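(* Let $\delta\in(0,1)$ and $\varepsilon=\Omega\left(\frac{1}{\mathrm{poly}\log n}\right)$. Assume the 1-vs-2-cycle conjecture. Then any component-stable MPC algorithm with $O(n^\delta)$ space per machine and $\mathrm{poly}(n)$ total space that solves the $\varepsilon$-almost-spanning forest problem with probability $1-\frac1n$ must take $\Omega\left(\log\frac1\varepsilon\right)$ rounds.
   Context: The $\varepsilon$-almost-spanning forest problem: given $0<\varepsilon<1$ and a graph $G$ on $n$ vertices each of whose connected components is a cycle or a path, with $c$ the number of cycles, remove a set of edges such that at least one edge of each cycle is removed and at most $c+\varepsilon n$ edges are removed in total. MPC model: machines with local memory $S$, synchronous rounds of local computation and communication with at most $S$ words sent and received per machine per round. Each vertex has a unique name and an ID which is only required to be unique within its connected component; a randomized MPC algorithm is component-stable if the output at each vertex $u$ is a function only of $n$, of the topology and vertex-ID assignment of $u$'s connected component, and of the random tape shared by all machines. The 1-vs-2-cycle conjecture: no MPC algorithm with $n^{1-\Omega(1)}$ local space and $\mathrm{poly}(n)$ machines can distinguish in $o(\log n)$ rounds whether the input is one cycle on $2n$ vertices or two cycles on $n$ vertices each. *)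

theory Defs
  imports "HOL-Probability.Probability_Mass_Function" "HOL-Library.Landau_Symbols"
begin

section \<open>Massively parallel computation\<close>

text \<open>
  A word is a natural number below \<open>word_range n\<close>; the range is polynomial in \<open>n\<close> wherever
  an algorithm is used below, so that a word has \<open>O(log n)\<close> bits.  Local computation is
  unrestricted, and algorithms may be non-uniform in the size parameter \<open>n\<close>.

  \<open>local_comp A n t i \<omega> m b\<close> is what machine \<open>i\<close> does in round \<open>t\<close> with memory \<open>m\<close>, received
  words \<open>b\<close> and shared random tape \<open>\<omega>\<close>: it returns its new memory and the words to be sent,
  each paired with the number of the machine it is sent to.
\<close>

record mpc_algorithm =
  machines    :: "nat \<Rightarrow> nat"
  local_space :: "nat \<Rightarrow> nat"
  word_range  :: "nat \<Rightarrow> nat"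
  tape_length :: "nat \<Rightarrow> nat"
  rounds      :: "nat \<Rightarrow> nat"
  local_comp  :: "nat \<Rightarrow> nat \<Rightarrow> nat \<Rightarrow> bool list \<Rightarrow> nat list \<Rightarrow> nat list
                    \<Rightarrow> nat list \<times> (nat \<times> nat) list"

definition tapes :: "mpc_algorithm \<Rightarrow> nat \<Rightarrow> bool list set" where
  "tapes A n = {\<omega>. length \<omega> = tape_length A n}"

text \<open>
  Memories and inboxes after \<open>t\<close> rounds.  An inbox lists the received words in the order of
  the sending machines; a machine that wants to identify itself has to do so in its words.
\<close>

fun config :: "mpc_algorithm \<Rightarrow> nat \<Rightarrow> bool list \<Rightarrow> (nat \<Rightarrow> nat list) \<Rightarrow> nat
                 \<Rightarrow> (nat \<Rightarrow> nat list) \<times> (nat \<Rightarrow> nat list)" where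
  "config A n \<omega> m0 0 = (m0, \<lambda>_. [])"
| "config A n \<omega> m0 (Suc t) =
     (let (m, b) = config A n \<omega> m0 t;
          res = (\<lambda>i. local_comp A n t i \<omega> (m i) (b i))
      in (\<lambda>i. fst (res i),
          \<lambda>i. concat (map (\<lambda>j. map snd (filter (\<lambda>(d, w). d = i) (snd (res j))))
                 [0..<machines A n])))"

definition memory_after where
  "memory_after A n \<omega> m0 t i = fst (config A n \<omega> m0 t) i"

definition inbox_after where
  "inbox_after A n \<omega> m0 t i = snd (config A n \<omega> m0 t) i"

definition sent_in_round :: "mpc_algorithm \<Rightarrow> nat \<Rightarrow> bool list \<Rightarrow> (nat \<Rightarrow> nat list) \<Rightarrow> nat \<Rightarrow> nat
    \<Rightarrow> (nat \<times> nat) list" where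
  "sent_in_round A n \<omega> m0 t i =
     snd (local_comp A n t i \<omega> (memory_after A n \<omega> m0 t i) (inbox_after A n \<omega> m0 t i))"

definition within_limits :: "mpc_algorithm \<Rightarrow> nat \<Rightarrow> bool list \<Rightarrow> (nat \<Rightarrow> nat list) \<Rightarrow> bool" where
  "within_limits A n \<omega> m0 \<longleftrightarrow>
     (\<forall>i<machines A n.
        (\<forall>t\<le>rounds A n.
           length (memory_after A n \<omega> m0 t i) \<le> local_space A n \<and>
           set (memory_after A n \<omega> m0 t i) \<subseteq> {..<word_range A n} \<and>
           length (inbox_after A n \<omega> m0 t i) \<le> local_space A n) \<and>
        (\<forall>t<rounds A n.
           length (sent_in_round A n \<omega> m0 t i) \<le> local_space A n \<and>
           set (sent_in_round A n \<omega> m0 t i) \<subseteq> {..<machines A n} \<times> {..<word_range A n}))"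

text \<open>
  The input is a finite set of records (lists of words), distributed over the machines in an
  arbitrary way that respects the local space.
\<close>

definition initial_memories ::
    "mpc_algorithm \<Rightarrow> nat \<Rightarrow> nat list set \<Rightarrow> (nat \<Rightarrow> nat list) set" where
  "initial_memories A n recs =
     {m0. \<exists>\<rho> :: nat \<Rightarrow> nat list list.
        distinct (concat (map \<rho> [0..<machines A n])) \<and>
        set (concat (map \<rho> [0..<machines A n])) = recs \<and>
        (\<forall>i. m0 i = concat (\<rho> i)) \<and>
        (\<forall>i<machines A n. length (m0 i) \<le> local_space A n)}"

text \<open>
  The output of an execution is the content of the memories after the last round, so local
  computation is needed, and hence at least one round is counted, even if nothing is communicated.
\<close>

definition mpc_output :: "mpc_algorithm \<Rightarrow> nat \<Rightarrow> bool list \<Rightarrow> (nat \<Rightarrow> nat list) \<Rightarrow> nat list list" where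
  "mpc_output A n \<omega> m0 = map (memory_after A n \<omega> m0 (rounds A n)) [0..<machines A n]"

text \<open>
  The first conjunct says that the input fits into the machines at all; without it an algorithm
  with too little memory would be vacuously correct.
\<close>

definition mpc_achieves ::
    "mpc_algorithm \<Rightarrow> nat \<Rightarrow> nat list set \<Rightarrow> real \<Rightarrow> (nat list list \<Rightarrow> bool) \<Rightarrow> bool" where
  "mpc_achieves A n recs p correct \<longleftrightarrow>
     initial_memories A n recs \<noteq> {} \<and>
     (\<forall>m0 \<in> initial_memories A n recs.
        (\<forall>\<omega> \<in> tapes A n. within_limits A n \<omega> m0) \<and>
        measure_pmf.prob (pmf_of_set (tapes A n)) {\<omega>. correct (mpc_output A n \<omega> m0)} \<ge> p)"

definition poly_bounded :: "(nat \<Rightarrow> nat) \<Rightarrow> bool" where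
  "poly_bounded f \<longleftrightarrow> (\<exists>k::nat. (\<lambda>n. real (f n)) \<in> O(\<lambda>n. real n ^ k))"


section \<open>Graphs whose components are paths and cycles\<close>

definition path_edges :: "nat list \<Rightarrow> nat set set" where
  "path_edges xs = {{xs ! i, xs ! Suc i} |i. Suc i < length xs}"

definition cycle_edges :: "nat list \<Rightarrow> nat set set" where
  "cycle_edges xs = insert {last xs, hd xs} (path_edges xs)"

definition simple_graph :: "nat set \<Rightarrow> nat set set \<Rightarrow> bool" where
  "simple_graph V E \<longleftrightarrow> finite V \<and> (\<forall>e\<in>E. \<exists>u\<in>V. \<exists>v\<in>V. u \<noteq> v \<and> e = {u, v})"

definition conn_comp :: "nat set set \<Rightarrow> nat \<Rightarrow> nat set" where
  "conn_comp E u = {v. (u, v) \<in> {(x, y). {x, y} \<in> E}\<^sup>*}"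

definition conn_comps :: "nat set \<Rightarrow> nat set set \<Rightarrow> nat set set" where
  "conn_comps V E = conn_comp E ` V"

definition edges_in :: "nat set set \<Rightarrow> nat set \<Rightarrow> nat set set" where
  "edges_in E C = {e \<in> E. e \<subseteq> C}"

text \<open>A single vertex counts as a path.\<close>

definition is_path_comp :: "nat set set \<Rightarrow> nat set \<Rightarrow> bool" where
  "is_path_comp E C \<longleftrightarrow> (\<exists>xs. distinct xs \<and> set xs = C \<and> edges_in E C = path_edges xs)"

definition is_cycle_comp :: "nat set set \<Rightarrow> nat set \<Rightarrow> bool" where
  "is_cycle_comp E C \<longleftrightarrow>
     (\<exists>xs. length xs \<ge> 3 \<and> distinct xs \<and> set xs = C \<and> edges_in E C = cycle_edges xs)"

definition path_cycle_graph :: "nat set \<Rightarrow> nat set set \<Rightarrow> bool" where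
  "path_cycle_graph V E \<longleftrightarrow>
     simple_graph V E \<and> (\<forall>C \<in> conn_comps V E. is_path_comp E C \<or> is_cycle_comp E C)"

definition cycle_comps :: "nat set \<Rightarrow> nat set set \<Rightarrow> nat set set" where
  "cycle_comps V E = {C \<in> conn_comps V E. is_cycle_comp E C}"


section \<open>The almost-spanning forest problem\<close>

definition almost_spanning_forest_solution ::
    "real \<Rightarrow> nat set \<Rightarrow> nat set set \<Rightarrow> nat set set \<Rightarrow> bool" where
  "almost_spanning_forest_solution \<epsilon> V E F \<longleftrightarrow>
     F \<subseteq> E \<and>
     (\<forall>C \<in> cycle_comps V E. F \<inter> edges_in E C \<noteq> {}) \<and>
     real (card F) \<le> real (card (cycle_comps V E)) + \<epsilon> * real (card V)"

text \<open>
  Vertices are identified with their (globally unique) names; \<open>ident v\<close> is the ID of \<open>v\<close>.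
  Names and IDs are words.
\<close>

definition forest_input ::
    "mpc_algorithm \<Rightarrow> nat \<Rightarrow> nat set \<Rightarrow> nat set set \<Rightarrow> (nat \<Rightarrow> nat) \<Rightarrow> bool" where
  "forest_input A n V E ident \<longleftrightarrow>
     path_cycle_graph V E \<and> card V = n \<and>
     V \<subseteq> {..<word_range A n} \<and> ident ` V \<subseteq> {..<word_range A n} \<and>
     (\<forall>C \<in> conn_comps V E. inj_on ident C)"

definition graph_records :: "nat set \<Rightarrow> nat set set \<Rightarrow> (nat \<Rightarrow> nat) \<Rightarrow> nat list set" where
  "graph_records V E ident =
     {[0, v, ident v] |v. v \<in> V} \<union> {[1, u, v] |u v. u < v \<and> {u, v} \<in> E}"

fun word_pairs :: "nat list \<Rightarrow> (nat \<times> nat) set" where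
  "word_pairs (u # v # ws) = insert (u, v) (word_pairs ws)"
| "word_pairs _ = {}"

text \<open>The final memories list the removed edges as pairs of names.\<close>

definition removed_edges :: "nat list list \<Rightarrow> nat set set" where
  "removed_edges mems = {{u, v} |u v. \<exists>m \<in> set mems. (u, v) \<in> word_pairs m}"

text \<open>
  The condition \<open>n \<le> word_range A n\<close> makes words large enough to name \<open>n\<close> vertices.
\<close>

definition solves_almost_spanning_forest :: "mpc_algorithm \<Rightarrow> nat \<Rightarrow> real \<Rightarrow> real \<Rightarrow> bool" where
  "solves_almost_spanning_forest A n \<epsilon> p \<longleftrightarrow>
     n \<le> word_range A n \<and>
     (\<forall>V E ident. forest_input A n V E ident \<longrightarrow>
        mpc_achieves A n (graph_records V E ident) p
          (\<lambda>mems. almost_spanning_forest_solution \<epsilon> V E (removed_edges mems)))"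

text \<open>
  The output at \<open>u\<close> consists of the IDs of those neighbours of \<open>u\<close> whose edge to \<open>u\<close> is removed.
  As IDs are unique within a component, the topology of the component of \<open>u\<close> together
  with its ID assignment is the graph obtained from it by replacing each vertex by its ID.
\<close>

definition output_at :: "nat set set \<Rightarrow> (nat \<Rightarrow> nat) \<Rightarrow> nat list list \<Rightarrow> nat \<Rightarrow> nat set" where
  "output_at E ident mems u = ident ` {v. {u, v} \<in> E \<and> {u, v} \<in> removed_edges mems}"

definition component_stable :: "mpc_algorithm \<Rightarrow> bool" where
  "component_stable A \<longleftrightarrow>
     (\<exists>f :: nat \<Rightarrow> nat set \<Rightarrow> nat set set \<Rightarrow> nat \<Rightarrow> bool list \<Rightarrow> nat set.
        \<forall>n V E ident. forest_input A n V E ident \<longrightarrow>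
          (\<forall>m0 \<in> initial_memories A n (graph_records V E ident). \<forall>\<omega> \<in> tapes A n. \<forall>u \<in> V.
             output_at E ident (mpc_output A n \<omega> m0) u =
             f n (ident ` conn_comp E u) ((`) ident ` edges_in E (conn_comp E u)) (ident u) \<omega>))"


section \<open>The 1-vs-2-cycle conjecture\<close>

definition edge_records :: "nat set set \<Rightarrow> nat list set" where
  "edge_records E = {[u, v] |u v. u < v \<and> {u, v} \<in> E}"

text \<open>Machine 0 answers 1 for one cycle and 0 for two cycles.\<close>

definition distinguishes_one_vs_two_cycles :: "mpc_algorithm \<Rightarrow> nat \<Rightarrow> real \<Rightarrow> bool" where
  "distinguishes_one_vs_two_cycles A n p \<longleftrightarrow>
     2 * n \<le> word_range A n \<and>
     (\<forall>xs. distinct xs \<and> length xs = 2 * n \<and> set xs \<subseteq> {..<word_range A n} \<longrightarrow>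
        mpc_achieves A n (edge_records (cycle_edges xs)) p (\<lambda>mems. mems ! 0 = [1])) \<and>
     (\<forall>xs ys. distinct (xs @ ys) \<and> length xs = n \<and> length ys = n \<and>
          set (xs @ ys) \<subseteq> {..<word_range A n} \<longrightarrow>
        mpc_achieves A n (edge_records (cycle_edges xs \<union> cycle_edges ys)) p
          (\<lambda>mems. mems ! 0 = [0]))"

text \<open>
  That no algorithm takes \<open>o(log n)\<close> rounds is read as the lower bound \<open>\<Omega>(log n)\<close> for every
  algorithm, so algorithms that are fast on infinitely many sizes only are excluded as well.
  Algorithms are randomized and succeed with probability \<open>1 - 1/n\<close>.
\<close>

definition one_vs_two_cycle_conjecture :: bool where
  "one_vs_two_cycle_conjecture \<longleftrightarrow>
     (\<forall>A \<gamma>. 0 < \<gamma> \<and>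
        (\<lambda>n. real (local_space A n)) \<in> O(\<lambda>n. real n powr (1 - \<gamma>)) \<and>
        poly_bounded (machines A) \<and> poly_bounded (word_range A) \<and>
        (\<forall>\<^sub>F n in sequentially. distinguishes_one_vs_two_cycles A n (1 - 1 / real n)) \<longrightarrow>
        (\<lambda>n. real (rounds A n)) \<in> \<Omega>(\<lambda>n. ln (real n)))"

end

theory Submission
  imports Defs "HOL-Library.Nat_Bijection" "HOL-Real_Asymp.Real_Asymp"
begin

text \<open>
  The algorithm \<open>A\<close> is turned into a deterministic algorithm that replaces a permutation of
  polynomially many nodes by its \<open>D\<close>-th power, with \<open>D\<close> a small power of \<open>1 / \<epsilon>\<close>, in
  \<open>rounds A n + O(1)\<close> rounds.  Iterating this on the two orientations of the cycles of the input
  separates one cycle of length \<open>2 N\<close> from two of length \<open>N = D ^ k\<close> after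
  \<open>k = log N / log D\<close> repetitions, so by the conjecture \<open>rounds A n\<close> is at least of the order of
  \<open>log D\<close>.

  Sensitivity.  As \<open>A\<close> is component-stable, a short path with given IDs gets the same output in
  every graph, in particular in one consisting of more than \<open>\<epsilon> n\<close> copies of it, so it is
  cut with probability at most \<open>1 / n\<close>.  A cycle with \<open>2 D + 2\<close> vertices must be cut somewhere.
  So for some fixed tape, the output cuts an edge of that cycle, but not the same edge in the
  paths around it that it contains.  To find out which walks of length \<open>D\<close> visit the layers
  \<open>0, ..., D\<close> of a layering one after the other, take two copies of the walks that respect
  the layering and join them at both ends: exactly the complete walks become cycles, and this is
  seen at their starting point.  A family of \<open>N powr o(1)\<close> layerings, all treated in parallel,
  identifies the end of every walk.  Here \<open>1 / \<epsilon>\<close> must be polylogarithmic.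

  The conjecture constrains algorithms that are correct for almost all sizes, so it is
  applied to the shortest correct program of each size; a token walking around the cycle shows
  that there is one.
\<close>

section \<open>Disjoint unions of paths and cycles\<close>

text \<open>Inputs may contain only paths and cycles, so completeness of a walk has to appear as the
  difference between a path and a cycle; this is the reason for doubling. An incomplete walk then
  gives a path reaching equally far on both sides of the watched edge, so that only
  \<open>D + 1\<close> paths per edge must be excluded when the tape is chosen. Since IDs are unique
  only within a component, they can be assigned by layer in advance, although it is unknown which
  walks are complete. Tape, IDs, layerings and programs are fixed non-uniformly, so their mere
  existence, by counting and union bounds, is enough. The number of layerings, about
  \<open>(D + 1) ^ (D + 2)\<close> up to smaller factors, is \<open>N powr o(1)\<close> as long as
  \<open>D\<close> is at most the square root of \<open>log n\<close>; this dictates the small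
  exponent in the choice of \<open>D\<close>. The additive constant of each phase is harmless
  because \<open>rounds A n\<close> is at least 1.\<close>

definition comp_edges :: "bool \<Rightarrow> nat list \<Rightarrow> nat set set" where
  "comp_edges c xs = (if c then cycle_edges xs else path_edges xs)"

lemma path_edges_subset: "e \<in> path_edges xs \<Longrightarrow> e \<subseteq> set xs"
  by (auto simp: path_edges_def)

lemma comp_edges_subset:
  assumes "e \<in> comp_edges c xs" "xs \<noteq> []"
  shows "e \<subseteq> set xs"
  using assms path_edges_subset by (fastforce simp: comp_edges_def cycle_edges_def split: if_splits)

lemma path_edges_nonempty: "e \<in> path_edges xs \<Longrightarrow> e \<noteq> {}"
  by (auto simp: path_edges_def)

lemma comp_edges_nonempty: "e \<in> comp_edges c xs \<Longrightarrow> e \<noteq> {}"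
  using path_edges_nonempty by (auto simp: comp_edges_def cycle_edges_def split: if_splits)

lemma comp_edges_proper:
  assumes "e \<in> comp_edges c xs" "distinct xs" "c \<Longrightarrow> length xs \<ge> 3"
  shows "\<exists>u\<in>set xs. \<exists>v\<in>set xs. u \<noteq> v \<and> e = {u, v}"
proof -
  have p: "\<exists>u\<in>set xs. \<exists>v\<in>set xs. u \<noteq> v \<and> e = {u, v}" if "e \<in> path_edges xs"
    using that assms(2) unfolding path_edges_def
    by (smt (verit, ccfv_SIG) Suc_lessD mem_Collect_eq n_not_Suc_n nth_eq_iff_index_eq nth_mem)
  show ?thesis
  proof (cases "c \<and> e = {last xs, hd xs}")
    case True
    then have l: "length xs \<ge> 3" using assms(3) by simp
    then have "xs \<noteq> []" by auto
    moreover have "last xs \<noteq> hd xs"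
      using l assms(2) by (simp add: last_conv_nth hd_conv_nth nth_eq_iff_index_eq \<open>xs \<noteq> []\<close>)
    ultimately show ?thesis using True
      by (metis hd_in_set last_in_set)
  next
    case False
    then show ?thesis using assms(1) p by (auto simp: comp_edges_def cycle_edges_def split: if_splits)
  qed
qed

lemma path_edges_map: "path_edges (map g xs) = (`) g ` path_edges xs"
proof -
  have "path_edges (map g xs) = {{map g xs ! i, map g xs ! Suc i} |i. Suc i < length xs}"
    by (simp add: path_edges_def)
  also have "\<dots> = (\<lambda>i. {map g xs ! i, map g xs ! Suc i}) ` {i. Suc i < length xs}"
    by blast
  also have "\<dots> = (\<lambda>i. {g (xs ! i), g (xs ! Suc i)}) ` {i. Suc i < length xs}"
    by (intro image_cong) auto
  finally have "path_edges (map g xs) = (\<lambda>i. {g (xs ! i), g (xs ! Suc i)}) ` {i. Suc i < length xs}" .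
  moreover have "path_edges xs = (\<lambda>i. {xs ! i, xs ! Suc i}) ` {i. Suc i < length xs}"
    by (auto simp: path_edges_def)
  ultimately show ?thesis by (simp add: image_image)
qed

lemma comp_edges_map:
  assumes "xs \<noteq> []"
  shows "comp_edges c (map g xs) = (`) g ` comp_edges c xs"
  using assms by (auto simp: comp_edges_def cycle_edges_def path_edges_map last_map hd_map)

lemma path_edges_Nil [simp]: "path_edges [] = {}"
  and path_edges_single [simp]: "path_edges [x] = {}"
  by (auto simp: path_edges_def)

lemma path_edges_Cons2 [simp]: "path_edges (x # y # ys) = insert {x, y} (path_edges (y # ys))"
proof -
  have "path_edges (x # zs) = (\<lambda>i. {(x # zs) ! i, (x # zs) ! Suc i}) ` {..<length zs}" for x and zs :: "nat list"
    by (auto simp: path_edges_def)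
  note * = this
  show ?thesis unfolding * by (simp add: lessThan_Suc_eq_insert_0 image_image)
qed

lemma path_edges_append:
  assumes "xs \<noteq> []" "ys \<noteq> []"
  shows "path_edges (xs @ ys) = insert {last xs, hd ys} (path_edges xs \<union> path_edges ys)"
  using assms
proof (induction xs)
  case (Cons x xs)
  then show ?case
    by (cases xs; cases ys) auto
qed simp

lemma path_edges_rev: "path_edges (rev xs) = path_edges xs"
proof (induction xs rule: induct_list012)
  case (3 x y zs)
  have "path_edges (rev (x # y # zs)) = path_edges ((rev zs @ [y]) @ [x])" by simp
  also have "\<dots> = insert {y, x} (path_edges (rev (y # zs)))"
    by (subst path_edges_append) auto
  finally show ?case using 3 by (simp add: insert_commute)
qed auto

lemma cycle_edges_rotate:
  assumes "xs \<noteq> []" "ys \<noteq> []"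
  shows "cycle_edges (xs @ ys) = cycle_edges (ys @ xs)"
  using assms by (simp add: cycle_edges_def path_edges_append) blast

lemma card_path_edges_less:
  assumes "xs \<noteq> []"
  shows "card (path_edges xs) < length xs"
proof -
  have "path_edges xs = (\<lambda>i. {xs ! i, xs ! Suc i}) ` {..<length xs - 1}"
    using assms by (auto simp: path_edges_def)
  then have "card (path_edges xs) \<le> length xs - 1"
    by (metis card_image_le card_lessThan finite_lessThan)
  then show ?thesis using assms by (cases xs) auto
qed

lemma cycle_edges_nth:
  assumes "xs \<noteq> []"
  shows "cycle_edges xs = (\<lambda>i. {xs ! i, xs ! (Suc i mod length xs)}) ` {..<length xs}"
proof -
  obtain m where m: "length xs = Suc m" using assms by (cases xs) auto
  have "path_edges xs = (\<lambda>i. {xs ! i, xs ! Suc i}) ` {..<m}"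
    using m by (auto simp: path_edges_def)
  also have "\<dots> = (\<lambda>i. {xs ! i, xs ! (Suc i mod length xs)}) ` {..<m}"
    using m by (intro image_cong) auto
  finally show ?thesis using m assms
    by (simp add: cycle_edges_def lessThan_Suc last_conv_nth hd_conv_nth)
qed

text \<open>Two positions could yield the same edge only in opposite directions; then each is the
  successor of the other modulo the length, which needs length at most 2. With
  \<open>card_path_edges_less\<close>, counting edges tells cycles from paths.\<close>

lemma card_cycle_edges:
  assumes "distinct xs" "length xs \<ge> 3"
  shows "card (cycle_edges xs) = length xs"
proof -
  let ?l = "length xs"
  have ne: "xs \<noteq> []" using assms by auto
  have "inj_on (\<lambda>i. {xs ! i, xs ! (Suc i mod ?l)}) {..<?l}"
  proof (rule inj_onI)
    fix i j assume ij: "i \<in> {..<?l}" "j \<in> {..<?l}"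
      and eq: "{xs ! i, xs ! (Suc i mod ?l)} = {xs ! j, xs ! (Suc j mod ?l)}"
    have "Suc i mod ?l < ?l" "Suc j mod ?l < ?l" using ne by auto
    then have "i = j \<or> (i = Suc j mod ?l \<and> j = Suc i mod ?l)"
      using eq ij assms(1) by (auto simp: doubleton_eq_iff nth_eq_iff_index_eq)
    moreover have "i = j" if "i = Suc j mod ?l" "j = Suc i mod ?l"
    proof -
      have *: "Suc i mod ?l = (if Suc i = ?l then 0 else Suc i)" "Suc j mod ?l = (if Suc j = ?l then 0 else Suc j)"
        using ij by auto
      have a: "if Suc j = ?l then i = 0 else i = Suc j" using trans[OF that(1) *(2)] by simp
      have b: "if Suc i = ?l then j = 0 else j = Suc i" using trans[OF that(2) *(1)] by simp
      have "Suc j = ?l \<and> i = 0 \<or> i = Suc j" "Suc i = ?l \<and> j = 0 \<or> j = Suc i" using a b by metis+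
      then show ?thesis using assms(2) by linarith
    qed
    ultimately show "i = j" by blast
  qed
  then show ?thesis by (simp add: cycle_edges_nth[OF ne] card_image)
qed

lemma path_edges_reach:
  assumes "path_edges xs \<subseteq> E" "x \<in> set xs" "y \<in> set xs"
  shows "y \<in> conn_comp E x"
proof -
  let ?R = "{(x, y). {x, y} \<in> E}"
  have up: "(xs ! i, xs ! (i + k)) \<in> ?R\<^sup>*" if "i + k < length xs" for i k
    using that
  proof (induction k)
    case (Suc k)
    then have "{xs ! (i + k), xs ! (i + Suc k)} \<in> E"
      using assms(1) by (auto simp: path_edges_def)
    then show ?case using Suc by (auto intro: rtrancl_into_rtrancl)
  qed simp
  have "sym ?R" by (auto simp: sym_def insert_commute)
  then have sym: "sym (?R\<^sup>*)" by (rule sym_rtrancl)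
  obtain i j where ij: "i < length xs" "x = xs ! i" "j < length xs" "y = xs ! j"
    using assms by (metis in_set_conv_nth)
  have "(x, y) \<in> ?R\<^sup>*"
    using up[of i "j - i"] up[of j "i - j"] ij sym by (cases "i \<le> j") (auto dest: symD)
  then show ?thesis by (simp add: conn_comp_def)
qed

text \<open>Every graph below is assembled from explicit disjoint vertex lists. Components, their
  edges and the set of cycles are then read off from the lists instead of being derived from
  reachability each time.\<close>

locale path_cycle_family =
  fixes K :: "nat list set" and cyc :: "nat list \<Rightarrow> bool" and V :: "nat set" and E :: "nat set set"
  assumes finite_family: "finite K"
    and nonempty: "xs \<in> K \<Longrightarrow> xs \<noteq> []"
    and distinct: "xs \<in> K \<Longrightarrow> distinct xs"
    and cyc_length: "xs \<in> K \<Longrightarrow> cyc xs \<Longrightarrow> length xs \<ge> 3"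
    and disjoint: "xs \<in> K \<Longrightarrow> ys \<in> K \<Longrightarrow> x \<in> set xs \<Longrightarrow> x \<in> set ys \<Longrightarrow> xs = ys"
    and V_eq: "V = (\<Union>xs\<in>K. set xs)"
    and E_eq: "E = (\<Union>xs\<in>K. comp_edges (cyc xs) xs)"
begin

lemma edge_in_component:
  assumes "xs \<in> K" "u \<in> set xs" "{u, v} \<in> E"
  shows "v \<in> set xs" "{u, v} \<in> comp_edges (cyc xs) xs"
proof -
  obtain ys where ys: "ys \<in> K" "{u, v} \<in> comp_edges (cyc ys) ys" using assms(3) E_eq by auto
  then have "{u, v} \<subseteq> set ys" using comp_edges_subset nonempty by blast
  then have "ys = xs" using assms ys disjoint by auto
  then show "v \<in> set xs" "{u, v} \<in> comp_edges (cyc xs) xs" using ys \<open>{u, v} \<subseteq> set ys\<close> by auto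
qed

lemma conn_comp_eq:
  assumes "xs \<in> K" "u \<in> set xs"
  shows "conn_comp E u = set xs"
proof
  have "v \<in> set xs" if "(u, v) \<in> {(x, y). {x, y} \<in> E}\<^sup>*" for v
    using that by (induction rule: rtrancl_induct) (use assms edge_in_component(1) in auto)
  then show "conn_comp E u \<subseteq> set xs" by (auto simp: conn_comp_def)
  have "path_edges xs \<subseteq> E" using assms(1) E_eq by (auto simp: comp_edges_def cycle_edges_def)
  then show "set xs \<subseteq> conn_comp E u" using path_edges_reach assms(2) by blast
qed

lemma edges_in_eq:
  assumes "xs \<in> K"
  shows "edges_in E (set xs) = comp_edges (cyc xs) xs"
proof
  show "comp_edges (cyc xs) xs \<subseteq> edges_in E (set xs)"
    using assms comp_edges_subset nonempty E_eq by (fastforce simp: edges_in_def)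
  show "edges_in E (set xs) \<subseteq> comp_edges (cyc xs) xs"
  proof
    fix e assume e: "e \<in> edges_in E (set xs)"
    then obtain ys where ys: "ys \<in> K" "e \<in> comp_edges (cyc ys) ys" by (auto simp: edges_in_def E_eq)
    then obtain x where "x \<in> e" using comp_edges_nonempty by blast
    then have "x \<in> set ys" "x \<in> set xs" using ys comp_edges_subset nonempty e by (auto simp: edges_in_def)
    then show "e \<in> comp_edges (cyc xs) xs" using disjoint assms ys by blast
  qed
qed

lemma conn_comps_eq: "conn_comps V E = set ` K"
proof -
  have "conn_comps V E = (\<Union>xs\<in>K. conn_comp E ` set xs)" by (auto simp: conn_comps_def V_eq)
  also have "\<dots> = (\<Union>xs\<in>K. {set xs})"
  proof (rule SUP_cong)
    fix xs assume "xs \<in> K"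
    then have "conn_comp E ` set xs = (\<lambda>_. set xs) ` set xs" using conn_comp_eq by (intro image_cong) auto
    then show "conn_comp E ` set xs = {set xs}" using nonempty[OF \<open>xs \<in> K\<close>] by (simp add: image_constant_conv)
  qed simp
  finally show ?thesis by auto
qed

lemma path_cycle_graph: "path_cycle_graph V E"
proof -
  have "simple_graph V E"
    unfolding simple_graph_def
  proof (intro conjI ballI)
    show "finite V" using finite_family by (auto simp: V_eq)
    fix e assume "e \<in> E"
    then obtain xs where xs: "xs \<in> K" "e \<in> comp_edges (cyc xs) xs" using E_eq by auto
    have "\<exists>u\<in>set xs. \<exists>v\<in>set xs. u \<noteq> v \<and> e = {u, v}"
      by (rule comp_edges_proper[OF xs(2)]) (use distinct cyc_length xs in auto)
    then show "\<exists>u\<in>V. \<exists>v\<in>V. u \<noteq> v \<and> e = {u, v}"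
      using xs(1) V_eq by blast
  qed
  moreover have "is_path_comp E C \<or> is_cycle_comp E C" if C: "C \<in> conn_comps V E" for C
  proof -
    obtain xs where "xs \<in> K" "C = set xs" using C by (auto simp: conn_comps_eq)
    then show ?thesis
      using edges_in_eq[of xs] distinct[of xs] cyc_length[of xs]
      by (auto simp: is_path_comp_def is_cycle_comp_def comp_edges_def split: if_splits)
  qed
  ultimately show ?thesis by (auto simp: path_cycle_graph_def)
qed

text \<open>\<open>is_cycle_comp\<close> asks for some enumeration of the vertices, so a path has to
  be shown not to be a cycle in another order: it has too few edges.\<close>

lemma cycle_comps_eq: "cycle_comps V E = set ` {xs \<in> K. cyc xs}"
proof -
  have "is_cycle_comp E (set xs) \<longleftrightarrow> cyc xs" if "xs \<in> K" for xs
  proof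
    assume "cyc xs"
    then show "is_cycle_comp E (set xs)"
      using edges_in_eq[of xs] distinct[of xs] cyc_length[of xs] that
      by (auto simp: is_cycle_comp_def comp_edges_def)
  next
    assume "is_cycle_comp E (set xs)"
    then obtain ys where ys: "length ys \<ge> 3" "distinct ys" "set ys = set xs"
      "edges_in E (set xs) = cycle_edges ys"
      unfolding is_cycle_comp_def by blast
    then have "card (comp_edges (cyc xs) xs) = length xs"
      using card_cycle_edges[of ys] distinct[OF that] edges_in_eq[OF that] by (metis distinct_card)
    then show "cyc xs" using card_path_edges_less[OF nonempty[OF that]]
      by (auto simp: comp_edges_def split: if_splits)
  qed
  then show ?thesis by (auto simp: cycle_comps_def conn_comps_eq)
qed

end

section \<open>Cutting one edge of a cycle but not of the paths it contains\<close>

lemma path_edges_nthI: "Suc i < length xs \<Longrightarrow> {xs ! i, xs ! Suc i} \<in> path_edges xs"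
  by (auto simp: path_edges_def)

lemma finite_tapes: "finite (tapes A n)" and tapes_nonempty: "tapes A n \<noteq> {}"
proof -
  show "finite (tapes A n)"
    using finite_lists_length_eq[of "UNIV :: bool set" "tape_length A n"] by (simp add: tapes_def)
  have "replicate (tape_length A n) True \<in> tapes A n" by (simp add: tapes_def)
  then show "tapes A n \<noteq> {}" by blast
qed

lemma prob_tapes_mono:
  assumes "\<And>\<omega>. \<omega> \<in> tapes A n \<Longrightarrow> P \<omega> \<Longrightarrow> Q \<omega>"
  shows "measure_pmf.prob (pmf_of_set (tapes A n)) {\<omega>. P \<omega>}
    \<le> measure_pmf.prob (pmf_of_set (tapes A n)) {\<omega>. Q \<omega>}"
proof -
  let ?p = "pmf_of_set (tapes A n)"
  have "measure_pmf.prob ?p {\<omega>. P \<omega>} = measure_pmf.prob ?p ({\<omega>. P \<omega>} \<inter> set_pmf ?p)"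
    by (simp add: measure_Int_set_pmf)
  also have "\<dots> \<le> measure_pmf.prob ?p {\<omega>. Q \<omega>}"
    by (rule measure_pmf.finite_measure_mono)
      (use assms in \<open>auto simp: set_pmf_of_set finite_tapes tapes_nonempty\<close>)
  finally show ?thesis .
qed

type_synonym stable_output = "nat \<Rightarrow> nat set \<Rightarrow> nat set set \<Rightarrow> nat \<Rightarrow> bool list \<Rightarrow> nat set"

text \<open>Component stability with the output function exposed: sensitivity is a property of this
  function, and it has to be the same function in all graphs that are compared.\<close>

definition stable_witness :: "mpc_algorithm \<Rightarrow> stable_output \<Rightarrow> bool" where
  "stable_witness A f \<longleftrightarrow> (\<forall>n V E ident. forest_input A n V E ident \<longrightarrow>
     (\<forall>m0 \<in> initial_memories A n (graph_records V E ident). \<forall>\<omega> \<in> tapes A n. \<forall>u \<in> V.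
       output_at E ident (mpc_output A n \<omega> m0) u =
       f n (ident ` conn_comp E u) ((`) ident ` edges_in E (conn_comp E u)) (ident u) \<omega>))"

context path_cycle_family
begin

lemma forest_inputI:
  assumes "card V = n" "V \<subseteq> {..<word_range A n}" "ident ` V \<subseteq> {..<word_range A n}"
    and "\<And>xs. xs \<in> K \<Longrightarrow> distinct (map ident xs)"
  shows "forest_input A n V E ident"
  using assms path_cycle_graph by (auto simp: forest_input_def conn_comps_eq distinct_map)

text \<open>The output at \<open>u\<close> is a set of IDs; injectivity of \<open>ident\<close> on
  the component turns membership back into the removal of an edge. The right-hand side mentions the
  component only through its ID list, so it can be compared between different graphs.\<close>

lemma removed_iff_stable_output:
  assumes "stable_witness A f" "forest_input A n V E ident"
    and "m0 \<in> initial_memories A n (graph_records V E ident)" "\<omega> \<in> tapes A n"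
    and xs: "xs \<in> K" "u \<in> set xs" and uv: "{u, v} \<in> E"
  shows "{u, v} \<in> removed_edges (mpc_output A n \<omega> m0) \<longleftrightarrow>
    ident v \<in> f n (set (map ident xs)) (comp_edges (cyc xs) (map ident xs)) (ident u) \<omega>"
proof -
  let ?R = "removed_edges (mpc_output A n \<omega> m0)"
  have "u \<in> V" using xs V_eq by auto
  then have "output_at E ident (mpc_output A n \<omega> m0) u =
      f n (ident ` conn_comp E u) ((`) ident ` edges_in E (conn_comp E u)) (ident u) \<omega>"
    using assms by (auto simp: stable_witness_def)
  also have "\<dots> = f n (set (map ident xs)) (comp_edges (cyc xs) (map ident xs)) (ident u) \<omega>"
    using conn_comp_eq[OF xs] edges_in_eq[OF xs(1)] comp_edges_map[OF nonempty[OF xs(1)]] by simp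
  finally have out: "output_at E ident (mpc_output A n \<omega> m0) u = \<dots>" .
  have inj: "inj_on ident (set xs)"
    using assms(2) xs(1) by (auto simp: forest_input_def conn_comps_eq)
  have "v \<in> set xs" using edge_in_component(1)[OF xs uv] .
  moreover have "{v. {u, v} \<in> E \<and> {u, v} \<in> ?R} \<subseteq> set xs" using edge_in_component(1)[OF xs] by auto
  ultimately have "ident v \<in> ident ` {v. {u, v} \<in> E \<and> {u, v} \<in> ?R} \<longleftrightarrow> {u, v} \<in> E \<and> {u, v} \<in> ?R"
    using inj_on_image_mem_iff[OF inj] by simp
  then show ?thesis using uv out by (simp add: output_at_def)
qed

end

text \<open>Disjoint copies of \<open>p\<close> with the same IDs fill the graph. The tape is
  shared, so a tape that cuts the edge in one copy cuts it in all. Without cycles at most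
  \<open>\<epsilon> * n\<close> edges may be removed, fewer than there are copies, so all these
  tapes are failures.\<close>

lemma prob_path_cut_le:
  assumes stable: "stable_witness A f"
    and solves: "solves_almost_spanning_forest A n \<epsilon> (1 - 1 / real n)"
    and p: "distinct p" "p \<noteq> []" "set p \<subseteq> {..<n}"
    and long: "2 * length p \<le> n" and eps: "2 * real (length p) * \<epsilon> < 1"
    and e: "{u, v} \<in> path_edges p" "u \<in> set p"
  shows "measure_pmf.prob (pmf_of_set (tapes A n)) {\<omega>. v \<in> f n (set p) (path_edges p) u \<omega>} \<le> 1 / real n"
proof -
  let ?l = "length p" let ?q = "n div ?l"
  define copy where "copy j = [j * ?l..<j * ?l + ?l]" for j
  define K where "K = copy ` {..<?q} \<union> (\<lambda>v. [v]) ` {?q * ?l..<n}"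
  \<comment> \<open>The leftover isolated vertices all get ID 0, which is allowed because IDs need
    to differ only within a component.\<close>
  define ident where "ident v = (if v < ?q * ?l then p ! (v mod ?l) else 0)" for v
  define E where "E = (\<Union>xs\<in>K. path_edges xs)"
  have l: "0 < ?l" using p by simp
  have ql: "?q * ?l \<le> n" by (rule div_times_less_eq_dividend)
  have jl: "j * ?l + ?l \<le> ?q * ?l" if "j < ?q" for j
    using mult_le_mono1[of "Suc j" ?q ?l] that by simp
  have copy_set: "x \<in> set (copy j) \<longleftrightarrow> x div ?l = j" for x j
  proof -
    have "x div ?l = j" if "j * ?l \<le> x" "x < j * ?l + ?l"
      by (rule div_nat_eqI) (use that in \<open>simp_all add: mult.commute\<close>)
    moreover have "x div ?l * ?l \<le> x" "x < x div ?l * ?l + ?l"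
      using dividend_less_div_times[OF l, of x] by simp_all
    ultimately show ?thesis by (auto simp: copy_def)
  qed
  have V_eq: "{..<n} = (\<Union>xs\<in>K. set xs)"
  proof
    show "{..<n} \<subseteq> (\<Union>xs\<in>K. set xs)"
    proof
      fix x assume x: "x \<in> {..<n}"
      show "x \<in> (\<Union>xs\<in>K. set xs)"
      proof (cases "x < ?q * ?l")
        case True
        then have "x div ?l < ?q" by (simp add: less_mult_imp_div_less)
        then show ?thesis using copy_set[of x "x div ?l"] by (auto simp: K_def)
      qed (use x in \<open>auto simp: K_def\<close>)
    qed
    show "(\<Union>xs\<in>K. set xs) \<subseteq> {..<n}"
    proof
      fix x assume "x \<in> (\<Union>xs\<in>K. set xs)"
      then consider j where "j < ?q" "x < j * ?l + ?l" | "x < n" by (auto simp: K_def copy_def)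
      then show "x \<in> {..<n}"
      proof cases
        case 1
        have "x < n" using jl[OF 1(1)] ql 1(2) by linarith
        then show ?thesis by simp
      qed simp
    qed
  qed
  interpret path_cycle_family K "\<lambda>_. False" "{..<n}" E
  proof
    show "xs = ys" if "xs \<in> K" "ys \<in> K" "x \<in> set xs" "x \<in> set ys" for xs ys x
    proof -
      have "(\<exists>j<?q. xs = copy j \<and> x < ?q * ?l) \<or> (xs = [x] \<and> \<not> x < ?q * ?l)" if "xs \<in> K" "x \<in> set xs" for xs
        using that jl by (fastforce simp: K_def copy_def)
      then show ?thesis using that copy_set by metis
    qed
    show "{..<n} = (\<Union>xs\<in>K. set xs)" by (fact V_eq)
    have "copy j \<noteq> []" for j using p by (simp add: copy_def)
    then show "xs \<noteq> []" if "xs \<in> K" for xs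
      using that unfolding K_def by (metis Un_iff image_iff list.distinct(1))
  qed (use l in \<open>auto simp: K_def copy_def E_def comp_edges_def\<close>)
  have ident_copy: "map ident (copy j) = p" if "j < ?q" for j
    by (rule nth_equalityI) (use jl[OF that] in \<open>auto simp: copy_def ident_def\<close>)
  have W: "n \<le> word_range A n" using solves by (simp add: solves_almost_spanning_forest_def)
  have inp: "forest_input A n {..<n} E ident"
  proof (rule forest_inputI)
    have "ident v < n" if "v < n" for v
      using p l that by (auto simp: ident_def subset_iff)
    then show "ident ` {..<n} \<subseteq> {..<word_range A n}" using W by fastforce
    show "distinct (map ident xs)" if "xs \<in> K" for xs
      using that ident_copy p by (auto simp: K_def simp del: distinct_map)
  qed (use W in auto)
  then have ach: "mpc_achieves A n (graph_records {..<n} E ident) (1 - 1 / real n)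
      (\<lambda>mems. almost_spanning_forest_solution \<epsilon> {..<n} E (removed_edges mems))"
    using solves by (auto simp: solves_almost_spanning_forest_def)
  then obtain m0 where m0: "m0 \<in> initial_memories A n (graph_records {..<n} E ident)"
    by (auto simp: mpc_achieves_def)
  let ?prob = "measure_pmf.prob (pmf_of_set (tapes A n))"
  let ?R = "\<lambda>\<omega>. removed_edges (mpc_output A n \<omega> m0)"
  have good: "?prob {\<omega>. almost_spanning_forest_solution \<epsilon> {..<n} E (?R \<omega>)} \<ge> 1 - 1 / real n"
    using ach m0 by (auto simp: mpc_achieves_def)
  obtain i where i: "Suc i < ?l" "{u, v} = {p ! i, p ! Suc i}" using e by (auto simp: path_edges_def)
  have bad: "\<not> almost_spanning_forest_solution \<epsilon> {..<n} E (?R \<omega>)"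
    if \<omega>: "\<omega> \<in> tapes A n" and cut: "v \<in> f n (set p) (path_edges p) u \<omega>" for \<omega>
  proof
    assume sol: "almost_spanning_forest_solution \<epsilon> {..<n} E (?R \<omega>)"
    have mem: "{j * ?l + i, j * ?l + Suc i} \<in> ?R \<omega>" if j: "j < ?q" for j
    proof -
      have c: "copy j \<in> K" using j by (auto simp: K_def)
      have ed: "{j * ?l + i, j * ?l + Suc i} \<in> E"
        using path_edges_nthI[of i "copy j"] i(1) c by (auto simp: E_def copy_def)
      have s: "j * ?l + i \<in> set (copy j)" "j * ?l + Suc i \<in> set (copy j)" using i(1) by (auto simp: copy_def)
      have id: "ident (j * ?l + i) = p ! i" "ident (j * ?l + Suc i) = p ! Suc i"
        using i(1) jl[OF j] by (auto simp: ident_def)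
      note r = removed_iff_stable_output[OF stable inp m0 \<omega> c]
      consider "u = p ! i" "v = p ! Suc i" | "u = p ! Suc i" "v = p ! i"
        using i(2) by (auto simp: doubleton_eq_iff)
      then show ?thesis
      proof cases
        case 1
        then show ?thesis using r[OF s(1) ed] cut id ident_copy[OF j]
          by (simp add: comp_edges_def del: set_map)
      next
        case 2
        then show ?thesis using r[OF s(2), of "j * ?l + i"] ed cut id ident_copy[OF j]
          by (simp add: comp_edges_def insert_commute del: set_map)
      qed
    qed
    have "inj_on (\<lambda>j. {j * ?l + i, j * ?l + Suc i}) {..<?q}"
      using l by (auto simp: inj_on_def doubleton_eq_iff)
    then have c: "card ((\<lambda>j. {j * ?l + i, j * ?l + Suc i}) ` {..<?q}) = ?q"
      by (simp add: card_image)
    have fin: "finite (?R \<omega>)"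
    proof (rule finite_subset)
      show "?R \<omega> \<subseteq> E" using sol by (simp add: almost_spanning_forest_solution_def)
      have "finite (path_edges xs)" for xs
        by (rule finite_subset[of _ "Pow (set xs)"]) (use path_edges_subset in auto)
      then show "finite E" using finite_family by (simp add: E_def)
    qed
    have "(\<lambda>j. {j * ?l + i, j * ?l + Suc i}) ` {..<?q} \<subseteq> ?R \<omega>" using mem by auto
    from card_mono[OF fin this] c have "?q \<le> card (?R \<omega>)" by simp
    moreover have "card (cycle_comps {..<n} E) = 0" by (simp add: cycle_comps_eq)
    moreover have "real (card (?R \<omega>)) \<le> real (card (cycle_comps {..<n} E)) + \<epsilon> * real (card {..<n})"
      using sol unfolding almost_spanning_forest_solution_def by blast
    ultimately have q_le: "real ?q \<le> \<epsilon> * real n" by simp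
    \<comment> \<open>At least one copy fits, so rounding down loses at most a factor 2:
      \<open>n < l * (q + 1) \<le> l * (2 * q)\<close>.\<close>
    have "real n < 2 * real ?l * real ?q"
    proof -
      have "n < ?l * Suc ?q" using dividend_less_times_div[OF l, of n] by simp
      moreover have "0 < ?q" using long l by (simp add: div_greater_zero_iff)
      then have "?l * Suc ?q \<le> ?l * (2 * ?q)" by (intro mult_le_mono2) simp
      ultimately have "n < ?l * (2 * ?q)" by linarith
      then have "real n < real (?l * (2 * ?q))" by (simp only: of_nat_less_iff)
      then show ?thesis by (simp add: mult.assoc mult.left_commute)
    qed
    moreover have "2 * real ?l * real ?q \<le> 2 * real ?l * (\<epsilon> * real n)"
      using q_le by (intro mult_left_mono) auto
    ultimately have "real n < (2 * real ?l * \<epsilon>) * real n" by (simp add: mult.assoc)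
    moreover have "(2 * real ?l * \<epsilon>) * real n \<le> 1 * real n" using eps by (intro mult_right_mono) auto
    ultimately show False by simp
  qed
  have "?prob {\<omega>. v \<in> f n (set p) (path_edges p) u \<omega>}
      \<le> ?prob {\<omega>. \<not> almost_spanning_forest_solution \<epsilon> {..<n} E (?R \<omega>)}"
    by (rule prob_tapes_mono) (use bad in auto)
  also have "\<dots> = 1 - ?prob {\<omega>. almost_spanning_forest_solution \<epsilon> {..<n} E (?R \<omega>)}"
    by (subst measure_pmf.prob_compl[symmetric]) (auto simp: Compl_eq_Diff_UNIV[symmetric] Collect_neg_eq)
  finally show ?thesis using good by simp
qed

text \<open>Isolated vertices pad the cycle to \<open>n\<close> vertices and names serve as IDs.
  Every solution has to cut the only cycle.\<close>

lemma prob_cycle_cut_ge: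
  assumes stable: "stable_witness A f"
    and solves: "solves_almost_spanning_forest A n \<epsilon> (1 - 1 / real n)"
    and xs: "distinct xs" "length xs \<ge> 3" "set xs \<subseteq> {..<n}"
  shows "measure_pmf.prob (pmf_of_set (tapes A n))
     {\<omega>. \<exists>u\<in>set xs. \<exists>v. {u, v} \<in> cycle_edges xs \<and> v \<in> f n (set xs) (cycle_edges xs) u \<omega>} \<ge> 1 - 1 / real n"
proof -
  define K where "K = insert xs ((\<lambda>v. [v]) ` ({..<n} - set xs))"
  define E where "E = cycle_edges xs"
  have ne: "xs \<noteq> []" using xs by auto
  interpret path_cycle_family K "\<lambda>ys. ys = xs" "{..<n}" E
  proof
    show "ys = zs" if "ys \<in> K" "zs \<in> K" "x \<in> set ys" "x \<in> set zs" for ys zs x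
      using that by (auto simp: K_def)
    show "E = (\<Union>ys\<in>K. comp_edges (ys = xs) ys)" using xs by (auto simp: K_def E_def comp_edges_def)
  qed (use xs ne in \<open>auto simp: K_def\<close>)
  have W: "n \<le> word_range A n" using solves by (simp add: solves_almost_spanning_forest_def)
  have inp: "forest_input A n {..<n} E id"
    by (rule forest_inputI) (use W distinct in auto)
  then have ach: "mpc_achieves A n (graph_records {..<n} E id) (1 - 1 / real n)
      (\<lambda>mems. almost_spanning_forest_solution \<epsilon> {..<n} E (removed_edges mems))"
    using solves by (auto simp: solves_almost_spanning_forest_def)
  then obtain m0 where m0: "m0 \<in> initial_memories A n (graph_records {..<n} E id)"
    by (auto simp: mpc_achieves_def)
  let ?prob = "measure_pmf.prob (pmf_of_set (tapes A n))"
  let ?R = "\<lambda>\<omega>. removed_edges (mpc_output A n \<omega> m0)"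
  have "1 - 1 / real n \<le> ?prob {\<omega>. almost_spanning_forest_solution \<epsilon> {..<n} E (?R \<omega>)}"
    using ach m0 by (auto simp: mpc_achieves_def)
  also have "\<dots> \<le> ?prob {\<omega>. \<exists>u\<in>set xs. \<exists>v. {u, v} \<in> cycle_edges xs \<and> v \<in> f n (set xs) (cycle_edges xs) u \<omega>}"
  proof (rule prob_tapes_mono)
    fix \<omega> assume \<omega>: "\<omega> \<in> tapes A n" and sol: "almost_spanning_forest_solution \<epsilon> {..<n} E (?R \<omega>)"
    have K: "xs \<in> K" by (simp add: K_def)
    then have "set xs \<in> cycle_comps {..<n} E" by (auto simp: cycle_comps_eq)
    then obtain e where e: "e \<in> ?R \<omega>" "e \<in> edges_in E (set xs)"
      using sol by (auto simp: almost_spanning_forest_solution_def)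
    then have "e \<in> comp_edges True xs" using edges_in_eq[OF K] by simp
    then obtain u v where uv: "u \<in> set xs" "e = {u, v}" using comp_edges_proper xs by metis
    then have "{u, v} \<in> E" using e by (auto simp: edges_in_def)
    from removed_iff_stable_output[OF stable inp m0 \<omega> K uv(1) this] e uv
    have "v \<in> f n (set xs) (cycle_edges xs) u \<omega>" by (simp add: comp_edges_def)
    then show "\<exists>u\<in>set xs. \<exists>v. {u, v} \<in> cycle_edges xs \<and> v \<in> f n (set xs) (cycle_edges xs) u \<omega>"
      using uv \<open>{u, v} \<in> E\<close> by (auto simp: E_def)
  qed
  finally show ?thesis .
qed

text \<open>
  The edge to be watched, \<open>{last zs, hd zs}\<close>, is the middle one of the path formed by the last
  and the first \<open>a + 1\<close> vertices of the cycle \<open>zs\<close>.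
\<close>

definition around :: "nat \<Rightarrow> nat list \<Rightarrow> nat list" where
  "around a zs = drop (length zs - Suc a) zs @ take (Suc a) zs"

text \<open>The length is \<open>2 * D + 2\<close> because a complete walk has \<open>D + 1\<close>
  nodes and is doubled; \<open>around a zs\<close> carries the IDs of a doubled walk with
  \<open>a + 1\<close> nodes.\<close>

definition sensitive_cycle :: "stable_output \<Rightarrow> nat \<Rightarrow> nat \<Rightarrow> bool list \<Rightarrow> nat list \<Rightarrow> bool" where
  "sensitive_cycle f n D \<omega> zs \<longleftrightarrow>
     distinct zs \<and> length zs = 2 * D + 2 \<and> set zs \<subseteq> {..<n} \<and>
     last zs \<in> f n (set zs) (cycle_edges zs) (hd zs) \<omega> \<and>
     (\<forall>a\<le>D. last zs \<notin> f n (set (around a zs)) (path_edges (around a zs)) (hd zs) \<omega>)"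

lemma distinct_around:
  assumes "distinct zs" "2 * Suc a \<le> length zs"
  shows "distinct (around a zs)"
proof -
  have "set (take (Suc a) zs) \<inter> set (drop (length zs - Suc a) zs) = {}"
    by (rule set_take_disj_set_drop_if_distinct) (use assms in auto)
  then show ?thesis using assms(1) by (auto simp: around_def)
qed

lemma exists_rotation:
  assumes "{u, v} \<in> cycle_edges xs" "length xs \<ge> 3"
  shows "\<exists>r<length xs. {u, v} = {last (rotate r xs), hd (rotate r xs)}"
proof -
  let ?l = "length xs"
  have ne: "xs \<noteq> []" using assms(2) by auto
  obtain i where i: "i < ?l" "{u, v} = {xs ! i, xs ! (Suc i mod ?l)}"
    using assms(1) cycle_edges_nth[OF ne] by auto
  define r where "r = Suc i mod ?l"
  have r: "r < ?l" using ne by (simp add: r_def)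
  have "hd (rotate r xs) = xs ! r" using hd_rotate_conv_nth[OF ne, of r] r by simp
  moreover have "last (rotate r xs) = xs ! i"
  proof -
    have "last (rotate r xs) = xs ! ((r + (?l - 1)) mod ?l)"
      using ne by (subst last_conv_nth) (simp_all add: nth_rotate)
    also have "(r + (?l - 1)) mod ?l = (Suc i + (?l - 1)) mod ?l" by (simp add: r_def mod_add_left_eq)
    also have "Suc i + (?l - 1) = i + ?l" using ne by (cases xs) auto
    finally show ?thesis using i(1) by simp
  qed
  ultimately show ?thesis using i(2) r by (auto simp: r_def)
qed

lemma cycle_edges_rotate': "cycle_edges (rotate r xs) = cycle_edges xs"
proof (cases "xs = []")
  case False
  show ?thesis
  proof (cases "r mod length xs = 0")
    case True
    then show ?thesis by (simp add: rotate_id)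
  next
    case nz: False
    then have "drop (r mod length xs) xs \<noteq> []" "take (r mod length xs) xs \<noteq> []"
      using False by (simp_all add: linorder_not_le)
    from cycle_edges_rotate[OF this] show ?thesis by (simp add: rotate_drop_take)
  qed
qed simp

lemma middle_edge_around:
  assumes "Suc a \<le> length zs"
  shows "{hd zs, last zs} \<in> path_edges (around a zs)"
proof -
  have "drop (length zs - Suc a) zs \<noteq> []" "take (Suc a) zs \<noteq> []" using assms by auto
  moreover have "last (drop (length zs - Suc a) zs) = last zs" using assms by auto
  moreover have "hd (take (Suc a) zs) = hd zs" by simp
  ultimately show ?thesis unfolding around_def using path_edges_append
    by (simp add: insert_commute)
qed

text \<open>Union bound over \<open>2 * L * (D + 1)\<close> events, given by an edge of the cycle, a
  radius \<open>a\<close> and the endpoint that reports the cut. Each has probability at most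
  \<open>1 / n\<close>, while the cycle is cut with probability at least \<open>1 - 1 / n\<close>;
  so some tape cuts the cycle and avoids all of them. Rotating makes the edge that it cuts the
  watched one.\<close>

lemma exists_sensitive_cycle:
  assumes stable: "stable_witness A f"
    and solves: "solves_almost_spanning_forest A n \<epsilon> (1 - 1 / real n)"
    and D: "D \<ge> 1" and L: "L = 2 * D + 2"
    and n: "2 * (2 * L) * (D + 1) + 1 < n" and eps: "0 < \<epsilon>" "2 * real L * \<epsilon> < 1"
  shows "\<exists>\<omega> zs. \<omega> \<in> tapes A n \<and> sensitive_cycle f n D \<omega> zs"
proof -
  let ?xs = "[0..<L]" and ?p = "pmf_of_set (tapes A n)"
  let ?prob = "measure_pmf.prob ?p"
  let ?rot = "\<lambda>r. rotate r ?xs"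
  have Ln: "2 * L < n"
  proof -
    have "2 * (2 * L) * (D + 1) \<ge> 2 * L" by simp
    then show ?thesis using n by linarith
  qed
  \<comment> \<open>\<open>sw\<close> selects the reporting endpoint: the outputs at the two ends of
    an edge are different values of \<open>f\<close>.\<close>
  define bad where "bad = (\<lambda>(sw, r, a). {\<omega>.
     (if sw then hd (?rot r) \<in> f n (set (around a (?rot r))) (path_edges (around a (?rot r))) (last (?rot r)) \<omega>
      else last (?rot r) \<in> f n (set (around a (?rot r))) (path_edges (around a (?rot r))) (hd (?rot r)) \<omega>)})"
  define J where "J = (UNIV :: bool set) \<times> {..<L} \<times> {..D}"
  define good where "good = {\<omega>. \<exists>u\<in>set ?xs. \<exists>v. {u, v} \<in> cycle_edges ?xs \<and> v \<in> f n (set ?xs) (cycle_edges ?xs) u \<omega>}"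
  have bad_le: "?prob (bad j) \<le> 1 / real n" if j_in: "j \<in> J" for j
  proof -
    obtain sw r a where j: "j = (sw, r, a)" "a \<le> D" "r < L" using j_in by (auto simp: J_def)
    let ?zs = "?rot r"
    have len: "length (around a ?zs) = 2 * Suc a" using j L by (simp add: around_def)
    have ed: "{hd ?zs, last ?zs} \<in> path_edges (around a ?zs)" by (rule middle_edge_around) (use j L in simp)
    then have mem: "hd ?zs \<in> set (around a ?zs)" "last ?zs \<in> set (around a ?zs)" using path_edges_subset by blast+
    have dist: "distinct (around a ?zs)" by (rule distinct_around) (use j L in auto)
    have sub: "set (around a ?zs) \<subseteq> {..<n}"
      using Ln by (auto simp: around_def dest!: in_set_takeD in_set_dropD)
    have "2 * real (2 * Suc a) * \<epsilon> \<le> 2 * real L * \<epsilon>" using j L eps by simp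
    then have eps': "2 * real (length (around a ?zs)) * \<epsilon> < 1" using eps unfolding len by linarith
    have "2 * length (around a ?zs) \<le> n" using j L Ln len by simp
    have "around a ?zs \<noteq> []" using len by auto
    note pr = prob_path_cut_le[OF stable solves dist _ sub _ eps']
    show ?thesis
      using pr[OF _ _ ed mem(1)] pr[of "last ?zs" "hd ?zs"] ed mem \<open>around a ?zs \<noteq> []\<close> \<open>2 * length (around a ?zs) \<le> n\<close>
      by (cases sw) (simp_all add: j(1) bad_def insert_commute)
  qed
  have "?prob (\<Union>j\<in>J. bad j) \<le> (\<Sum>j\<in>J. ?prob (bad j))"
    by (rule measure_pmf.finite_measure_subadditive_finite) (auto simp: J_def)
  also have "\<dots> \<le> (\<Sum>j\<in>J. 1 / real n)" by (rule sum_mono) (rule bad_le)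
  also have "\<dots> = real (2 * L * (D + 1)) / real n" by (simp add: J_def)
  finally have b: "?prob (\<Union>j\<in>J. bad j) \<le> real (2 * L * (D + 1)) / real n" .
  have g: "?prob good \<ge> 1 - 1 / real n"
    unfolding good_def by (rule prob_cycle_cut_ge[OF stable solves]) (use L D Ln in auto)
  have "real (2 * L * (D + 1)) / real n + 1 / real n < 1"
  proof -
    have "2 * L * (D + 1) + 1 < n" using n by simp
    then have "real (2 * L * (D + 1)) + 1 < real n" by linarith
    then show ?thesis using n by (simp add: add_divide_distrib[symmetric])
  qed
  then have "?prob (\<Union>j\<in>J. bad j) < ?prob good" using b g by linarith
  then have "\<not> good \<inter> set_pmf ?p \<subseteq> (\<Union>j\<in>J. bad j)"
    using measure_pmf.finite_measure_mono[of "good \<inter> set_pmf ?p" "\<Union>j\<in>J. bad j" ?p]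
    by (auto simp: measure_Int_set_pmf)
  then obtain \<omega> where \<omega>: "\<omega> \<in> good" "\<omega> \<in> tapes A n" "\<And>j. j \<in> J \<Longrightarrow> \<omega> \<notin> bad j"
    by (auto simp: set_pmf_of_set finite_tapes tapes_nonempty)
  obtain u v where uv: "{u, v} \<in> cycle_edges ?xs" "v \<in> f n (set ?xs) (cycle_edges ?xs) u \<omega>"
    using \<omega>(1) by (auto simp: good_def)
  then obtain r where r: "r < L" "{u, v} = {last (?rot r), hd (?rot r)}"
    using exists_rotation[OF uv(1)] L D by auto
  consider "u = hd (?rot r)" "v = last (?rot r)" | "u = last (?rot r)" "v = hd (?rot r)"
    using r(2) by (auto simp: doubleton_eq_iff)
  then have "\<exists>zs. sensitive_cycle f n D \<omega> zs"
  proof cases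
    case 1
    have "last (?rot r) \<notin> f n (set (around a (?rot r))) (path_edges (around a (?rot r))) (hd (?rot r)) \<omega>"
      if "a \<le> D" for a
      using \<omega>(3)[of "(False, r, a)"] that r(1) by (simp add: J_def bad_def)
    then have "sensitive_cycle f n D \<omega> (?rot r)"
      using uv(2) 1 L Ln by (auto simp: sensitive_cycle_def cycle_edges_rotate' simp del: rotate_Suc)
    then show ?thesis ..
  next
    case 2
    \<comment> \<open>The cut is reported by the other endpoint; reversing the list exchanges
      \<open>hd\<close> and \<open>last\<close> and keeps the edges of the cycle and of the
      paths.\<close>
    let ?zs = "rev (?rot r)"
    have ne: "?rot r \<noteq> []" using L by simp
    have ar: "around a ?zs = rev (around a (?rot r))" if "a \<le> D" for a
      using that L by (simp add: around_def rev_drop rev_take)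
    have "last ?zs \<notin> f n (set (around a ?zs)) (path_edges (around a ?zs)) (hd ?zs) \<omega>" if "a \<le> D" for a
      using \<omega>(3)[of "(True, r, a)"] that r(1) ne
      by (simp add: J_def bad_def ar path_edges_rev hd_rev last_rev)
    moreover have "cycle_edges ?zs = cycle_edges ?xs"
      by (metis cycle_edges_def cycle_edges_rotate' path_edges_rev hd_rev last_rev insert_commute)
    ultimately have "sensitive_cycle f n D \<omega> ?zs"
      using uv(2) 2 L Ln ne by (auto simp: sensitive_cycle_def hd_rev last_rev)
    then show ?thesis ..
  qed
  then show ?thesis using \<omega>(2) by blast
qed

section \<open>Folded layered walks\<close>

text \<open>
  A permutation \<open>s\<close> of \<open>{..<P}\<close> is restricted to the steps that increase the layer \<open>h\<close> by one.
  Every node \<open>x\<close> is doubled to \<open>x\<close> and \<open>x + P\<close>, and the copies are joined at layers 0 and \<open>D\<close>.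
  So a walk through all the layers becomes a cycle with the IDs \<open>zs\<close>, and a walk from layer 0
  that stops before layer \<open>D\<close> becomes a path around the watched edge of \<open>zs\<close>.
\<close>

locale fold_instance =
  fixes P D n :: nat and s h :: "nat \<Rightarrow> nat" and zs :: "nat list"
  assumes s_bij: "bij_betw s {..<P} {..<P}"
    and h_le: "x < P \<Longrightarrow> h x \<le> D"
    and D_pos: "1 \<le> D" and P_le: "2 * P \<le> n" and P_pos: "0 < P"
    and zs_len: "length zs = 2 * D + 2" and zs_distinct: "distinct zs" and zs_sub: "set zs \<subseteq> {..<n}"
begin

definition link where "link x \<longleftrightarrow> h (s x) = Suc (h x)"

definition fold_edges :: "nat set set" where
  "fold_edges = {{x, s x} |x. x < P \<and> link x} \<union> {{x + P, s x + P} |x. x < P \<and> link x}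
     \<union> {{x, x + P} |x. x < P \<and> (h x = 0 \<or> h x = D)}"

text \<open>The ID depends on layer and copy only: along \<open>zs\<close>, the lower copy climbs
  from the head and the upper copy descends from the end. Nodes of one layer share an ID, but a
  strand meets each layer at most once.\<close>

definition fold_ident :: "nat \<Rightarrow> nat" where
  "fold_ident v = (if v < P then zs ! h v else if v < 2 * P then zs ! (2 * D + 1 - h (v - P)) else 0)"

text \<open>The counter is fuel: a link raises the layer by one and layers end at \<open>D\<close>,
  so \<open>D - h x\<close> further nodes suffice.\<close>

fun strand_upto :: "nat \<Rightarrow> nat \<Rightarrow> nat list" where
  "strand_upto 0 x = [x]"
| "strand_upto (Suc k) x = x # (if link x then strand_upto k (s x) else [])"

definition strand where "strand x = strand_upto (D - h x) x"

text \<open>The strands of the roots partition the nodes and thereby index the components of the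
  folded graph.\<close>

definition root where "root x \<longleftrightarrow> x < P \<and> \<not> (\<exists>y<P. s y = x \<and> link y)"

lemma vertical_in_fold_edges: "x < P \<Longrightarrow> h x = 0 \<or> h x = D \<Longrightarrow> {x, x + P} \<in> fold_edges"
  unfolding fold_edges_def by blast

lemma s_less: "x < P \<Longrightarrow> s x < P"
  using bij_betwE[OF s_bij] by auto

lemma s_inj: "x < P \<Longrightarrow> y < P \<Longrightarrow> s x = s y \<Longrightarrow> x = y"
  using bij_betw_imp_inj_on[OF s_bij] by (auto simp: inj_on_def)

lemma link_less: "x < P \<Longrightarrow> link x \<Longrightarrow> h x < D"
  using h_le[OF s_less] by (fastforce simp: link_def)

lemma strand_unfold:
  assumes "x < P"
  shows "strand x = x # (if link x then strand (s x) else [])"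
proof (cases "link x")
  case True
  then have "D - h x = Suc (D - h (s x))" using link_less[OF assms True] by (simp add: link_def)
  then show ?thesis using True by (simp add: strand_def)
next
  case False
  then show ?thesis by (cases "D - h x") (auto simp: strand_def)
qed

lemma strand_induct [consumes 1, case_names node]:
  assumes "x < P" "\<And>x. x < P \<Longrightarrow> (link x \<Longrightarrow> Q (s x)) \<Longrightarrow> Q x"
  shows "Q x"
  using assms(1)
proof (induction "D - h x" arbitrary: x rule: less_induct)
  case less
  have "Q (s x)" if "link x"
    by (rule less(1)) (use link_less[OF less(2) that] s_less[OF less(2)] that in \<open>auto simp: link_def\<close>)
  then show ?case using assms(2)[OF less(2)] by blast
qed

lemma strand_nonempty: "x < P \<Longrightarrow> strand x \<noteq> []"
  by (subst strand_unfold) auto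

lemma hd_strand: "x < P \<Longrightarrow> hd (strand x) = x"
  by (subst strand_unfold) auto

lemma self_in_strand: "x < P \<Longrightarrow> x \<in> set (strand x)"
  using hd_strand strand_nonempty hd_in_set by metis

lemma strand_less: "x < P \<Longrightarrow> y \<in> set (strand x) \<Longrightarrow> y < P"
proof (induction x rule: strand_induct)
  case (node x)
  then show ?case using strand_unfold[of x] by (auto split: if_splits)
qed

lemma nth_strand:
  assumes "x < P" "i < length (strand x)"
  shows "strand x ! i = (s ^^ i) x" "h ((s ^^ i) x) = h x + i"
proof -
  have "strand x ! i = (s ^^ i) x \<and> h ((s ^^ i) x) = h x + i"
    using assms
  proof (induction x arbitrary: i rule: strand_induct)
    case (node x)
    show ?case
    proof (cases i)
      case 0
      then show ?thesis using strand_unfold[OF node(1)] by simp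
    next
      case (Suc j)
      then have l: "link x" "j < length (strand (s x))"
        using node(1,3) strand_unfold[OF node(1)] by (auto split: if_splits)
      then show ?thesis using node(2)[OF l] Suc strand_unfold[OF node(1)]
        by (auto simp: funpow_swap1 link_def)
    qed
  qed
  then show "strand x ! i = (s ^^ i) x" "h ((s ^^ i) x) = h x + i" by auto
qed

lemma length_strand_le: "x < P \<Longrightarrow> h x + length (strand x) \<le> Suc D"
  using nth_strand[of x "length (strand x) - 1"] strand_nonempty[of x]
    h_le[OF strand_less[OF _ nth_mem], of x "length (strand x) - 1"] by (cases "length (strand x)") auto

lemma distinct_strand: "x < P \<Longrightarrow> distinct (strand x)"
  unfolding distinct_conv_nth using nth_strand by (metis add_left_cancel)

lemma h_last_strand: "x < P \<Longrightarrow> Suc (h (last (strand x))) = h x + length (strand x)"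
  using nth_strand[of x "length (strand x) - 1"] strand_nonempty[of x]
  by (cases "length (strand x)") (auto simp: last_conv_nth)

lemma not_link_last: "x < P \<Longrightarrow> \<not> link (last (strand x))"
proof (induction x rule: strand_induct)
  case (node x)
  then show ?case using strand_unfold[of x] strand_nonempty[OF s_less[of x]] by auto
qed

lemma path_edges_strand: "x < P \<Longrightarrow> path_edges (strand x) = {{y, s y} |y. y \<in> set (strand x) \<and> link y}"
proof (induction x rule: strand_induct)
  case (node x)
  show ?case
  proof (cases "link x")
    case True
    have s: "strand x = x # strand (s x)" "strand (s x) = s x # tl (strand (s x))"
      using strand_unfold[OF node(1)] strand_unfold[OF s_less[OF node(1)]] True by auto
    have "path_edges (strand x) = insert {x, s x} (path_edges (strand (s x)))"
      using s path_edges_Cons2 by metis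
    then show ?thesis using node(2) True s(1) by auto
  next
    case False
    then show ?thesis using strand_unfold[OF node(1)] by auto
  qed
qed

lemma strand_closed: "x < P \<Longrightarrow> y \<in> set (strand x) \<Longrightarrow> link y \<Longrightarrow> s y \<in> set (strand x)"
proof (induction x rule: strand_induct)
  case (node x)
  show ?case
  proof (cases "y = x")
    case True
    then show ?thesis
      using node strand_unfold[OF node(1)] strand_unfold[OF s_less[OF node(1)]] by simp
  next
    case False
    then show ?thesis using node strand_unfold[OF node(1)] by (auto split: if_splits)
  qed
qed

lemma strand_pred:
  "x < P \<Longrightarrow> y \<in> set (strand x) \<Longrightarrow> y = x \<or> (\<exists>z\<in>set (strand x). link z \<and> s z = y)"
proof (induction x rule: strand_induct)
  case (node x)
  then show ?case using strand_unfold[OF node(1)] by (auto split: if_splits)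
qed

text \<open>Following links backwards lowers the layer, so it stops at a root.\<close>

lemma exists_root: "y < P \<Longrightarrow> \<exists>x. root x \<and> y \<in> set (strand x)"
proof (induction "h y" arbitrary: y rule: less_induct)
  case less
  show ?case
  proof (cases "root y")
    case True
    then show ?thesis using strand_unfold[OF less(2)] by auto
  next
    case False
    then obtain z where z: "z < P" "s z = y" "link z" using less(2) by (auto simp: root_def)
    then obtain x where "root x" "z \<in> set (strand x)" using less(1)[of z] by (auto simp: link_def)
    then show ?thesis using strand_closed[of x z] z by (auto simp: root_def)
  qed
qed

text \<open>Going backwards is deterministic because \<open>s\<close> is injective, so two strands
  through \<open>y\<close> agree below \<open>y\<close>.\<close>

lemma root_unique:
  "root x \<Longrightarrow> root x' \<Longrightarrow> y \<in> set (strand x) \<Longrightarrow> y \<in> set (strand x') \<Longrightarrow> x = x'"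
proof (induction "h y" arbitrary: y rule: less_induct)
  case less
  have P: "x < P" "x' < P" using less(2,3) by (auto simp: root_def)
  consider "y = x" | "y = x'" | z z' where "z \<in> set (strand x)" "link z" "s z = y"
      "z' \<in> set (strand x')" "link z'" "s z' = y"
    using strand_pred[OF P(1) less(4)] strand_pred[OF P(2) less(5)] by blast
  then show ?case
  proof cases
    case 1
    then show ?thesis using strand_pred[OF P(2) less(5)] less(2) strand_less[OF P(2)] by (auto simp: root_def)
  next
    case 2
    then show ?thesis using strand_pred[OF P(1) less(4)] less(3) strand_less[OF P(1)] by (auto simp: root_def)
  next
    case 3
    have "z < P" "z' < P" using 3 strand_less P by blast+
    then have "z = z'" using s_inj 3(3,6) by metis
    then show ?thesis using less(1)[of z] less(2,3) 3 by (auto simp: link_def)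
  qed
qed

section \<open>Doubled strands: the components of the folded graph\<close>

definition upper where "upper x = map (\<lambda>v. v + P) (strand x)"

definition closed_end where "closed_end x \<longleftrightarrow> h (last (strand x)) = D"

text \<open>The shapes differ by whether the copies are joined at layer 0, only at layer
  \<open>D\<close>, or nowhere. From layer 0, the rung \<open>{x, x + P}\<close> is put in the
  middle of the list, which makes the ID list an instance of \<open>around\<close>; a rung at layer
  \<open>D\<close> then closes this list to a cycle.\<close>

definition lists_of :: "nat \<Rightarrow> nat list set" where
  "lists_of x = (if h x = 0 then {rev (upper x) @ strand x}
     else if closed_end x then {strand x @ rev (upper x)} else {strand x, upper x})"

definition family where
  "family = (\<Union>x\<in>Collect root. lists_of x) \<union> (\<lambda>v. [v]) ` {2 * P..<n}"

definition is_cyc where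
  "is_cyc xs \<longleftrightarrow> (\<exists>x. root x \<and> h x = 0 \<and> closed_end x \<and> xs = rev (upper x) @ strand x)"

lemma upper_props:
  assumes "x < P"
  shows "upper x \<noteq> []" "distinct (upper x)" "set (upper x) = (\<lambda>v. v + P) ` set (strand x)"
    "hd (upper x) = x + P" "last (upper x) = last (strand x) + P"
    "path_edges (upper x) = {{y + P, s y + P} |y. y \<in> set (strand x) \<and> link y}"
proof -
  show "path_edges (upper x) = {{y + P, s y + P} |y. y \<in> set (strand x) \<and> link y}"
    unfolding upper_def path_edges_map path_edges_strand[OF assms] by (auto simp: setcompr_eq_image image_image)
qed (use assms strand_nonempty[OF assms] distinct_strand[OF assms] hd_strand[OF assms]
  in \<open>auto simp: upper_def distinct_map hd_map last_map\<close>)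

lemma disjoint_upper: "x < P \<Longrightarrow> set (strand x) \<inter> set (upper x) = {}"
  using strand_less upper_props(3) by fastforce

lemma layer_zero: "x < P \<Longrightarrow> y \<in> set (strand x) \<Longrightarrow> h y = 0 \<Longrightarrow> y = x \<and> h x = 0"
  using strand_pred[of x y] by (auto simp: link_def)

lemma layer_top:
  assumes "x < P" "y \<in> set (strand x)" "h y = D"
  shows "y = last (strand x)"
proof -
  obtain i where i: "i < length (strand x)" "y = strand x ! i" using assms by (metis in_set_conv_nth)
  then have "h x + i = D" using nth_strand[OF assms(1) i(1)] assms(3) by simp
  then have "i = length (strand x) - 1" using length_strand_le[OF assms(1)] i(1) by linarith
  then show ?thesis using i strand_nonempty[OF assms(1)] by (simp add: last_conv_nth)
qed

definition edges_of where
  "edges_of x = {{y, s y} |y. y \<in> set (strand x) \<and> link y} \<union> {{y + P, s y + P} |y. y \<in> set (strand x) \<and> link y}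
     \<union> {{y, y + P} |y. y \<in> set (strand x) \<and> (h y = 0 \<or> h y = D)}"

lemma edges_of_eq:
  assumes "x < P"
  shows "edges_of x = path_edges (strand x) \<union> path_edges (upper x) \<union>
    (if h x = 0 then {{x, x + P}} else {}) \<union> (if closed_end x then {{last (strand x), last (strand x) + P}} else {})"
proof -
  have "{{y, y + P} |y. y \<in> set (strand x) \<and> (h y = 0 \<or> h y = D)} =
      (\<lambda>y. {y, y + P}) ` {y \<in> set (strand x). h y = 0 \<or> h y = D}" by auto
  also have "{y \<in> set (strand x). h y = 0 \<or> h y = D} =
      (if h x = 0 then {x} else {}) \<union> (if closed_end x then {last (strand x)} else {})"
  proof -
    have "x \<in> set (strand x)" "last (strand x) \<in> set (strand x)"
      using strand_nonempty[OF assms] hd_strand[OF assms] hd_in_set by (fastforce, simp)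
    moreover have a: "h y = 0 \<longleftrightarrow> h x = 0 \<and> y = x" if "y \<in> set (strand x)" for y
      using layer_zero[OF assms that] by blast
    have b: "h y = D \<longleftrightarrow> closed_end x \<and> y = last (strand x)" if "y \<in> set (strand x)" for y
      using layer_top[OF assms that] by (auto simp: closed_end_def)
    have "{y \<in> set (strand x). h y = 0 \<or> h y = D} =
        {y \<in> set (strand x). (h x = 0 \<and> y = x) \<or> (closed_end x \<and> y = last (strand x))}"
      using a b by blast
    ultimately show ?thesis by auto
  qed
  finally have "{{y, y + P} |y. y \<in> set (strand x) \<and> (h y = 0 \<or> h y = D)} =
      (if h x = 0 then {{x, x + P}} else {}) \<union> (if closed_end x then {{last (strand x), last (strand x) + P}} else {})"
    by (cases "h x = 0"; cases "closed_end x"; simp)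
  then show ?thesis
    unfolding edges_of_def upper_props(6)[OF assms] path_edges_strand[OF assms] by (simp add: Un_assoc)
qed

lemma edges_of_lists:
  assumes "root x"
  shows "(\<Union>xs\<in>lists_of x. comp_edges (is_cyc xs) xs) = edges_of x"
proof -
  have x: "x < P" using assms by (simp add: root_def)
  note ne = strand_nonempty[OF x] upper_props(1)[OF x]
  note simps = hd_strand[OF x] upper_props(4,5)[OF x]
  have cyc_sub: "\<exists>y. root y \<and> h y = 0 \<and> closed_end y \<and> set xs = set (strand y) \<union> set (upper y)"
    if "is_cyc xs" for xs
    using that by (auto simp: is_cyc_def)
  \<comment> \<open>A list determines its root, since strands of different roots are disjoint. So
    \<open>is_cyc\<close>, which quantifies over roots, is decided by \<open>x\<close>
    alone.\<close>
  have root_eq: "y = x" if "root y" "v \<in> set xs" "set xs = set (strand y) \<union> set (upper y)"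
    "set xs \<subseteq> set (strand x) \<union> set (upper x)" for y v xs
  proof -
    have "y < P" using that by (simp add: root_def)
    then have "y \<in> set (strand y)" using strand_unfold[of y] by auto
    then have "y \<in> set (strand x) \<union> set (upper x)" using that by blast
    then have "y \<in> set (strand x)" using upper_props(3)[OF x] \<open>y < P\<close> by auto
    then show ?thesis using root_unique[OF that(1) assms] \<open>y \<in> set (strand y)\<close> by blast
  qed
  have cyc: "is_cyc xs \<longleftrightarrow> h x = 0 \<and> closed_end x" if "xs \<in> lists_of x" for xs
  proof
    assume "is_cyc xs"
    then obtain y where y: "root y" "h y = 0" "closed_end y" "set xs = set (strand y) \<union> set (upper y)"
      using cyc_sub by blast
    have "hd (strand y) \<in> set xs" using y strand_nonempty[of y] by (auto simp: root_def)
    moreover have "set xs \<subseteq> set (strand x) \<union> set (upper x)" using that by (auto simp: lists_of_def split: if_splits)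
    ultimately have "y = x" using root_eq y by blast
    then show "h x = 0 \<and> closed_end x" using y by simp
  next
    assume "h x = 0 \<and> closed_end x"
    then show "is_cyc xs" using that assms by (auto simp: is_cyc_def lists_of_def)
  qed
  consider "h x = 0" | "h x \<noteq> 0" "closed_end x" | "h x \<noteq> 0" "\<not> closed_end x" by blast
  then show ?thesis
  proof cases
    case 1
    then have l: "lists_of x = {rev (upper x) @ strand x}" by (simp add: lists_of_def)
    have "path_edges (rev (upper x) @ strand x) = insert {x, x + P} (path_edges (strand x) \<union> path_edges (upper x))"
      using ne by (subst path_edges_append) (auto simp: last_rev simps path_edges_rev insert_commute)
    then show ?thesis
      using l 1 ne cyc unfolding edges_of_eq[OF x]
      by (auto simp: comp_edges_def cycle_edges_def hd_rev simps)
  next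
    case 2
    then have l: "lists_of x = {strand x @ rev (upper x)}" by (simp add: lists_of_def)
    have "path_edges (strand x @ rev (upper x)) =
        insert {last (strand x), last (strand x) + P} (path_edges (strand x) \<union> path_edges (upper x))"
      using ne by (subst path_edges_append) (auto simp: hd_rev simps path_edges_rev)
    then show ?thesis
      using l 2 cyc unfolding edges_of_eq[OF x] by (auto simp: comp_edges_def)
  next
    case 3
    then have "lists_of x = {strand x, upper x}" by (simp add: lists_of_def)
    then show ?thesis
      using 3 cyc unfolding edges_of_eq[OF x] by (auto simp: comp_edges_def)
  qed
qed

lemma fold_edges_eq: "fold_edges = (\<Union>x\<in>Collect root. edges_of x)"
proof
  show "fold_edges \<subseteq> (\<Union>x\<in>Collect root. edges_of x)"
  proof
    fix e assume "e \<in> fold_edges"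
    then obtain y where y: "y < P" "link y \<and> (e = {y, s y} \<or> e = {y + P, s y + P}) \<or>
        e = {y, y + P} \<and> (h y = 0 \<or> h y = D)"
      by (auto simp: fold_edges_def)
    then obtain x where "root x" "y \<in> set (strand x)" using exists_root by blast
    then show "e \<in> (\<Union>x\<in>Collect root. edges_of x)" using y by (auto simp: edges_of_def)
  qed
  show "(\<Union>x\<in>Collect root. edges_of x) \<subseteq> fold_edges"
  proof
    fix e assume "e \<in> (\<Union>x\<in>Collect root. edges_of x)"
    then obtain x where x: "x < P" "e \<in> edges_of x" by (auto simp: root_def)
    then show "e \<in> fold_edges" using strand_less[OF x(1)] unfolding edges_of_def fold_edges_def by blast
  qed
qed

lemma lists_of_set: "xs \<in> lists_of x \<Longrightarrow> x < P \<Longrightarrow> v \<in> set xs \<Longrightarrow>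
    (v < P \<and> v \<in> set (strand x)) \<or> (P \<le> v \<and> v < 2 * P \<and> v - P \<in> set (strand x))"
  using strand_less[of x] by (auto simp: lists_of_def upper_def split: if_splits)

lemma Union_lists_of: "x < P \<Longrightarrow> (\<Union>xs\<in>lists_of x. set xs) = set (strand x) \<union> (\<lambda>v. v + P) ` set (strand x)"
  by (auto simp: lists_of_def upper_def split: if_splits)

text \<open>Strands neither merge nor close up, because \<open>s\<close> is injective and links
  raise the layer; only rungs at layers 0 and \<open>D\<close> connect the copies. The vertices from
  \<open>2 * P\<close> on are isolated padding.\<close>

sublocale fold: path_cycle_family family is_cyc "{..<n}" fold_edges
proof
  have r: "root x \<Longrightarrow> x < P" for x by (simp add: root_def)
  have "Collect root \<subseteq> {..<P}" using r by auto
  then have "finite (Collect root)" by (rule finite_subset) simp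
  then show "finite family" by (auto simp: family_def lists_of_def)
  have "strand x \<noteq> []" "upper x \<noteq> []" if "root x" for x
    using that strand_nonempty upper_props(1) r by auto
  then have "xs \<noteq> []" if "xs \<in> lists_of x" "root x" for xs x
    using that unfolding lists_of_def by (metis Nil_is_append_conv empty_iff insert_iff)
  then show "xs \<noteq> []" if "xs \<in> family" for xs
    using that by (auto simp: family_def)
  show "distinct xs" if "xs \<in> family" for xs
  proof -
    have "distinct xs" if "xs \<in> lists_of x" "root x" for x
      using that disjoint_upper[OF r[OF that(2)]] distinct_strand[OF r[OF that(2)]] upper_props(2)[OF r[OF that(2)]]
      by (auto simp: lists_of_def split: if_splits)
    then show ?thesis using that by (auto simp: family_def)
  qed
  \<comment> \<open>\<open>1 \<le> D\<close> gives a doubled complete strand at least four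
    vertices.\<close>
  show "length xs \<ge> 3" if cyc: "is_cyc xs" for xs
  proof -
    obtain x where x: "root x" "h x = 0" "closed_end x" "xs = rev (upper x) @ strand x"
      using cyc unfolding is_cyc_def by blast
    then have "length (strand x) = Suc D" using h_last_strand[OF r[OF x(1)]] by (simp add: closed_end_def)
    then show ?thesis using x(4) D_pos by (simp add: upper_def)
  qed
  show "xs = ys" if same: "xs \<in> family" "ys \<in> family" "v \<in> set xs" "v \<in> set ys" for xs ys v
  proof -
    have mem: "(v < 2 * P \<and> (\<exists>x. root x \<and> xs \<in> lists_of x)) \<or> (2 * P \<le> v \<and> xs = [v])"
      if "xs \<in> family" "v \<in> set xs" for xs
    proof (cases "\<exists>x. root x \<and> xs \<in> lists_of x")
      case True
      then obtain x where x: "root x" "xs \<in> lists_of x" by blast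
      have "v < 2 * P" using lists_of_set[OF x(2) r[OF x(1)] that(2)] by linarith
      then show ?thesis using x by blast
    qed (use that in \<open>auto simp: family_def\<close>)
    show ?thesis
    proof (cases "v < 2 * P")
      case True
      then obtain x y where xy: "root x" "xs \<in> lists_of x" "root y" "ys \<in> lists_of y"
        using mem[OF same(1,3)] mem[OF same(2,4)] by auto
      have "\<exists>w. w \<in> set (strand x) \<and> w \<in> set (strand y)"
        using lists_of_set[OF xy(2) r[OF xy(1)] same(3)] lists_of_set[OF xy(4) r[OF xy(3)] same(4)] by auto
      then have "x = y" using root_unique xy by blast
      then show ?thesis using xy that(3,4) disjoint_upper[OF r[OF xy(1)]]
        by (auto simp: lists_of_def split: if_splits)
    next
      case False
      then show ?thesis using mem that by (metis)
    qed
  qed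
  show "{..<n} = (\<Union>xs\<in>family. set xs)"
  proof
    show "{..<n} \<subseteq> (\<Union>xs\<in>family. set xs)"
    proof
      fix v assume v: "v \<in> {..<n}"
      define w where "w = (if v < P then v else v - P)"
      show "v \<in> (\<Union>xs\<in>family. set xs)"
      proof (cases "v < 2 * P")
        case True
        then have "w < P" by (auto simp: w_def)
        then obtain x where x: "root x" "w \<in> set (strand x)" using exists_root by blast
        have "v \<in> set (strand x) \<union> (\<lambda>v. v + P) ` set (strand x)"
          using x(2) True by (auto simp: w_def image_iff split: if_splits) (metis le_add_diff_inverse2 linorder_not_le)
        then have "v \<in> (\<Union>xs\<in>lists_of x. set xs)" using Union_lists_of[OF r[OF x(1)]] by simp
        then show ?thesis using x by (auto simp: family_def)
      qed (use v in \<open>auto simp: family_def\<close>)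
    qed
    show "(\<Union>xs\<in>family. set xs) \<subseteq> {..<n}"
      using lists_of_set r P_le by (fastforce simp: family_def)
  qed
  have "(\<Union>xs\<in>family. comp_edges (is_cyc xs) xs) =
      (\<Union>x\<in>Collect root. \<Union>xs\<in>lists_of x. comp_edges (is_cyc xs) xs) \<union>
      (\<Union>v\<in>{2 * P..<n}. comp_edges (is_cyc [v]) [v])"
    by (auto simp: family_def)
  also have "(\<Union>x\<in>Collect root. \<Union>xs\<in>lists_of x. comp_edges (is_cyc xs) xs) = fold_edges"
    unfolding fold_edges_eq using edges_of_lists by simp
  also have "(\<Union>v\<in>{2 * P..<n}. comp_edges (is_cyc [v]) [v]) = {}"
  proof -
    have "\<not> is_cyc [v]" for v
    proof
      assume "is_cyc [v]"
      then obtain x where "root x" "[v] = rev (upper x) @ strand x" by (auto simp: is_cyc_def)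
      then have "length (upper x) + length (strand x) = 1"
        by (metis length_append length_rev length_Cons list.size(3) One_nat_def)
      then show False using strand_nonempty[OF r[OF \<open>root x\<close>]]
        by (cases "strand x") (auto simp: upper_def)
    qed
    then show ?thesis by (simp add: comp_edges_def)
  qed
  finally show "fold_edges = (\<Union>xs\<in>family. comp_edges (is_cyc xs) xs)" by simp
qed

text \<open>Layers rise by exactly one along a strand, so its IDs form a segment of
  \<open>zs\<close>; the upper copy, read backwards, gives the mirrored segment.\<close>

lemma map_ident_strand:
  assumes "x < P"
  shows "map fold_ident (strand x) = take (length (strand x)) (drop (h x) zs)"
    "map fold_ident (rev (upper x)) = drop (length zs - h x - length (strand x)) (take (length zs - h x) zs)"
proof -
  let ?l = "length (strand x)"
  have l: "h x + ?l \<le> Suc D" by (rule length_strand_le[OF assms])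
  show "map fold_ident (strand x) = take ?l (drop (h x) zs)"
  proof (rule nth_equalityI)
    fix i assume "i < length (map fold_ident (strand x))"
    then have i: "i < ?l" by simp
    then have "strand x ! i < P" using strand_less[OF assms nth_mem] by blast
    then show "map fold_ident (strand x) ! i = take ?l (drop (h x) zs) ! i"
      using nth_strand[OF assms i] i l zs_len by (simp add: fold_ident_def)
  qed (use l zs_len in simp)
  show "map fold_ident (rev (upper x)) = drop (length zs - h x - ?l) (take (length zs - h x) zs)"
  proof (rule nth_equalityI)
    fix i assume "i < length (map fold_ident (rev (upper x)))"
    then have i: "i < ?l" by (simp add: upper_def)
    define j where "j = ?l - Suc i"
    have j: "j < ?l" using i by (simp add: j_def)
    then have "strand x ! j < P" using strand_less[OF assms nth_mem] by blast
    then have "fold_ident (strand x ! j + P) = zs ! (2 * D + 1 - (h x + j))"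
      using nth_strand[OF assms j] by (simp add: fold_ident_def)
    also have "2 * D + 1 - (h x + j) = length zs - h x - ?l + i"
      using l i zs_len by (simp add: j_def)
    finally show "map fold_ident (rev (upper x)) ! i = drop (length zs - h x - ?l) (take (length zs - h x) zs) ! i"
      using i l zs_len by (simp add: upper_def rev_nth j_def)
  qed (use l zs_len in \<open>simp add: upper_def\<close>)
qed

lemma fold_ident_less: "v < n \<Longrightarrow> fold_ident v < n"
proof -
  assume v: "v < n"
  have "zs ! i < n" if "i \<le> 2 * D + 1" for i
    using zs_sub zs_len that nth_mem[of i zs] by (metis Suc_1 add_Suc_right le_imp_less_Suc lessThan_iff plus_1_eq_Suc subsetD add.commute)
  moreover have "h x \<le> 2 * D + 1" if "x < P" for x using h_le[OF that] by simp
  ultimately show ?thesis using v by (auto simp: fold_ident_def)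
qed

text \<open>Lower copies take their IDs from the first \<open>D + 1\<close> entries of
  \<open>zs\<close> and upper copies from the last \<open>D + 1\<close>, so joining the copies
  creates no clash.\<close>

lemma fold_forest_input:
  assumes "n \<le> word_range A n"
  shows "forest_input A n {..<n} fold_edges fold_ident"
proof (rule fold.forest_inputI)
  show "fold_ident ` {..<n} \<subseteq> {..<word_range A n}" using fold_ident_less assms by fastforce
  show "distinct (map fold_ident xs)" if xs: "xs \<in> family" for xs
  proof -
    have "distinct (map fold_ident xs)" if "xs \<in> lists_of x" "root x" for x
    proof -
      have x: "x < P" using \<open>root x\<close> by (simp add: root_def)
      let ?l = "length (strand x)"
      have l: "h x + ?l \<le> Suc D" by (rule length_strand_le[OF x])
      let ?a = "map fold_ident (strand x)" and ?b = "map fold_ident (rev (upper x))"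
      have d: "distinct ?a" "distinct ?b" unfolding map_ident_strand[OF x] using zs_distinct by auto
      have "set ?a \<subseteq> set (take (Suc D) zs)"
        unfolding map_ident_strand[OF x] using l
        by (metis set_take_subset_set_take take_drop add.commute order_trans set_drop_subset)
      moreover have "set ?b \<subseteq> set (drop (Suc D) zs)"
        unfolding map_ident_strand[OF x] drop_take
        using l zs_len by (intro order_trans[OF set_take_subset] set_drop_subset_set_drop) simp
      moreover have "set (take (Suc D) zs) \<inter> set (drop (Suc D) zs) = {}"
        by (rule set_take_disj_set_drop_if_distinct[OF zs_distinct]) simp
      ultimately have dj: "set ?a \<inter> set ?b = {}" by blast
      have "distinct (map fold_ident (upper x))" using d(2) by (simp add: rev_map[symmetric])
      then show ?thesis using \<open>xs \<in> lists_of x\<close> d dj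
        by (auto simp: lists_of_def simp del: distinct_map set_map split: if_splits)
    qed
    then show ?thesis using xs by (auto simp: family_def)
  qed
qed (use assms in auto)

text \<open>By stability only the component of \<open>x\<close> with its IDs matters. For a complete
  walk it is the cycle \<open>zs\<close>, which is cut at the watched edge under \<omega>; otherwise
  it is the path \<open>around (l - 1) zs\<close>, with \<open>l\<close> the length of the strand,
  which is not cut there.\<close>

lemma middle_removed_iff:
  assumes "stable_witness A f" "n \<le> word_range A n" "sensitive_cycle f n D \<omega> zs"
    and m0: "m0 \<in> initial_memories A n (graph_records {..<n} fold_edges fold_ident)" and \<omega>: "\<omega> \<in> tapes A n"
    and x: "x < P" "h x = 0"
  shows "{x, x + P} \<in> removed_edges (mpc_output A n \<omega> m0) \<longleftrightarrow> (\<forall>i\<le>D. h ((s ^^ i) x) = i)"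
proof -
  have rx: "root x" using x by (auto simp: root_def link_def)
  let ?xs = "rev (upper x) @ strand x" and ?l = "length (strand x)"
  have "?xs \<in> lists_of x" using x by (simp add: lists_of_def)
  then have K: "?xs \<in> family" using rx unfolding family_def by blast
  have xs: "x \<in> set (strand x)" by (rule self_in_strand[OF x(1)])
  then have xin: "x \<in> set ?xs" by simp
  have e: "{x, x + P} \<in> fold_edges" using vertical_in_fold_edges x by blast
  have id: "fold_ident x = hd zs" "fold_ident (x + P) = last zs"
    using x zs_len D_pos by (auto simp: fold_ident_def hd_conv_nth last_conv_nth simp flip: length_0_conv)
  have l: "0 < ?l" "?l \<le> Suc D" using length_strand_le[OF x(1)] strand_nonempty[OF x(1)] by auto
  have ar: "map fold_ident ?xs = around (?l - 1) zs"
    using l map_ident_strand[OF x(1)] x(2) zs_len by (simp add: around_def)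
  have cyc: "is_cyc ?xs \<longleftrightarrow> closed_end x"
  proof
    assume "closed_end x" then show "is_cyc ?xs" using rx x by (auto simp: is_cyc_def)
  next
    assume "is_cyc ?xs"
    then obtain y where y: "root y" "closed_end y" "?xs = rev (upper y) @ strand y" by (auto simp: is_cyc_def)
    have yP: "y < P" using y by (simp add: root_def)
    have "set (strand x) \<union> set (upper x) = set (strand y) \<union> set (upper y)" using y(3)
      by (metis set_append set_rev sup_commute)
    then have "x \<in> set (strand y) \<union> set (upper y)" using xs by blast
    then have "x \<in> set (strand y)" using upper_props(3)[OF yP] x(1) by auto
    then have "x = y" using root_unique[OF rx y(1)] xs by blast
    then show "closed_end x" using y by simp
  qed
  note r = fold.removed_iff_stable_output[OF assms(1) fold_forest_input[OF assms(2)] m0 \<omega> K xin e]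
  have "{x, x + P} \<in> removed_edges (mpc_output A n \<omega> m0) \<longleftrightarrow> closed_end x"
  proof (cases "closed_end x")
    case True
    then have lD: "?l = Suc D" using h_last_strand[OF x(1)] x(2) by (simp add: closed_end_def)
    have "zs \<noteq> []" using zs_len by auto
    \<comment> \<open>\<open>around D zs\<close> is \<open>zs\<close> rotated by half its length,
      hence the same cycle.\<close>
    then have "cycle_edges (around D zs) = cycle_edges zs"
      using cycle_edges_rotate[of "take (Suc D) zs" "drop (Suc D) zs"] zs_len by (simp add: around_def)
    moreover have "set (around D zs) = set zs"
      by (metis append_take_drop_id around_def set_append sup_commute zs_len diff_Suc_Suc add_Suc_right
          add_2_eq_Suc' diff_add_inverse mult_2 add_diff_cancel_right')
    ultimately show ?thesis
      using r assms(3) True id unfolding ar cyc by (simp add: lD comp_edges_def sensitive_cycle_def)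
  next
    case False
    then show ?thesis
      using r assms(3) id l unfolding ar cyc by (simp add: comp_edges_def sensitive_cycle_def)
  qed
  also have "closed_end x \<longleftrightarrow> (\<forall>i\<le>D. h ((s ^^ i) x) = i)"
  proof
    assume "closed_end x"
    then have "?l = Suc D" using h_last_strand[OF x(1)] x(2) by (simp add: closed_end_def)
    then show "\<forall>i\<le>D. h ((s ^^ i) x) = i" using nth_strand[OF x(1)] x(2) by (metis add_0 le_imp_less_Suc)
  next
    \<comment> \<open>A strand that stops early ends in a node without a link, which contradicts the
      layers along the walk.\<close>
    assume a: "\<forall>i\<le>D. h ((s ^^ i) x) = i"
    have "last (strand x) = (s ^^ (?l - 1)) x"
      using nth_strand[OF x(1), of "?l - 1"] l strand_nonempty[OF x(1)] by (simp add: last_conv_nth)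
    then have "h (s ((s ^^ (?l - 1)) x)) \<noteq> Suc (h ((s ^^ (?l - 1)) x))"
      using not_link_last[OF x(1)] by (simp add: link_def)
    moreover have "(s ^^ ?l) x = s ((s ^^ (?l - 1)) x)" using l by (cases ?l) auto
    ultimately have "\<not> ?l \<le> D" using a[rule_format, of ?l] a[rule_format, of "?l - 1"] l by auto
    then have "?l = Suc D" using l by simp
    then show "closed_end x" using h_last_strand[OF x(1)] x(2) by (simp add: closed_end_def)
  qed
  finally show ?thesis .
qed

end

section \<open>A small family of layerings\<close>

text \<open>Averaging: the hitting pairs are counted once by elements and once by tests.\<close>

lemma exists_good_test:
  fixes hit :: "'x \<Rightarrow> 't \<Rightarrow> bool"
  assumes "finite U" "finite T" "T \<noteq> {}" "0 < K"
    and "\<And>x. x \<in> U \<Longrightarrow> card T \<le> K * card {t \<in> T. hit x t}"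
  shows "\<exists>t\<in>T. card U \<le> K * card {x \<in> U. hit x t}"
proof (rule ccontr)
  assume "\<not> ?thesis"
  then have lt: "K * card {x \<in> U. hit x t} < card U" if "t \<in> T" for t using that by (auto simp: not_le)
  have "card U * card T \<le> (\<Sum>x\<in>U. K * card {t \<in> T. hit x t})"
    using sum_mono[of U "\<lambda>_. card T", OF assms(5)] by simp
  also have "\<dots> = K * (\<Sum>x\<in>U. \<Sum>t\<in>T. if hit x t then 1 else 0)"
    using assms(2) by (simp add: sum_distrib_left sum.If_cases Int_def)
  also have "\<dots> = K * (\<Sum>t\<in>T. \<Sum>x\<in>U. if hit x t then 1 else 0)"
    by (subst sum.swap) simp
  also have "\<dots> = (\<Sum>t\<in>T. K * card {x \<in> U. hit x t})"
    using assms(1) by (simp add: sum_distrib_left sum.If_cases Int_def)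
  also have "\<dots> < (\<Sum>t\<in>T. card U)"
    by (rule sum_strict_mono) (use assms lt in auto)
  finally show False by (simp add: mult.commute)
qed

text \<open>Greedy choice: some test hits at least a fraction \<open>1 / K\<close> of what is still
  unhit, so each further test shrinks the rest by the factor \<open>1 - 1 / K\<close>.\<close>

lemma greedy_tests:
  fixes hit :: "'x \<Rightarrow> 't \<Rightarrow> bool"
  assumes "finite X" "finite T" "T \<noteq> {}" "0 < K"
    and "\<And>x. x \<in> X \<Longrightarrow> card T \<le> K * card {t \<in> T. hit x t}"
  shows "\<exists>ts. length ts = r \<and> set ts \<subseteq> T \<and>
    real (card {x \<in> X. \<forall>t\<in>set ts. \<not> hit x t}) \<le> (1 - 1 / real K) ^ r * real (card X)"
proof (induction r)
  case (Suc r)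
  then obtain ts where ts: "length ts = r" "set ts \<subseteq> T"
    "real (card {x \<in> X. \<forall>t\<in>set ts. \<not> hit x t}) \<le> (1 - 1 / real K) ^ r * real (card X)" by blast
  let ?U = "{x \<in> X. \<forall>t\<in>set ts. \<not> hit x t}"
  have fin: "finite ?U" using assms(1) by simp
  obtain t where t: "t \<in> T" "card ?U \<le> K * card {x \<in> ?U. hit x t}"
    using exists_good_test[OF fin assms(2-4), of hit] assms(5) by auto
  have "card ?U = card ({x \<in> ?U. hit x t} \<union> {x \<in> ?U. \<not> hit x t})" by (rule arg_cong[of _ _ card]) blast
  also have "\<dots> = card {x \<in> ?U. hit x t} + card {x \<in> ?U. \<not> hit x t}"
    by (rule card_Un_disjoint) (use assms(1) in auto)
  finally have split: "card ?U = card {x \<in> ?U. hit x t} + card {x \<in> ?U. \<not> hit x t}" .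
  have "real (card ?U) \<le> real (K * card {x \<in> ?U. hit x t})"
    using t(2) by (simp only: of_nat_le_iff)
  then have "real (card ?U) \<le> real K * real (card {x \<in> ?U. hit x t})" by (simp only: of_nat_mult)
  then have "real (card ?U) / real K \<le> real (card {x \<in> ?U. hit x t})"
    using assms(4) by (simp add: divide_le_eq mult.commute)
  then have "real (card {x \<in> ?U. \<not> hit x t}) \<le> real (card ?U) - real (card ?U) / real K"
    using split by linarith
  then have "real (card {x \<in> ?U. \<not> hit x t}) \<le> (1 - 1 / real K) * real (card ?U)"
    by (simp add: left_diff_distrib)
  also have "\<dots> \<le> (1 - 1 / real K) * ((1 - 1 / real K) ^ r * real (card X))"
    by (rule mult_left_mono[OF ts(3)]) (use assms(4) in simp)
  finally have "real (card {x \<in> ?U. \<not> hit x t}) \<le> (1 - 1 / real K) ^ Suc r * real (card X)"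
    by (simp add: mult.assoc)
  moreover have "{x \<in> ?U. \<not> hit x t} = {x \<in> X. \<forall>t\<in>set (t # ts). \<not> hit x t}" by auto
  ultimately show ?case using ts t(1) by (intro exI[of _ "t # ts"]) auto
qed simp

text \<open>Since \<open>1 - 1 / K\<close> is at most \<open>exp (- (1 / K))\<close>, fewer than one
  element survives once \<open>r\<close> exceeds \<open>K * ln (card X)\<close>.\<close>

lemma covering_tests:
  fixes hit :: "'x \<Rightarrow> 't \<Rightarrow> bool"
  assumes "finite X" "finite T" "T \<noteq> {}" "0 < K"
    and "\<And>x. x \<in> X \<Longrightarrow> card T \<le> K * card {t \<in> T. hit x t}"
    and r: "real K * ln (real (card X)) < real r"
  shows "\<exists>ts. length ts = r \<and> set ts \<subseteq> T \<and> (\<forall>x\<in>X. \<exists>t\<in>set ts. hit x t)"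
proof -
  obtain ts where ts: "length ts = r" "set ts \<subseteq> T"
    "real (card {x \<in> X. \<forall>t\<in>set ts. \<not> hit x t}) \<le> (1 - 1 / real K) ^ r * real (card X)"
    using greedy_tests[of X T K hit r] assms(1-5) by blast
  have "(1 - 1 / real K) ^ r * real (card X) < 1"
  proof (cases "card X = 0")
    case False
    have "(1 - 1 / real K) ^ r \<le> exp (- (1 / real K)) ^ r"
      by (rule power_mono) (use exp_ge_add_one_self[of "- (1 / real K)"] assms(4) in auto)
    also have "\<dots> = exp (- (real r / real K))" by (simp add: exp_of_nat_mult[symmetric])
    finally have "(1 - 1 / real K) ^ r * real (card X) \<le> exp (- (real r / real K)) * real (card X)"
      by (simp add: mult_right_mono)
    also have "\<dots> = exp (ln (real (card X)) - real r / real K)" using False by (simp add: exp_diff exp_minus field_simps)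
    also have "\<dots> < 1" using r assms(4) by (simp add: field_simps)
    finally show ?thesis .
  qed simp
  then have "card {x \<in> X. \<forall>t\<in>set ts. \<not> hit x t} = 0" using ts(3) by linarith
  then show ?thesis using ts assms(1) by auto
qed

text \<open>A random layering takes prescribed values at \<open>D + 2\<close> given nodes with
  probability \<open>1 / (D + 1) ^ (D + 2)\<close>, and there are at most \<open>P ^ (D + 2)\<close>
  lists of such nodes; greedy covering gives the bound on \<open>Q\<close>. The extra node
  \<open>t\<close> is kept out of layer \<open>D\<close>, so every wrong candidate for the end of a
  walk is refuted by some layering in which the walk is complete.\<close>

lemma exists_layerings:
  fixes P D Q :: nat
  assumes D: "1 \<le> D" and P: "D + 2 \<le> P"
    and Q: "real ((D + 1) ^ (D + 2)) * (real (D + 2) * ln (real P)) < real Q"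
  shows "\<exists>H :: nat \<Rightarrow> nat \<Rightarrow> nat. (\<forall>I<Q. \<forall>x<P. H I x \<le> D) \<and>
    (\<forall>xs t. distinct xs \<and> length xs = D + 1 \<and> set xs \<subseteq> {..<P} \<and> t < P \<and> t \<noteq> last xs \<longrightarrow>
       (\<exists>I<Q. (\<forall>i\<le>D. H I (xs ! i) = i) \<and> H I t \<noteq> D))"
proof -
  let ?m = "D + 2"
  \<comment> \<open>The entry after the walk is sent to layer 0, which differs from \<open>D\<close>
    because \<open>1 \<le> D\<close>.\<close>
  define v where "v i = (if i \<le> D then i else 0)" for i :: nat
  define T where "T = {..<P} \<rightarrow>\<^sub>E {..D}"
  define X where "X = {xs :: nat list. length xs = ?m \<and> distinct xs \<and> set xs \<subseteq> {..<P}}"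
  define hit where "hit xs h \<longleftrightarrow> (\<forall>i<?m. h (xs ! i) = v i)" for xs :: "nat list" and h :: "nat \<Rightarrow> nat"
  have finX: "finite X"
    by (rule finite_subset[OF _ finite_lists_length_eq[of "{..<P}" ?m]]) (auto simp: X_def)
  have finT: "finite T" by (simp add: T_def finite_PiE)
  have cT: "card T = (D + 1) ^ P" by (simp add: T_def card_PiE)
  have neT: "T \<noteq> {}" by (auto simp: T_def PiE_eq_empty_iff)
  have hits: "card {h \<in> T. hit xs h} = (D + 1) ^ (P - ?m)" if xs: "xs \<in> X" for xs
  proof -
    define g where "g x = v (the_inv_into {..<?m} ((!) xs) x)" for x
    have inj: "inj_on ((!) xs) {..<?m}" using xs by (auto simp: X_def inj_on_def nth_eq_iff_index_eq)
    have g: "g (xs ! i) = v i" if "i < ?m" for i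
      using the_inv_into_f_f[OF inj, of i] that by (simp add: g_def)
    have gD: "v i \<le> D" for i by (simp add: v_def)
    \<comment> \<open>The values on the list are prescribed, and those at the other
      \<open>P - ?m\<close> nodes are free.\<close>
    have "{h \<in> T. hit xs h} = (\<Pi>\<^sub>E x\<in>{..<P}. if x \<in> set xs then {g x} else {..D})"
    proof (intro set_eqI iffI)
      fix h assume h: "h \<in> {h \<in> T. hit xs h}"
      have "h x = g x" if x: "x \<in> set xs" for x
      proof -
        obtain i where "i < length xs" "x = xs ! i" using x by (metis in_set_conv_nth)
        then show ?thesis using h g xs by (auto simp: hit_def X_def)
      qed
      then show "h \<in> (\<Pi>\<^sub>E x\<in>{..<P}. if x \<in> set xs then {g x} else {..D})"
        using h by (auto simp: T_def PiE_iff)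
    next
      fix h assume h: "h \<in> (\<Pi>\<^sub>E x\<in>{..<P}. if x \<in> set xs then {g x} else {..D})"
      have "h x \<le> D" if "x < P" for x
      proof (cases "x \<in> set xs")
        case True
        then have "h x = g x" using PiE_mem[OF h, of x] that by simp
        then show ?thesis by (simp add: g_def gD)
      qed (use PiE_mem[OF h, of x] that in simp)
      then have "h \<in> T" using h by (auto simp: T_def PiE_iff)
      moreover have "hit xs h"
        unfolding hit_def
      proof (intro allI impI)
        fix i assume i: "i < ?m"
        then have "xs ! i \<in> set xs" using xs by (simp add: X_def)
        moreover from this have "xs ! i < P" using xs by (auto simp: X_def)
        ultimately have "h (xs ! i) = g (xs ! i)" using PiE_mem[OF h, of "xs ! i"] by simp
        then show "h (xs ! i) = v i" using g[OF i] by simp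
      qed
      ultimately show "h \<in> {h \<in> T. hit xs h}" by simp
    qed
    then have "card {h \<in> T. hit xs h} = (\<Prod>x<P. card (if x \<in> set xs then {g x} else {..D}))"
      by (simp add: card_PiE)
    also have "\<dots> = (\<Prod>x<P. if x \<in> set xs then 1 else D + 1)" by (rule prod.cong) auto
    also have "\<dots> = (D + 1) ^ card ({..<P} - set xs)"
      by (simp add: prod.If_cases Int_absorb1 Diff_eq)
    also have "card ({..<P} - set xs) = P - ?m"
      using xs by (subst card_Diff_subset) (auto simp: X_def distinct_card)
    finally show ?thesis .
  qed
  have "card T \<le> (D + 1) ^ ?m * card {h \<in> T. hit xs h}" if "xs \<in> X" for xs
  proof -
    have "P = ?m + (P - ?m)" using P by simp
    then have "(D + 1) ^ P = (D + 1) ^ (?m + (P - ?m))" by (rule arg_cong)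
    also have "\<dots> = (D + 1) ^ ?m * (D + 1) ^ (P - ?m)" by (rule power_add)
    finally show ?thesis unfolding hits[OF that] cT by (rule eq_refl)
  qed
  moreover have "real ((D + 1) ^ ?m) * ln (real (card X)) < real Q"
  proof (cases "card X = 0")
    case True
    have "0 \<le> real ((D + 1) ^ ?m) * (real ?m * ln (real P))"
      using P by (intro mult_nonneg_nonneg ln_ge_zero) auto
    then show ?thesis using Q True by simp
  next
    case False
    have "card X \<le> card {xs :: nat list. set xs \<subseteq> {..<P} \<and> length xs = ?m}"
      by (rule card_mono[OF finite_lists_length_eq]) (auto simp: X_def)
    also have "\<dots> = P ^ ?m" by (simp add: card_lists_length_eq)
    finally have "real (card X) \<le> real (P ^ ?m)" by (simp only: of_nat_le_iff)
    then have "ln (real (card X)) \<le> ln (real (P ^ ?m))"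
      using False by (intro ln_mono) simp_all
    also have "\<dots> = real ?m * ln (real P)" unfolding of_nat_power by (rule ln_realpow)
    finally have "real ((D + 1) ^ ?m) * ln (real (card X)) \<le> real ((D + 1) ^ ?m) * (real ?m * ln (real P))"
      by (intro mult_left_mono) auto
    then show ?thesis using Q by linarith
  qed
  ultimately obtain ts where ts: "length ts = Q" "set ts \<subseteq> T" "\<forall>x\<in>X. \<exists>t\<in>set ts. hit x t"
    using covering_tests[OF finX finT neT, of "(D + 1) ^ ?m" hit Q] by auto
  have "\<exists>I<Q. (\<forall>i\<le>D. (ts ! I) (xs ! i) = i) \<and> (ts ! I) t \<noteq> D"
    if xs: "distinct xs" "length xs = D + 1" "set xs \<subseteq> {..<P}" and t: "t < P" "t \<noteq> last xs" for xs t
  proof -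
    \<comment> \<open>If \<open>t\<close> lies on the walk before its end, its layer is below
      \<open>D\<close> anyway, and any node off the walk can fill the last place;
      \<open>D + 2 \<le> P\<close> provides one.\<close>
    obtain t' where t': "t' < P" "t' \<notin> set xs" "t \<notin> set xs \<Longrightarrow> t' = t"
    proof (cases "t \<in> set xs")
      case True
      have "\<not> {..<P} \<subseteq> set xs"
        using card_mono[of "set xs" "{..<P}"] distinct_card[OF xs(1)] xs(2) P by auto
      then show ?thesis using that True by blast
    qed (use t that in blast)
    have "xs @ [t'] \<in> X" using xs t' by (simp add: X_def)
    then obtain I where I: "I < Q" "hit (xs @ [t']) (ts ! I)" using ts by (metis in_set_conv_nth)
    have lay: "(ts ! I) (xs ! i) = i" if "i \<le> D" for i
      using I(2)[unfolded hit_def, rule_format, of i] that xs(2) by (simp add: v_def nth_append)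
    have "(ts ! I) t \<noteq> D"
    proof (cases "t \<in> set xs")
      case True
      then obtain i where i: "i < length xs" "t = xs ! i" by (metis in_set_conv_nth)
      have "xs \<noteq> []" using xs(2) by auto
      then have "i \<noteq> D" using t(2) i(2) xs(2) by (auto simp: last_conv_nth)
      then show ?thesis using lay[of i] i xs(2) by simp
    next
      case False
      then show ?thesis
        using I(2)[unfolded hit_def, rule_format, of "D + 1"] t'(3) xs(2) D by (simp add: v_def nth_append)
    qed
    then show ?thesis using I(1) lay by blast
  qed
  moreover have "(ts ! I) x \<le> D" if "I < Q" "x < P" for I x
  proof -
    have "ts ! I \<in> T" using that ts(1,2) nth_mem[of I ts] by blast
    then show ?thesis using PiE_mem[of "ts ! I" "{..<P}" "\<lambda>_. {..D}" x] that by (simp add: T_def)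
  qed
  ultimately show ?thesis by (intro exI[of _ "(!) ts"]) blast
qed

section \<open>Placing the records of an instance\<close>

lemma length_concat_const: "(\<And>r. r \<in> set rs \<Longrightarrow> length r = k) \<Longrightarrow> length (concat rs) = k * length rs"
  by (induction rs) auto

text \<open>
  The places of the \<open>2 n\<close> records of a cycle on \<open>n\<close> vertices serve as slots for the records of
  any sparser graph on \<open>n\<close> vertices.
\<close>

lemma exists_slots:
  assumes solves: "solves_almost_spanning_forest A n \<epsilon> p" and n: "3 \<le> n"
  shows "\<exists>\<sigma>. (\<forall>r<2 * n. \<sigma> r < machines A n) \<and>
    (\<forall>i<machines A n. 3 * card {r. r < 2 * n \<and> \<sigma> r = i} \<le> local_space A n)"
proof -
  let ?xs = "[0..<n]"
  interpret path_cycle_family "{?xs}" "\<lambda>_. True" "{..<n}" "cycle_edges ?xs"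
    by standard (use n in \<open>auto simp: comp_edges_def\<close>)
  have W: "n \<le> word_range A n" using solves by (simp add: solves_almost_spanning_forest_def)
  have "forest_input A n {..<n} (cycle_edges ?xs) id"
    by (rule forest_inputI) (use W in auto)
  then have "mpc_achieves A n (graph_records {..<n} (cycle_edges ?xs) id) p
      (\<lambda>mems. almost_spanning_forest_solution \<epsilon> {..<n} (cycle_edges ?xs) (removed_edges mems))"
    using solves unfolding solves_almost_spanning_forest_def by blast
  \<comment> \<open>Correctness includes that the input fits into the machines, so a placement of
    the cycle exists, with 3 words for each record.\<close>
  then obtain m0 where "m0 \<in> initial_memories A n (graph_records {..<n} (cycle_edges ?xs) id)"
    by (auto simp: mpc_achieves_def)
  then obtain \<rho> where \<rho>: "set (concat (map \<rho> [0..<machines A n])) = graph_records {..<n} (cycle_edges ?xs) id"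
    "\<And>i. m0 i = concat (\<rho> i)" "\<And>i. i < machines A n \<Longrightarrow> length (m0 i) \<le> local_space A n"
    by (auto simp: initial_memories_def)
  \<comment> \<open>First the vertex records, then the edges between consecutive numbers, and last
    the closing edge with its smaller end 0 in front, as \<open>graph_records\<close>
    demands.\<close>
  define rec where "rec r = (if r < n then [0, r, r] else
     if r = 2 * n - 1 then [1, 0, n - 1] else [1, r - n, Suc (r - n)])" for r
  have rec_in: "rec r \<in> graph_records {..<n} (cycle_edges ?xs) id" if r: "r < 2 * n" for r
  proof -
    consider "r < n" | "r = 2 * n - 1" | "n \<le> r" "r < 2 * n - 1" using r by linarith
    then show ?thesis
    proof cases
      case 1 then show ?thesis by (auto simp: rec_def graph_records_def)
    next
      case 2
      have "{0, n - 1} \<in> cycle_edges ?xs" using n by (auto simp: cycle_edges_def hd_conv_nth last_conv_nth)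
      then show ?thesis using 2 n by (auto simp: rec_def graph_records_def)
    next
      case 3
      then have "{r - n, Suc (r - n)} \<in> cycle_edges ?xs"
        using path_edges_nthI[of "r - n" ?xs] by (auto simp: cycle_edges_def)
      then show ?thesis using 3 by (auto simp: rec_def graph_records_def)
    qed
  qed
  have inj: "inj_on rec {..<2 * n}" using n by (auto simp: inj_on_def rec_def split: if_splits)
  have len3: "length r = 3" if "r \<in> graph_records {..<n} (cycle_edges ?xs) id" for r
    using that unfolding graph_records_def by (elim UnE CollectE exE conjE) simp_all
  have "\<exists>i<machines A n. rec r \<in> set (\<rho> i)" if "r < 2 * n" for r
  proof -
    have "rec r \<in> set (concat (map \<rho> [0..<machines A n]))" using rec_in[OF that] \<rho>(1) by simp
    then show ?thesis by auto
  qed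
  then obtain \<sigma> where \<sigma>: "\<And>r. r < 2 * n \<Longrightarrow> \<sigma> r < machines A n \<and> rec r \<in> set (\<rho> (\<sigma> r))" by metis
  have "3 * card {r. r < 2 * n \<and> \<sigma> r = i} \<le> local_space A n" if i: "i < machines A n" for i
  proof -
    have "card {r. r < 2 * n \<and> \<sigma> r = i} = card (rec ` {r. r < 2 * n \<and> \<sigma> r = i})"
      by (rule card_image[symmetric]) (rule inj_on_subset[OF inj], auto)
    also have "\<dots> \<le> card (set (\<rho> i))" by (rule card_mono) (use \<sigma> in auto)
    also have "\<dots> \<le> length (\<rho> i)" by (rule card_length)
    finally have c: "card {r. r < 2 * n \<and> \<sigma> r = i} \<le> length (\<rho> i)" .
    have "length r = 3" if "r \<in> set (\<rho> i)" for r
    proof (rule len3)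
      have "r \<in> set (concat (map \<rho> [0..<machines A n]))" using i that by auto
      then show "r \<in> graph_records {..<n} (cycle_edges ?xs) id" unfolding \<rho>(1) .
    qed
    then have "length (concat (\<rho> i)) = 3 * length (\<rho> i)" by (rule length_concat_const)
    then show ?thesis using c \<rho>(2,3) i by (metis mult_le_mono2 order_trans)
  qed
  then show ?thesis using \<sigma> by blast
qed

lemma distinct_concat_upt:
  assumes "\<And>x. x < P \<Longrightarrow> distinct (F x)" "\<And>x y. x < P \<Longrightarrow> y < x \<Longrightarrow> set (F x) \<inter> set (F y) = {}"
  shows "distinct (concat (map F [0..<P]))"
  using assms
proof (induction P)
  case (Suc P)
  have "set (concat (map F [0..<P])) \<inter> set (F P) = {}" using Suc.prems(2)[of P] by fastforce
  then show ?case using Suc by auto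
qed simp

text \<open>Entries are pairs of a slot and a record, and \<sigma> names the machine that owns the
  slot.\<close>

definition placed :: "(nat \<Rightarrow> nat) \<Rightarrow> (nat \<times> nat list) list \<Rightarrow> nat \<Rightarrow> nat list list" where
  "placed \<sigma> AL i = map snd (filter (\<lambda>p. \<sigma> (fst p) = i) AL)"

lemma placed_append: "placed \<sigma> (xs @ ys) i = placed \<sigma> xs i @ placed \<sigma> ys i"
  by (simp add: placed_def)

text \<open>Different records use different slots, so a machine never holds more records than it
  owns slots.\<close>

lemma initial_memories_placed:
  assumes slots: "\<And>r. r < k \<Longrightarrow> \<sigma> r < machines A n" "\<And>i. i < machines A n \<Longrightarrow> 3 * card {r. r < k \<and> \<sigma> r = i} \<le> local_space A n"
    and AL: "distinct (map fst AL)" "\<And>p. p \<in> set AL \<Longrightarrow> fst p < k" "distinct (map snd AL)"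
      "snd ` set AL = recs" "\<And>r. r \<in> recs \<Longrightarrow> length r = 3"
  shows "(\<lambda>i. if i < machines A n then concat (placed \<sigma> AL i) else []) \<in> initial_memories A n recs"
  unfolding initial_memories_def
proof (intro CollectI exI conjI allI impI)
  define \<rho> where "\<rho> i = (if i < machines A n then placed \<sigma> AL i else [])" for i
  have map_\<rho>: "map \<rho> [0..<machines A n] = map (placed \<sigma> AL) [0..<machines A n]"
    by (simp add: \<rho>_def)
  show "distinct (concat (map \<rho> [0..<machines A n]))"
  proof (subst map_\<rho>, rule distinct_concat_upt)
    show "distinct (placed \<sigma> AL x)" for x using AL(3) by (simp add: placed_def distinct_map_filter)
    show "set (placed \<sigma> AL x) \<inter> set (placed \<sigma> AL y) = {}" if "y < x" for x y
      using AL(3) that by (auto simp: placed_def distinct_map inj_on_def)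
  qed
  show "set (concat (map \<rho> [0..<machines A n])) = recs"
  proof
    show "set (concat (map \<rho> [0..<machines A n])) \<subseteq> recs"
      unfolding map_\<rho> AL(4)[symmetric] by (auto simp: placed_def)
    show "recs \<subseteq> set (concat (map \<rho> [0..<machines A n]))"
    proof
      fix r assume "r \<in> recs"
      then obtain p where p: "p \<in> set AL" "r = snd p" using AL(4) by blast
      then have "r \<in> set (placed \<sigma> AL (\<sigma> (fst p)))" by (auto simp: placed_def)
      then show "r \<in> set (concat (map \<rho> [0..<machines A n]))"
        using slots(1)[OF AL(2)[OF p(1)]] unfolding map_\<rho> by auto
    qed
  qed
  show "(if i < machines A n then concat (placed \<sigma> AL i) else []) = concat (\<rho> i)" for i
    by (simp add: \<rho>_def)
  fix i assume i: "i < machines A n"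
  have "distinct (map fst (filter (\<lambda>p. \<sigma> (fst p) = i) AL))" by (rule distinct_map_filter[OF AL(1)])
  then have "length (placed \<sigma> AL i) = card (fst ` set (filter (\<lambda>p. \<sigma> (fst p) = i) AL))"
    using distinct_card by (fastforce simp: placed_def)
  also have "\<dots> \<le> card {r. r < k \<and> \<sigma> r = i}" by (rule card_mono) (use AL(2) in auto)
  finally have "3 * length (placed \<sigma> AL i) \<le> local_space A n" using slots(2)[OF i] by linarith
  moreover have "length (concat (placed \<sigma> AL i)) = 3 * length (placed \<sigma> AL i)"
    by (rule length_concat_const) (use AL(4,5) in \<open>auto simp: placed_def\<close>)
  ultimately show "length (if i < machines A n then concat (placed \<sigma> AL i) else []) \<le> local_space A n" using i by simp
qed

definition pad_records :: "nat \<Rightarrow> nat \<Rightarrow> (nat \<times> nat list) list" where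
  "pad_records P n = map (\<lambda>v. (v, [0, v, 0])) [2 * P..<n]"

text \<open>With \<open>y\<close> the successor of \<open>x\<close>, node \<open>x\<close> can write
  all these records from the layers of \<open>x\<close> and \<open>y\<close> alone. Vertex slots lie
  below \<open>n\<close>; the edge slots start at \<open>n\<close>, \<open>n + P\<close> and
  \<open>n + 2 * P\<close>, so \<open>3 * P \<le> n\<close> keeps them below
  \<open>2 * n\<close>.\<close>

definition node_records :: "nat \<Rightarrow> nat \<Rightarrow> nat \<Rightarrow> nat list \<Rightarrow> (nat \<Rightarrow> nat) \<Rightarrow> nat \<Rightarrow> nat \<Rightarrow> (nat \<times> nat list) list" where
  "node_records P D n zs h x y =
     [(x, [0, x, zs ! h x]), (x + P, [0, x + P, zs ! (2 * D + 1 - h x)])]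
     @ (if h y = Suc (h x) then [(n + x, [1, min x y, max x y]), (n + P + x, [1, min x y + P, max x y + P])] else [])
     @ (if h x = 0 \<or> h x = D then [(n + 2 * P + x, [1, x, x + P])] else [])"

context fold_instance
begin

abbreviation "nrec x \<equiv> node_records P D n zs h x (s x)"

definition all_records :: "(nat \<times> nat list) list" where
  "all_records = pad_records P n @ concat (map nrec [0..<P])"

lemma link_neq: "link x \<Longrightarrow> s x \<noteq> x"
  by (auto simp: link_def)

lemma records_set: "snd ` set all_records = graph_records {..<n} fold_edges fold_ident"
proof
  show "snd ` set all_records \<subseteq> graph_records {..<n} fold_edges fold_ident"
  proof
    fix r assume "r \<in> snd ` set all_records"
    then have "r \<in> snd ` set (pad_records P n) \<or> (\<exists>x<P. r \<in> snd ` set (nrec x))"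
      by (auto simp: all_records_def image_Un image_UN)
    then consider v where "2 * P \<le> v" "v < n" "r = [0, v, 0]" | x where "x < P" "r \<in> snd ` set (nrec x)"
      by (auto simp: pad_records_def)
    then show "r \<in> graph_records {..<n} fold_edges fold_ident"
    proof cases
      case 1
      then have "fold_ident v = 0" by (simp add: fold_ident_def)
      then show ?thesis using 1 by (auto simp: graph_records_def)
    next
      case 2
      have e: "{min x (s x), max x (s x)} = {x, s x}" by (auto simp: min_def max_def)
      have e': "{min x (s x) + P, max x (s x) + P} = {x + P, s x + P}" by (auto simp: min_def max_def)
      have lt: "min x (s x) < max x (s x)" if "link x" using link_neq[OF that] by (auto simp: min_def max_def)
      consider "r = [0, x, zs ! h x]" | "r = [0, x + P, zs ! (2 * D + 1 - h x)]"
        | "link x" "r = [1, min x (s x), max x (s x)] \<or> r = [1, min x (s x) + P, max x (s x) + P]"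
        | "h x = 0 \<or> h x = D" "r = [1, x, x + P]"
        using 2(2) by (auto simp: node_records_def link_def split: if_splits)
      then show ?thesis
      proof cases
        case 3
        have "{x, s x} \<in> fold_edges" "{x + P, s x + P} \<in> fold_edges"
          using 2(1) 3(1) unfolding fold_edges_def by blast+
        then have "{min x (s x), max x (s x)} \<in> fold_edges" "{min x (s x) + P, max x (s x) + P} \<in> fold_edges"
          unfolding e e' .
        moreover have "[1, u, v] \<in> graph_records {..<n} fold_edges fold_ident" if "u < v" "{u, v} \<in> fold_edges" for u v
          using that unfolding graph_records_def by blast
        ultimately show ?thesis using 3(2) lt[OF 3(1)] add_less_cancel_right by blast
      next
        case 4
        then show ?thesis using vertical_in_fold_edges[OF 2(1)] P_pos by (auto simp: graph_records_def)
      qed (use 2(1) P_le in \<open>auto simp: graph_records_def fold_ident_def\<close>)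
    qed
  qed
  show "graph_records {..<n} fold_edges fold_ident \<subseteq> snd ` set all_records"
  proof
    fix r assume "r \<in> graph_records {..<n} fold_edges fold_ident"
    then consider v where "v < n" "r = [0, v, fold_ident v]" | u v where "u < v" "{u, v} \<in> fold_edges" "r = [1, u, v]"
      by (auto simp: graph_records_def)
    then show "r \<in> snd ` set all_records"
    proof cases
      case 1
      consider "v < P" | "P \<le> v" "v < 2 * P" | "2 * P \<le> v" by linarith
      then show ?thesis
      proof cases
        case a: 1
        then have "r \<in> snd ` set (nrec v)" using 1 by (simp add: node_records_def fold_ident_def)
        then show ?thesis using a by (force simp: all_records_def)
      next
        case a: 2
        then have "r \<in> snd ` set (nrec (v - P))" using 1 by (simp add: node_records_def fold_ident_def)
        moreover have "v - P < P" using a by linarith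
        ultimately show ?thesis by (force simp: all_records_def)
      next
        case 3
        then show ?thesis using 1 by (force simp: all_records_def pad_records_def fold_ident_def)
      qed
    next
      case 2
      have "\<exists>x<P. r \<in> snd ` set (nrec x)"
      proof -
        from 2(2) consider x where "x < P" "link x" "{u, v} = {x, s x}" | x where "x < P" "link x" "{u, v} = {x + P, s x + P}"
          | x where "x < P" "{u, v} = {x, x + P}" "h x = 0 \<or> h x = D"
          unfolding fold_edges_def by blast
        then show ?thesis
        proof cases
          case (1 x)
          then have "u = min x (s x)" "v = max x (s x)" using 2(1) by (auto simp: doubleton_eq_iff)
          then have "r \<in> snd ` set (nrec x)" using 1 2(3) by (simp add: node_records_def link_def)
          then show ?thesis using 1 by blast
        next
          case c: (2 x)
          then have "u = min x (s x) + P" "v = max x (s x) + P" using 2(1) by (auto simp: doubleton_eq_iff)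
          then have "r \<in> snd ` set (nrec x)" using c 2(3) by (simp add: node_records_def link_def)
          then show ?thesis using c by blast
        next
          case (3 x)
          then have "u = x" "v = x + P" using 2(1) by (auto simp: doubleton_eq_iff)
          then have "r \<in> snd ` set (nrec x)" using 3 2(3) by (auto simp: node_records_def)
          then show ?thesis using 3 by blast
        qed
      qed
      then show ?thesis by (force simp: all_records_def)
    qed
  qed
qed

lemma distinct_records: "distinct (map snd all_records)"
proof -
  have "distinct (map snd (concat (map nrec [0..<P])))"
    unfolding map_concat map_map
  proof (rule distinct_concat_upt)
    show "distinct ((map snd \<circ> nrec) x)" if "x < P" for x
      using P_pos s_less[OF that] that by (auto simp: node_records_def)
    show "set ((map snd \<circ> nrec) x) \<inter> set ((map snd \<circ> nrec) y) = {}" if "x < P" "y < x" for x y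
    proof -
      have a: "x < P" "y < P" "s x < P" "s y < P" using that s_less by auto
      have "\<not> (min x (s x) = min y (s y) \<and> max x (s x) = max y (s y))"
        if "h (s x) = Suc (h x)" "h (s y) = Suc (h y)"
      proof
        assume "min x (s x) = min y (s y) \<and> max x (s x) = max y (s y)"
        \<comment> \<open>Two links on the same pair of nodes would run in opposite directions, and
          each of the two layers would exceed the other.\<close>
        then have "x = s y \<and> y = s x" using \<open>y < x\<close> by (auto simp: min_def max_def split: if_splits)
        then have "h x = Suc (h y)" "h y = Suc (h x)" using that by metis+
        then show False by simp
      qed
      then show ?thesis using a \<open>y < x\<close> by (auto simp: node_records_def)
    qed
  qed
  moreover have "set (map snd (pad_records P n)) \<inter> set (map snd (concat (map nrec [0..<P]))) = {}"
    by (auto simp: pad_records_def node_records_def split: if_splits)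
  moreover have "distinct (map snd (pad_records P n))" by (auto simp: pad_records_def distinct_map inj_on_def)
  ultimately show ?thesis by (simp add: all_records_def)
qed

lemma slots_of_records:
  assumes "3 * P \<le> n"
  shows "distinct (map fst all_records)" "\<And>p. p \<in> set all_records \<Longrightarrow> fst p < 2 * n"
proof -
  have "distinct (map fst (concat (map nrec [0..<P])))"
    unfolding map_concat map_map
  proof (rule distinct_concat_upt)
    show "distinct ((map fst \<circ> nrec) x)" if "x < P" for x
      using that assms by (auto simp: node_records_def)
    have "\<exists>k\<in>{0, P, n, n + P, n + 2 * P}. q = k + x" if "q \<in> set ((map fst \<circ> nrec) x)" for q x
      using that by (auto simp: node_records_def split: if_splits)
    moreover have "x = y" if "k \<in> {0, P, n, n + P, n + 2 * P}" "k' \<in> {0, P, n, n + P, n + 2 * P}"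
      "k + x = k' + y" "x < P" "y < P" for k k' x y
      using that assms by auto
    ultimately have same: "x = y" if "q \<in> set ((map fst \<circ> nrec) x)" "q \<in> set ((map fst \<circ> nrec) y)" "x < P" "y < P" for q x y
      using that by metis
    show "set ((map fst \<circ> nrec) x) \<inter> set ((map fst \<circ> nrec) y) = {}" if xy: "x < P" "y < x" for x y
    proof (rule equals0I)
      fix q assume "q \<in> set ((map fst \<circ> nrec) x) \<inter> set ((map fst \<circ> nrec) y)"
      then have "x = y" using same[of q x y] xy by simp
      then show False using xy by simp
    qed
  qed
  moreover have "set (map fst (pad_records P n)) \<inter> set (map fst (concat (map nrec [0..<P]))) = {}"
    by (auto simp: pad_records_def node_records_def split: if_splits)
  moreover have "distinct (map fst (pad_records P n))" by (auto simp: pad_records_def distinct_map inj_on_def)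
  ultimately show "distinct (map fst all_records)" by (simp add: all_records_def)
  show "fst p < 2 * n" if "p \<in> set all_records" for p
    using that assms by (auto simp: all_records_def pad_records_def node_records_def split: if_splits)
qed

lemma records_in_range:
  assumes "p \<in> set all_records"
  shows "set (snd p) \<subseteq> {..<n}" "length (snd p) = 3"
proof -
  have "snd p \<in> graph_records {..<n} fold_edges fold_ident" using assms records_set by auto
  then consider v where "v < n" "snd p = [0, v, fold_ident v]" | u v where "{u, v} \<in> fold_edges" "snd p = [1, u, v]"
    by (auto simp: graph_records_def)
  then show "set (snd p) \<subseteq> {..<n}" "length (snd p) = 3"
  proof (atomize(full), cases)
    case (2 u v)
    have "\<exists>a\<in>{..<n}. \<exists>b\<in>{..<n}. a \<noteq> b \<and> {u, v} = {a, b}"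
      using 2(1) fold.path_cycle_graph unfolding path_cycle_graph_def simple_graph_def by blast
    then obtain a b where "a < n" "b < n" "{u, v} = {a, b}" by auto
    then have "{u, v} \<subseteq> {..<n}" by simp
    then show "set (snd p) \<subseteq> {..<n} \<and> length (snd p) = 3" using 2 P_le P_pos by auto
  qed (use fold_ident_less P_pos P_le in auto)
qed

lemma fold_initial_memories:
  assumes "3 * P \<le> n" "\<And>r. r < 2 * n \<Longrightarrow> \<sigma> r < machines A n"
    "\<And>i. i < machines A n \<Longrightarrow> 3 * card {r. r < 2 * n \<and> \<sigma> r = i} \<le> local_space A n"
  shows "(\<lambda>i. if i < machines A n then concat (placed \<sigma> all_records i) else [])
    \<in> initial_memories A n (graph_records {..<n} fold_edges fold_ident)"
proof (rule initial_memories_placed[where k = "2 * n"])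
  show "length r = 3" if "r \<in> graph_records {..<n} fold_edges fold_ident" for r
    using that unfolding graph_records_def by (elim UnE CollectE exE conjE) simp_all
qed (fact assms(2,3) slots_of_records[OF assms(1)] records_set distinct_records)+

end

section \<open>Programs for the machines\<close>

type_synonym step = "nat \<Rightarrow> nat list \<Rightarrow> nat list \<Rightarrow> nat list \<times> (nat \<times> nat) list"
type_synonym cfg = "(nat \<Rightarrow> nat list) \<times> (nat \<Rightarrow> nat list)"

definition msgs :: "nat \<Rightarrow> (nat \<times> nat) list \<Rightarrow> nat list" where
  "msgs i l = map snd (filter (\<lambda>(d, w). d = i) l)"

definition deliver :: "nat \<Rightarrow> (nat \<Rightarrow> (nat \<times> nat) list) \<Rightarrow> nat \<Rightarrow> nat list" where
  "deliver M sends i = concat (map (\<lambda>j. msgs i (sends j)) [0..<M])"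

definition apply_step :: "nat \<Rightarrow> step \<Rightarrow> cfg \<Rightarrow> cfg" where
  "apply_step M st c = (\<lambda>i. fst (st i (fst c i) (snd c i)), deliver M (\<lambda>j. snd (st j (fst c j) (snd c j))))"

text \<open>One list element per round, so the number of rounds is the length of the program. Steps
  are arbitrary functions and may have tables such as layerings, IDs or a tape built in.\<close>

fun exec :: "nat \<Rightarrow> step list \<Rightarrow> cfg \<Rightarrow> cfg" where
  "exec M [] c = c"
| "exec M (st # p) c = exec M p (apply_step M st c)"

definition fits :: "nat \<Rightarrow> nat \<Rightarrow> nat \<Rightarrow> cfg \<Rightarrow> bool" where
  "fits M S W c \<longleftrightarrow> (\<forall>i<M. length (fst c i) \<le> S \<and> set (fst c i) \<subseteq> {..<W} \<and> length (snd c i) \<le> S)"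

definition sends_ok :: "nat \<Rightarrow> nat \<Rightarrow> nat \<Rightarrow> step \<Rightarrow> cfg \<Rightarrow> bool" where
  "sends_ok M S W st c \<longleftrightarrow> (\<forall>i<M. length (snd (st i (fst c i) (snd c i))) \<le> S \<and>
     set (snd (st i (fst c i) (snd c i))) \<subseteq> {..<M} \<times> {..<W})"

fun safe :: "nat \<Rightarrow> nat \<Rightarrow> nat \<Rightarrow> step list \<Rightarrow> cfg \<Rightarrow> bool" where
  "safe M S W [] c = fits M S W c"
| "safe M S W (st # p) c = (fits M S W c \<and> sends_ok M S W st c \<and> safe M S W p (apply_step M st c))"

text \<open>Hoare triples whose conclusion includes the limits on memories, inboxes and messages in
  all rounds, so that composing programs also composes the resource bounds.\<close>

definition triple :: "nat \<Rightarrow> nat \<Rightarrow> nat \<Rightarrow> (cfg \<Rightarrow> bool) \<Rightarrow> step list \<Rightarrow> (cfg \<Rightarrow> bool) \<Rightarrow> bool" where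
  "triple M S W P p Q \<longleftrightarrow> (\<forall>c. P c \<longrightarrow> safe M S W p c \<and> Q (exec M p c))"

lemma exec_append: "exec M (p @ q) c = exec M q (exec M p c)"
  by (induction p arbitrary: c) auto

lemma safe_fits: "safe M S W p c \<Longrightarrow> fits M S W c"
  by (cases p) auto

lemma safe_append: "safe M S W (p @ q) c \<longleftrightarrow> safe M S W p c \<and> safe M S W q (exec M p c)"
  by (induction p arbitrary: c) (auto dest: safe_fits)

lemma triple_append: "triple M S W P p Q \<Longrightarrow> triple M S W Q q R \<Longrightarrow> triple M S W P (p @ q) R"
  unfolding triple_def safe_append exec_append by blast

lemma triple_step:
  assumes "\<And>c. P c \<Longrightarrow> fits M S W c" "\<And>c. Q c \<Longrightarrow> fits M S W c"
    and "\<And>c. P c \<Longrightarrow> sends_ok M S W st c" "\<And>c. P c \<Longrightarrow> Q (apply_step M st c)"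
  shows "triple M S W P [st] Q"
  using assms by (auto simp: triple_def)

lemma triple_iterate:
  assumes "\<And>c. I 0 c \<Longrightarrow> fits M S W c" "\<And>t. t < T \<Longrightarrow> triple M S W (I t) (p t) (I (Suc t))"
  shows "triple M S W (I 0) (concat (map p [0..<T])) (I T)"
  using assms(2)
proof (induction T)
  case 0
  then show ?case using assms(1) by (auto simp: triple_def)
next
  case (Suc T)
  then have "triple M S W (I 0) (concat (map p [0..<T])) (I T)" by simp
  then show ?case using triple_append[OF _ Suc.prems[of T]] by simp
qed

lemma triple_conseq:
  "triple M S W P p Q \<Longrightarrow> (\<And>c. P' c \<Longrightarrow> P c) \<Longrightarrow> (\<And>c. Q c \<Longrightarrow> Q' c) \<Longrightarrow> triple M S W P' p Q'"
  by (auto simp: triple_def)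

lemma msgs_Nil [simp]: "msgs i [] = []"
  and msgs_append: "msgs i (xs @ ys) = msgs i xs @ msgs i ys"
  and msgs_Cons: "msgs i ((d, w) # xs) = (if d = i then w # msgs i xs else msgs i xs)"
  by (auto simp: msgs_def)

lemma msgs_concat: "msgs i (concat xss) = concat (map (msgs i) xss)"
  by (induction xss) (auto simp: msgs_append)

abbreviation tagged :: "nat \<Rightarrow> nat list \<Rightarrow> (nat \<times> nat) list" where
  "tagged d ws \<equiv> map (Pair d) ws"

lemma msgs_tagged [simp]: "msgs i (tagged d ws) = (if d = i then ws else [])"
  by (induction ws) (auto simp: msgs_Cons)

lemma msgs_map_Pair: "msgs i (map (\<lambda>x. (g x, k x)) xs) = map k (filter (\<lambda>x. g x = i) xs)"
  by (induction xs) (auto simp: msgs_Cons)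

lemma concat_map_filter_nonempty:
  "(\<And>x. x \<in> set xs \<Longrightarrow> \<not> R x \<Longrightarrow> g x = []) \<Longrightarrow> concat (map g xs) = concat (map g (filter R xs))"
  by (induction xs) auto

section \<open>Inboxes under renumbering of the senders\<close>

lemma filter_upt_image:
  assumes "\<And>x y. x < y \<Longrightarrow> y < k \<Longrightarrow> e x < (e y :: nat)" "\<And>x. x < k \<Longrightarrow> e x < M"
  shows "filter (\<lambda>j. j \<in> e ` {..<k}) [0..<M] = map e [0..<k]"
proof (rule sorted_distinct_set_unique)
  show "sorted (map e [0..<k])" "distinct (map e [0..<k])"
    using assms(1) by (auto simp: sorted_iff_nth_mono_less less_imp_le distinct_conv_nth)
      (metis linorder_neqE_nat less_irrefl)
qed (use assms(2) in \<open>auto simp: sorted_wrt_filter atLeast0LessThan\<close>)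

text \<open>An inbox is ordered by its senders. If all words come from machines \<open>e x\<close>
  with \<open>e\<close> increasing, it is the inbox that senders numbered \<open>x\<close> would
  produce; this allows an exact simulation.\<close>

lemma concat_map_embed:
  assumes "\<And>x y. x < y \<Longrightarrow> y < k \<Longrightarrow> e x < (e y :: nat)" "\<And>x. x < k \<Longrightarrow> e x < M"
    and "\<And>j. j < M \<Longrightarrow> j \<notin> e ` {..<k} \<Longrightarrow> g j = []"
  shows "concat (map g [0..<M]) = concat (map (\<lambda>x. g (e x)) [0..<k])"
proof -
  have "concat (map g [0..<M]) = concat (map g (filter (\<lambda>j. j \<in> e ` {..<k}) [0..<M]))"
    by (rule concat_map_filter_nonempty) (use assms(3) in auto)
  also have "filter (\<lambda>j. j \<in> e ` {..<k}) [0..<M] = map e [0..<k]"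
    by (rule filter_upt_image) (use assms in auto)
  finally show ?thesis by (simp add: o_def)
qed

lemma concat_map_upt_single:
  assumes "j0 < M" "\<And>j. j < M \<Longrightarrow> j \<noteq> j0 \<Longrightarrow> g j = []"
  shows "concat (map g [0..<M]) = g j0"
  using concat_map_embed[of 1 "\<lambda>_. j0" M g] assms by (simp add: lessThan_Suc)

lemma deliver_embed:
  assumes "\<And>x y. x < y \<Longrightarrow> y < k \<Longrightarrow> e x < (e y :: nat)" "\<And>x. x < k \<Longrightarrow> e x < M"
    and "\<And>j. j < M \<Longrightarrow> j \<notin> e ` {..<k} \<Longrightarrow> msgs i (sends j) = []"
  shows "deliver M sends i = concat (map (\<lambda>x. msgs i (sends (e x))) [0..<k])"
  unfolding deliver_def by (rule concat_map_embed[OF assms]) auto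

lemma deliver_single:
  assumes "j0 < M" "\<And>j. j < M \<Longrightarrow> j \<noteq> j0 \<Longrightarrow> msgs i (sends j) = []"
  shows "deliver M sends i = msgs i (sends j0)"
  unfolding deliver_def by (rule concat_map_upt_single) (use assms in auto)

lemma deliver_none: "(\<And>j. j < M \<Longrightarrow> msgs i (sends j) = []) \<Longrightarrow> deliver M sends i = []"
  by (auto simp: deliver_def)

lemma deliver_eq_Nil_iff: "deliver M sends i = [] \<longleftrightarrow> (\<forall>j<M. msgs i (sends j) = [])"
  by (auto simp: deliver_def)

lemma length_deliver: "length (deliver M sends i) = (\<Sum>j<M. length (msgs i (sends j)))"
  by (simp add: deliver_def length_concat o_def sum_list_sum_nth lessThan_atLeast0)

section \<open>Roles of the machines\<close>

text \<open>
  Machines below \<open>P\<close> are nodes.  The others take part in the simulation of several runs, numbered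
  by \<open>I\<close>: \<open>sim_code P I i\<close> plays machine \<open>i\<close> of run \<open>I\<close>, and the machines
  \<open>tree_code P I x j\<close> collect what run \<open>I\<close> reports to node \<open>x\<close>.
\<close>

definition sim_code :: "nat \<Rightarrow> nat \<Rightarrow> nat \<Rightarrow> nat" where
  "sim_code P I i = P + 2 * prod_encode (I, i)"

definition tree_code :: "nat \<Rightarrow> nat \<Rightarrow> nat \<Rightarrow> nat \<Rightarrow> nat" where
  "tree_code P I x j = P + 2 * prod_encode (prod_encode (I, x), j) + 1"

text \<open>The parity of \<open>i - P\<close> separates the two kinds of codes, and
  \<open>prod_decode\<close> recovers their indices.\<close>

definition roles :: "nat \<Rightarrow> (nat \<Rightarrow> 'a) \<Rightarrow> (nat \<Rightarrow> nat \<Rightarrow> 'a) \<Rightarrow> (nat \<Rightarrow> nat \<Rightarrow> nat \<Rightarrow> 'a) \<Rightarrow> nat \<Rightarrow> 'a" where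
  "roles P fV fS fT i = (if i < P then fV i else
     (let (a, j) = prod_decode ((i - P) div 2) in
      if even (i - P) then fS a j else (let (I, x) = prod_decode a in fT I x j)))"

lemma roles_node [simp]: "i < P \<Longrightarrow> roles P fV fS fT i = fV i"
  by (simp add: roles_def)

lemma roles_sim [simp]: "roles P fV fS fT (sim_code P I i) = fS I i"
  by (simp add: roles_def sim_code_def)

lemma roles_tree [simp]: "roles P fV fS fT (tree_code P I x j) = fT I x j"
  by (simp add: roles_def tree_code_def)

lemma role_cases:
  obtains "i < P" | I k where "i = sim_code P I k" | I x j where "i = tree_code P I x j"
proof (cases "i < P")
  case False
  then have i: "i = P + (i - P)" by simp
  obtain a j where aj: "prod_decode ((i - P) div 2) = (a, j)" by fastforce
  then have e: "prod_encode (a, j) = (i - P) div 2" by (metis prod_decode_inverse)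
  show ?thesis
  proof (cases "even (i - P)")
    case True
    then have "i = sim_code P a j" using i by (simp add: sim_code_def e)
    then show ?thesis using that by blast
  next
    case odd: False
    obtain I x where "prod_decode a = (I, x)" by fastforce
    then have "prod_encode (I, x) = a" by (metis prod_decode_inverse)
    moreover have "i - P = 2 * ((i - P) div 2) + 1" using odd by presburger
    ultimately have "i = tree_code P I x j" using i by (simp add: tree_code_def e)
    then show ?thesis using that by blast
  qed
qed (use that in blast)

lemma sim_code_eq [simp]: "sim_code P I i = sim_code P I' i' \<longleftrightarrow> I = I' \<and> i = i'"
  by (simp add: sim_code_def)

lemma tree_code_eq [simp]: "tree_code P I x j = tree_code P I' x' j' \<longleftrightarrow> I = I' \<and> x = x' \<and> j = j'"
  by (simp add: tree_code_def)

lemma code_neq [simp]: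
  "sim_code P I i \<noteq> tree_code P I' x j" "tree_code P I' x j \<noteq> sim_code P I i"
  by (simp_all add: sim_code_def tree_code_def) presburger+

lemma node_neq_code [simp]:
  "v < P \<Longrightarrow> v \<noteq> sim_code P I i" "v < P \<Longrightarrow> sim_code P I i \<noteq> v"
  "v < P \<Longrightarrow> v \<noteq> tree_code P I x j" "v < P \<Longrightarrow> tree_code P I x j \<noteq> v"
  "\<not> sim_code P I i < P" "\<not> tree_code P I x j < P"
  by (auto simp: sim_code_def tree_code_def)

lemma triangle_less: "a < b \<Longrightarrow> triangle a < triangle b"
proof (induction b)
  case (Suc b)
  then show ?case by (cases "a = b") (auto simp: less_Suc_eq)
qed simp

text \<open>Needed for \<open>deliver_embed\<close>: the machines of one run keep their order, and
  so do the words in simulated inboxes.\<close>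

lemma sim_code_mono: "i < i' \<Longrightarrow> sim_code P I i < sim_code P I i'"
  using triangle_less[of "I + i" "I + i'"] by (simp add: sim_code_def prod_encode_def)

lemma triangle_le_square: "triangle a \<le> a\<^sup>2"
  by (induction a) (auto simp: power2_eq_square)

lemma prod_encode_le: "prod_encode (a, b) \<le> (a + b + 1)\<^sup>2"
  using triangle_le_square[of "a + b"] by (simp add: prod_encode_def power2_eq_square)

text \<open>Comes from \<open>prod_encode (a, b) \<le> (a + b + 1)\<^sup>2\<close>, nested twice for
  the tree codes; hence it is polynomial in all parameters.\<close>

definition machine_bound :: "nat \<Rightarrow> nat \<Rightarrow> nat \<Rightarrow> nat" where
  "machine_bound P Q m = P + 2 * ((Q + P + 1)\<^sup>2 + m + Q + 1)\<^sup>2 + 2"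

lemma sim_code_less: "I < Q \<Longrightarrow> i < m \<Longrightarrow> sim_code P I i < machine_bound P Q m"
proof -
  assume "I < Q" "i < m"
  have "prod_encode (I, i) \<le> (I + i + 1)\<^sup>2" by (rule prod_encode_le)
  also have "\<dots> \<le> ((Q + P + 1)\<^sup>2 + m + Q + 1)\<^sup>2"
    by (rule power_mono) (use \<open>I < Q\<close> \<open>i < m\<close> in auto)
  finally show ?thesis by (simp add: sim_code_def machine_bound_def)
qed

lemma tree_code_less: "I < Q \<Longrightarrow> x < P \<Longrightarrow> j < m \<Longrightarrow> tree_code P I x j < machine_bound P Q m"
proof -
  assume "I < Q" "x < P" "j < m"
  have "prod_encode (I, x) \<le> (I + x + 1)\<^sup>2" by (rule prod_encode_le)
  also have "\<dots> \<le> (Q + P + 1)\<^sup>2" by (rule power_mono) (use \<open>I < Q\<close> \<open>x < P\<close> in auto)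
  finally have a: "prod_encode (I, x) \<le> (Q + P + 1)\<^sup>2" .
  have "prod_encode (prod_encode (I, x), j) \<le> (prod_encode (I, x) + j + 1)\<^sup>2" by (rule prod_encode_le)
  also have "\<dots> \<le> ((Q + P + 1)\<^sup>2 + m + Q + 1)\<^sup>2"
    by (rule power_mono) (use a \<open>j < m\<close> in auto)
  finally show ?thesis by (simp add: tree_code_def machine_bound_def)
qed

section \<open>Encoding of words\<close>

text \<open>The constructed algorithm has words below \<open>2 * N\<close>, while words of
  \<open>A\<close> and node numbers may be larger. Each is spelled as a block of exactly
  \<open>c\<close> words, so that concatenations can be decoded. Local computation is unrestricted,
  so an inverse obtained by choice serves as decoder.\<close>

locale word_code =
  fixes W X c :: nat and enc1 :: "nat \<Rightarrow> nat list"
  assumes enc1_inj: "inj_on enc1 {..<X}"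
    and enc1_length: "w < X \<Longrightarrow> length (enc1 w) = c"
    and enc1_set: "w < X \<Longrightarrow> set (enc1 w) \<subseteq> {..<W}"
    and c_pos: "0 < c"
begin

definition enc :: "nat list \<Rightarrow> nat list" where "enc ws = concat (map enc1 ws)"

definition dec :: "nat list \<Rightarrow> nat list" where "dec = inv_into {ws. set ws \<subseteq> {..<X}} enc"

lemma enc_Nil [simp]: "enc [] = []" and enc_Cons: "enc (w # ws) = enc1 w @ enc ws"
  and enc_append: "enc (xs @ ys) = enc xs @ enc ys"
  by (auto simp: enc_def)

lemma enc_concat: "enc (concat xss) = concat (map enc xss)"
  by (induction xss) (auto simp: enc_append)

lemma enc1_nonempty: "w < X \<Longrightarrow> enc1 w \<noteq> []"
  using enc1_length c_pos by fastforce

lemma enc_inj: "set xs \<subseteq> {..<X} \<Longrightarrow> set ys \<subseteq> {..<X} \<Longrightarrow> enc xs = enc ys \<Longrightarrow> xs = ys"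
proof (induction xs arbitrary: ys)
  case Nil
  then show ?case using enc1_nonempty by (cases ys) (auto simp: enc_Cons)
next
  case (Cons x xs)
  show ?case
  proof (cases ys)
    case Nil
    then show ?thesis using Cons.prems enc1_nonempty by (auto simp: enc_Cons)
  next
    case (Cons y ys')
    then have e: "enc1 x @ enc xs = enc1 y @ enc ys'" using Cons.prems by (simp add: enc_Cons)
    moreover have "length (enc1 x) = length (enc1 y)" using Cons.prems Cons enc1_length by simp
    ultimately have "enc1 x = enc1 y" "enc xs = enc ys'" by auto
    then show ?thesis using Cons.IH[of ys'] Cons.prems Cons enc1_inj by (auto simp: inj_on_def)
  qed
qed

lemma dec_enc [simp]: "set ws \<subseteq> {..<X} \<Longrightarrow> dec (enc ws) = ws"
  unfolding dec_def by (rule inv_into_f_f) (use enc_inj in \<open>auto simp: inj_on_def\<close>)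

lemma dec_enc1 [simp]: "w < X \<Longrightarrow> dec (enc1 w) = [w]"
  using dec_enc[of "[w]"] by (simp add: enc_def)

lemma length_enc: "set ws \<subseteq> {..<X} \<Longrightarrow> length (enc ws) = c * length ws"
  by (induction ws) (auto simp: enc_Cons enc1_length)

lemma set_enc: "set ws \<subseteq> {..<X} \<Longrightarrow> set (enc ws) \<subseteq> {..<W}"
  using enc1_set by (fastforce simp: enc_def)

lemma enc_eq_Nil_iff: "set ws \<subseteq> {..<X} \<Longrightarrow> enc ws = [] \<longleftrightarrow> ws = []"
  using enc1_nonempty by (cases ws) (auto simp: enc_Cons)

end

lemma exists_word_code:
  assumes "X \<le> W ^ c" "0 < c"
  shows "\<exists>enc1. word_code W X c enc1"
proof -
  let ?L = "{xs :: nat list. set xs \<subseteq> {..<W} \<and> length xs = c}"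
  have "card {..<X} \<le> card ?L" using assms by (simp add: card_lists_length_eq)
  then obtain f where "f ` {..<X} \<subseteq> ?L" "inj_on f {..<X}"
    using card_le_inj[of "{..<X}" ?L] finite_lists_length_eq[of "{..<W}" c] by auto
  then have "word_code W X c f" using assms(2) by unfold_locales auto
  then show ?thesis by blast
qed

section \<open>Replacing a permutation by its D-th power\<close>

lemma filter_eq_upt: "filter (\<lambda>y. y = x) (filter R [0..<P]) = (if x < P \<and> R x then [x] else [])"
  by (induction P) auto

lemma length_word_pairs: "finite (word_pairs m) \<and> card (word_pairs m) \<le> length m"
proof (induction m rule: word_pairs.induct)
  case (1 u v ws)
  then show ?case using card_insert_le_m1[of "Suc (length ws)" "word_pairs ws" "(u, v)"]
    by (simp add: card_insert_if)
qed auto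

text \<open>Everything that stays fixed while the permutation changes. In \<open>S_ge\<close>,
  \<open>15 * c * Q\<close> counts 5 records of 3 words, spelled with \<open>c\<close> words each,
  for \<open>Q\<close> runs, and \<open>c * local_space A n\<close> the simulated memories.
  \<open>Bf\<close> and \<open>lv\<close> are fan-in and depth of the trees that collect
  reports.\<close>

locale phase_setup = word_code W X c enc1
  for W X c and enc1 :: "nat \<Rightarrow> nat list" +
  fixes A :: mpc_algorithm and n :: nat and \<epsilon> p :: real and \<omega> :: "bool list" and f :: stable_output
    and D :: nat and zs :: "nat list" and P Q :: nat and H :: "nat \<Rightarrow> nat \<Rightarrow> nat" and \<sigma> :: "nat \<Rightarrow> nat"
    and Bf lv M S :: nat
  assumes stable: "stable_witness A f" and sens: "sensitive_cycle f n D \<omega> zs" and tape: "\<omega> \<in> tapes A n"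
    and solves: "solves_almost_spanning_forest A n \<epsilon> p"
    and D_pos: "1 \<le> D" and P_pos: "0 < P" and P_le: "3 * P \<le> n"
    and X_ge: "word_range A n \<le> X" "Q \<le> X" and W_ge: "2 \<le> W"
    and H_le: "I < Q \<Longrightarrow> x < P \<Longrightarrow> H I x \<le> D"
    and H_family: "distinct xs \<Longrightarrow> length xs = D + 1 \<Longrightarrow> set xs \<subseteq> {..<P} \<Longrightarrow> t < P \<Longrightarrow> t \<noteq> last xs \<Longrightarrow>
       \<exists>I<Q. (\<forall>i\<le>D. H I (xs ! i) = i) \<and> H I t \<noteq> D"
    and \<sigma>_less: "r < 2 * n \<Longrightarrow> \<sigma> r < machines A n"
    and \<sigma>_load: "i < machines A n \<Longrightarrow> 3 * card {r. r < 2 * n \<and> \<sigma> r = i} \<le> local_space A n"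
    and Bf_pos: "1 \<le> Bf" and Bf_lv: "machines A n \<le> Bf ^ lv"
    and M_ge: "machine_bound P Q (machines A n) \<le> M"
    and S_ge: "15 * c * Q \<le> S" "c * local_space A n \<le> S" "Bf \<le> S" "c \<le> S" "1 \<le> S"
begin

abbreviation "MA \<equiv> machines A n"
abbreviation "T \<equiv> rounds A n"
abbreviation "nothing \<equiv> \<lambda>_ _. ([], [])"

definition dispatch :: step where
  "dispatch = roles P
     (\<lambda>x m b. ([], concat (map (\<lambda>I. concat (map (\<lambda>(r, rec). tagged (sim_code P I (\<sigma> r)) (enc rec))
        (node_records P D n zs (H I) x (hd (dec b))))) [0..<Q])))
     (\<lambda>_ _. nothing) (\<lambda>_ _ _. nothing)"

text \<open>Padding vertices belong to no node, so the simulated machines add their records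
  themselves.\<close>

definition load :: step where
  "load = roles P (\<lambda>_. nothing)
     (\<lambda>I i m b. (if I < Q \<and> i < MA then enc (concat (placed \<sigma> (pad_records P n) i) @ dec b) else [], []))
     (\<lambda>_ _ _. nothing)"

definition simulate :: "nat \<Rightarrow> step" where
  "simulate t = roles P (\<lambda>_. nothing)
     (\<lambda>I i m b. if I < Q \<and> i < MA then
        (let res = local_comp A n t i \<omega> (dec m) (dec b) in
          (enc (fst res), concat (map (\<lambda>(d, w). tagged (sim_code P I d) (enc1 w)) (snd res))))
        else ([], []))
     (\<lambda>_ _ _. nothing)"

definition reports :: "nat list \<Rightarrow> nat \<Rightarrow> bool" where
  "reports m x \<longleftrightarrow> (x, x + P) \<in> word_pairs m \<or> (x + P, x) \<in> word_pairs m"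

definition report :: step where
  "report = roles P (\<lambda>_. nothing)
     (\<lambda>I i m b. ([], if I < Q \<and> i < MA then
        map (\<lambda>x. (tree_code P I x i, 0)) (filter (\<lambda>x. H I x = 0 \<and> reports (dec m) x) [0..<P]) else []))
     (\<lambda>_ _ _. nothing)"

text \<open>An edge may be listed by many machines at the end, possibly too many to write to one
  node directly. A tree of fan-in \<open>Bf\<close> merges their reports; it only matters whether
  anything arrives.\<close>

definition combine :: step where
  "combine = roles P (\<lambda>_. nothing) (\<lambda>_ _. nothing)
     (\<lambda>I x j m b. ([], if b = [] then [] else [(tree_code P I x (j div Bf), 0)]))"

definition hand_back :: step where
  "hand_back = roles P (\<lambda>_. nothing) (\<lambda>_ _. nothing)
     (\<lambda>I x j m b. ([], if b = [] \<or> j \<noteq> 0 then [] else tagged x (enc1 I)))"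

text \<open>Node \<open>x\<close> learns only in which runs its walk was complete. The layerings are
  built in, so it finds the end as the one node that all these runs put into layer
  \<open>D\<close>.\<close>

definition update :: step where
  "update = roles P
     (\<lambda>x m b. ([], if b = [] then [] else tagged x (enc1 (THE t. t < P \<and> (\<forall>I\<in>set (dec b). H I t = D)))))
     (\<lambda>_ _. nothing) (\<lambda>_ _ _. nothing)"

definition decide :: step where
  "decide = roles P (\<lambda>x m b. (if x = 0 then [if b = [] then 0 else 1] else [], []))
     (\<lambda>_ _. nothing) (\<lambda>_ _ _. nothing)"

definition gather :: "step list" where
  "gather = [dispatch, load] @ map simulate [0..<T] @ [report] @ replicate lv combine @ [hand_back]"

text \<open>Between phases all memories are empty: the value \<open>s x\<close> survives as a
  message delivered to node \<open>x\<close>.\<close>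

definition node_state :: "(nat \<Rightarrow> nat) \<Rightarrow> cfg \<Rightarrow> bool" where
  "node_state s cf \<longleftrightarrow> (\<forall>i<M. fst cf i = [] \<and>
     snd cf i = roles P (\<lambda>x. enc1 (s x)) (\<lambda>_ _. []) (\<lambda>_ _ _. []) i)"

lemma sim_less: "I < Q \<Longrightarrow> i < MA \<Longrightarrow> sim_code P I i < M"
  using sim_code_less[of I Q i MA P] M_ge by simp

lemma tree_less: "I < Q \<Longrightarrow> x < P \<Longrightarrow> j < MA \<Longrightarrow> tree_code P I x j < M"
  using tree_code_less[of I Q x P j MA] M_ge by simp

lemma P_less: "P < M"
  using M_ge by (simp add: machine_bound_def)

lemma MA_pos: "0 < MA"
  using \<sigma>_less[of 0] P_le P_pos by simp

lemma P_le_X: "P \<le> X"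
  using P_le X_ge(1) solves by (simp add: solves_almost_spanning_forest_def)

end

section \<open>One phase for a fixed permutation, round by round\<close>

locale phase = phase_setup +
  fixes s :: "nat \<Rightarrow> nat"
  assumes s_bij: "bij_betw s {..<P} {..<P}"
begin

lemma fold_instance: "I < Q \<Longrightarrow> fold_instance P D n s (H I) zs"
  using s_bij H_le D_pos P_pos P_le sens by unfold_locales (auto simp: sensitive_cycle_def)

abbreviation "nrec I x \<equiv> node_records P D n zs (H I) x (s x)"
abbreviation "AL I \<equiv> fold_instance.all_records P D n s (H I) zs"
abbreviation "edgs I \<equiv> fold_instance.fold_edges P D s (H I)"
abbreviation "idn I \<equiv> fold_instance.fold_ident P D (H I) zs"

definition start :: "nat \<Rightarrow> nat \<Rightarrow> nat list" where
  "start I i = (if i < MA then concat (placed \<sigma> (AL I) i) else [])"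

definition cfgA where "cfgA I t = config A n \<omega> (start I) t"

lemma n_le: "n \<le> word_range A n"
  using solves by (simp add: solves_almost_spanning_forest_def)

lemma start_initial: "I < Q \<Longrightarrow> start I \<in> initial_memories A n (graph_records {..<n} (edgs I) (idn I))"
  using fold_instance.fold_initial_memories[OF fold_instance P_le \<sigma>_less \<sigma>_load]
  by (simp add: start_def[abs_def])

text \<open>The folded graph is a legal input, and correctness of \<open>A\<close> bounds its
  resources for every tape, hence for the fixed tape \<omega>.\<close>

lemma limits: "I < Q \<Longrightarrow> within_limits A n \<omega> (start I)"
proof -
  assume I: "I < Q"
  have "mpc_achieves A n (graph_records {..<n} (edgs I) (idn I)) p
      (\<lambda>mems. almost_spanning_forest_solution \<epsilon> {..<n} (edgs I) (removed_edges mems))"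
    using fold_instance.fold_forest_input[OF fold_instance[OF I] n_le] solves
    unfolding solves_almost_spanning_forest_def by blast
  then show ?thesis using start_initial[OF I] tape unfolding mpc_achieves_def by blast
qed

lemma mem_limits:
  assumes "I < Q" "t \<le> T" "i < MA"
  shows "length (fst (cfgA I t) i) \<le> local_space A n" "set (fst (cfgA I t) i) \<subseteq> {..<word_range A n}"
    "length (snd (cfgA I t) i) \<le> local_space A n"
  using limits[OF assms(1)] assms by (auto simp: within_limits_def memory_after_def inbox_after_def cfgA_def)

abbreviation "resA I t i \<equiv> local_comp A n t i \<omega> (fst (cfgA I t) i) (snd (cfgA I t) i)"

lemma send_limits:
  assumes "I < Q" "t < T" "i < MA"
  shows "length (snd (resA I t i)) \<le> local_space A n" "set (snd (resA I t i)) \<subseteq> {..<MA} \<times> {..<word_range A n}"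
  using limits[OF assms(1)] assms
  unfolding within_limits_def sent_in_round_def memory_after_def inbox_after_def cfgA_def by blast+

lemma cfgA_0: "cfgA I 0 = (start I, \<lambda>_. [])"
  by (simp add: cfgA_def)

lemma cfgA_Suc: "fst (cfgA I (Suc t)) i = fst (resA I t i)"
    "snd (cfgA I (Suc t)) i = deliver MA (\<lambda>j. snd (resA I t j)) i"
  by (simp_all add: cfgA_def deliver_def msgs_def case_prod_beta Let_def)

text \<open>The limits restrict the length of inboxes; the words in them are bounded because they
  were sent within the limits.\<close>

lemma inbox_words:
  assumes "I < Q" "t \<le> T"
  shows "set (snd (cfgA I t) i) \<subseteq> {..<word_range A n}"
proof (cases t)
  case (Suc u)
  have "set (msgs i (snd (resA I u j))) \<subseteq> {..<word_range A n}" if "j < MA" for j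
    using send_limits(2)[OF assms(1) _ that, of u] Suc assms(2) by (fastforce simp: msgs_def)
  then show ?thesis unfolding Suc cfgA_Suc deliver_def by fastforce
qed (simp add: cfgA_0)

lemma words_X:
  assumes "I < Q" "t \<le> T" "i < MA"
  shows "set (fst (cfgA I t) i) \<subseteq> {..<X}" "set (snd (cfgA I t) i) \<subseteq> {..<X}"
  using mem_limits(2)[OF assms] inbox_words[OF assms(1,2)] X_ge(1) by fastforce+

lemma record_words:
  assumes "I < Q" "q \<in> set (AL I)"
  shows "set (snd q) \<subseteq> {..<X}" "length (snd q) = 3" "fst q < 2 * n"
proof -
  interpret F: fold_instance P D n s "H I" zs by (rule fold_instance[OF assms(1)])
  show "set (snd q) \<subseteq> {..<X}" "length (snd q) = 3" "fst q < 2 * n"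
    using F.records_in_range[OF assms(2)] F.slots_of_records(2)[OF P_le assms(2)] n_le X_ge(1) by auto
qed

lemma AL_eq: "I < Q \<Longrightarrow> AL I = pad_records P n @ concat (map (nrec I) [0..<P])"
  by (rule fold_instance.all_records_def[OF fold_instance])

lemma nrec_in_AL: "I < Q \<Longrightarrow> x < P \<Longrightarrow> set (nrec I x) \<subseteq> set (AL I)"
  by (auto simp: AL_eq)

lemma placed_words:
  assumes "I < Q" "set l \<subseteq> set (AL I)"
  shows "set (concat (placed \<sigma> l i)) \<subseteq> {..<X}"
  using assms record_words(1) by (fastforce simp: placed_def)

definition loaded_state :: "cfg \<Rightarrow> bool" where
  "loaded_state cf \<longleftrightarrow> (\<forall>i<M. fst cf i = [] \<and> snd cf i = roles P (\<lambda>_. [])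
     (\<lambda>I i. if I < Q \<and> i < MA then enc (concat (placed \<sigma> (concat (map (nrec I) [0..<P])) i)) else []) (\<lambda>_ _ _. []) i)"

definition sim_state :: "nat \<Rightarrow> cfg \<Rightarrow> bool" where
  "sim_state t cf \<longleftrightarrow> (\<forall>i<M.
     fst cf i = roles P (\<lambda>_. []) (\<lambda>I i. if I < Q \<and> i < MA then enc (fst (cfgA I t) i) else []) (\<lambda>_ _ _. []) i \<and>
     snd cf i = roles P (\<lambda>_. []) (\<lambda>I i. if I < Q \<and> i < MA then enc (snd (cfgA I t) i) else []) (\<lambda>_ _ _. []) i)"

definition reported :: "nat \<Rightarrow> nat \<Rightarrow> nat \<Rightarrow> bool" where
  "reported I x k \<longleftrightarrow> I < Q \<and> x < P \<and> k < MA \<and> H I x = 0 \<and> reports (fst (cfgA I T) k) x"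

text \<open>A collector at level \<open>l\<close> stands for the machines with the same quotient by
  \<open>Bf ^ l\<close>. Only emptiness of its inbox carries information.\<close>

definition tree_state :: "nat \<Rightarrow> cfg \<Rightarrow> bool" where
  "tree_state l cf \<longleftrightarrow> (\<forall>i<M. fst cf i = [] \<and> length (snd cf i) \<le> Bf \<and>
     (snd cf i \<noteq> []) = roles P (\<lambda>_. False) (\<lambda>_ _. False) (\<lambda>I x j. \<exists>k. reported I x k \<and> k div Bf ^ l = j) i)"

definition full :: "nat \<Rightarrow> nat \<Rightarrow> bool" where
  "full I x \<longleftrightarrow> I < Q \<and> (\<forall>i\<le>D. H I ((s ^^ i) x) = i)"

definition answer_state :: "cfg \<Rightarrow> bool" where
  "answer_state cf \<longleftrightarrow> (\<forall>i<M. fst cf i = [] \<and>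
     (if i < P then \<exists>Is. snd cf i = enc Is \<and> set Is = {I. full I i} \<and> length Is \<le> Q else snd cf i = []))"

lemma s_less: "x < P \<Longrightarrow> s x < P"
  using bij_betwE[OF s_bij] by auto

lemma funpow_less: "x < P \<Longrightarrow> (s ^^ i) x < P"
  by (induction i) (auto simp: s_less)

lemma enc1_fits: "w < X \<Longrightarrow> length (enc1 w) \<le> S \<and> set (enc1 w) \<subseteq> {..<W}"
  using enc1_length enc1_set S_ge(4) by simp

lemma node_state_fits: "node_state s cf \<Longrightarrow> fits M S W cf"
proof -
  have "length (roles P (\<lambda>x. enc1 (s x)) (\<lambda>_ _. []) (\<lambda>_ _ _. []) i :: nat list) \<le> S" for i
  proof (cases i rule: role_cases[of _ P])
    case 1
    then have "s i < X" using s_less P_le_X by fastforce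
    then show ?thesis using enc1_fits 1 by simp
  qed simp_all
  then show "node_state s cf \<Longrightarrow> fits M S W cf" by (simp add: node_state_def fits_def)
qed

lemma placed_load:
  assumes I: "I < Q" and i: "i < MA" and l: "set l \<subseteq> set (AL I)" and sub: "length (placed \<sigma> l i) \<le> length (placed \<sigma> (AL I) i)"
  shows "length (enc (concat (placed \<sigma> l i))) \<le> S"
proof -
  have l3: "length (concat (placed \<sigma> l' i)) = 3 * length (placed \<sigma> l' i)" if "set l' \<subseteq> set (AL I)" for l'
    by (rule length_concat_const) (use that record_words(2)[OF I] in \<open>auto simp: placed_def\<close>)
  have "length (concat (placed \<sigma> l i)) \<le> length (concat (placed \<sigma> (AL I) i))"
    using l3[OF l] l3[OF subset_refl] sub by simp
  also have "\<dots> \<le> local_space A n"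
    using mem_limits(1)[OF I _ i, of 0] i by (simp add: cfgA_0 start_def)
  finally have "c * length (concat (placed \<sigma> l i)) \<le> c * local_space A n" by (rule mult_le_mono2)
  from order_trans[OF this S_ge(2)] show ?thesis unfolding length_enc[OF placed_words[OF I l]] .
qed

lemma loaded_state_fits:
  assumes "loaded_state cf"
  shows "fits M S W cf"
proof -
  have "length (snd cf i) \<le> S" if "i < M" for i
  proof (cases i rule: role_cases[of _ P])
    case (2 I k)
    have "length (enc (concat (placed \<sigma> (concat (map (nrec I) [0..<P])) k))) \<le> S" if I: "I < Q" and k: "k < MA"
      by (rule placed_load[OF I k]) (use I in \<open>auto simp: AL_eq placed_append\<close>)
    then show ?thesis using assms that 2 by (simp add: loaded_state_def)
  qed (use assms that in \<open>simp_all add: loaded_state_def\<close>)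
  then show ?thesis using assms by (simp add: loaded_state_def fits_def)
qed

lemma sim_state_fits:
  assumes "sim_state t cf" "t \<le> T"
  shows "fits M S W cf"
  unfolding fits_def
proof (intro allI impI)
  fix i assume i: "i < M"
  show "length (fst cf i) \<le> S \<and> set (fst cf i) \<subseteq> {..<W} \<and> length (snd cf i) \<le> S"
  proof (cases i rule: role_cases[of _ P])
    case (2 I k)
    show ?thesis
    proof (cases "I < Q \<and> k < MA")
      case True
      then have "c * length (fst (cfgA I t) k) \<le> S" "c * length (snd (cfgA I t) k) \<le> S"
        using mem_limits(1,3)[of I t k] assms(2) S_ge(2) by (meson le_trans mult_le_mono2)+
      moreover have "fst cf i = enc (fst (cfgA I t) k)" "snd cf i = enc (snd (cfgA I t) k)"
        using assms(1) i True 2 by (simp_all add: sim_state_def)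
      ultimately show ?thesis using words_X[of I t k] True assms(2) by (simp add: length_enc set_enc)
    next
      case False
      then have "fst cf i = []" "snd cf i = []" using assms(1) i 2 by (auto simp: sim_state_def)
      then show ?thesis by simp
    qed
  qed (use assms(1) i in \<open>simp_all add: sim_state_def\<close>)
qed

lemma tree_state_fits: "tree_state l cf \<Longrightarrow> fits M S W cf"
  using S_ge(3) by (fastforce simp: tree_state_def fits_def)

lemma answer_state_fits: "answer_state cf \<Longrightarrow> fits M S W cf"
proof -
  assume a: "answer_state cf"
  have "length (snd cf i) \<le> S" if i: "i < M" for i
  proof (cases "i < P")
    case True
    then have "\<exists>Is. snd cf i = enc Is \<and> set Is = {I. full I i} \<and> length Is \<le> Q"
      using a i by (simp add: answer_state_def)
    then obtain Is where Is: "snd cf i = enc Is" "set Is = {I. full I i}" "length Is \<le> Q" by blast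
    have "set Is \<subseteq> {..<X}" using Is(2) X_ge(2) by (auto simp: full_def)
    then have "length (snd cf i) = c * length Is" using Is(1) length_enc by simp
    also have "\<dots> \<le> c * Q" using Is(3) by (rule mult_le_mono2)
    also have "\<dots> \<le> S" using S_ge(1) by simp
    finally show ?thesis .
  qed (use a i in \<open>simp add: answer_state_def\<close>)
  then show ?thesis using a by (simp add: answer_state_def fits_def)
qed

lemma msgs_records_same:
  "msgs (sim_code P I k) (concat (map (\<lambda>(r, rec). tagged (sim_code P I (\<sigma> r)) (enc rec)) l)) = enc (concat (placed \<sigma> l k))"
  by (induction l) (auto simp: msgs_append placed_def enc_append)

lemma msgs_records_other:
  "\<forall>k. i \<noteq> sim_code P I k \<Longrightarrow> msgs i (concat (map (\<lambda>(r, rec). tagged (sim_code P I (\<sigma> r)) (enc rec)) l)) = []"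
  by (induction l) (auto simp: msgs_append)

lemma enc_placed_concat:
  "concat (map (\<lambda>x. enc (concat (placed \<sigma> (g x) k))) xs) = enc (concat (placed \<sigma> (concat (map g xs)) k))"
  by (induction xs) (auto simp: placed_append enc_append, simp add: placed_def)

lemma length_nrec: "length (nrec I x) \<le> 5"
  by (simp add: node_records_def)

text \<open>The senders are the nodes in increasing order, so each simulated machine receives its
  records in the order in which \<open>all_records\<close> lists them after the padding.\<close>

lemma triple_dispatch: "triple M S W (node_state s) [dispatch] loaded_state"
proof (rule triple_step)
  fix cf assume st: "node_state s cf"
  have node: "hd (dec (snd cf x)) = s x" if "x < P" for x
  proof -
    have "s x < X" using s_less[OF that] P_le_X by simp
    then show ?thesis using st that P_less by (simp add: node_state_def)
  qed
  let ?out = "\<lambda>x I. concat (map (\<lambda>(r, rec). tagged (sim_code P I (\<sigma> r)) (enc rec)) (nrec I x))"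
  have sends: "dispatch i (fst cf i) (snd cf i) = ([], if i < P then concat (map (?out i) [0..<Q]) else [])" for i
    using node by (cases i rule: role_cases[of _ P]) (simp_all add: dispatch_def)
  show "sends_ok M S W dispatch cf"
    unfolding sends_ok_def sends
  proof (intro allI impI)
    fix i assume "i < M"
    show "length (snd ([] :: nat list, if i < P then concat (map (?out i) [0..<Q]) else [])) \<le> S \<and>
        set (snd ([] :: nat list, if i < P then concat (map (?out i) [0..<Q]) else [])) \<subseteq> {..<M} \<times> {..<W}"
    proof (cases "i < P")
      case True
      have len: "length (?out i I) \<le> 15 * c" if I: "I < Q" for I
      proof -
        have "length (tagged (sim_code P I (\<sigma> r)) (enc rec)) = 3 * c" if "(r, rec) \<in> set (nrec I i)" for r rec
          using that record_words[OF I, of "(r, rec)"] nrec_in_AL[OF I True] length_enc[of rec] by auto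
        then have "length (?out i I) = 3 * c * length (map (\<lambda>(r, rec). tagged (sim_code P I (\<sigma> r)) (enc rec)) (nrec I i))"
          by (intro length_concat_const) auto
        also have "\<dots> \<le> 3 * c * 5" using length_nrec by (intro mult_le_mono2) simp
        finally show ?thesis by simp
      qed
      have "length (concat (map (?out i) [0..<Q])) = (\<Sum>I<Q. length (?out i I))"
        by (simp only: length_concat map_map o_def sum_list_sum_nth length_map length_upt)
          (rule sum.cong, auto)
      also have "\<dots> \<le> (\<Sum>I<Q. 15 * c)" by (rule sum_mono) (use len in auto)
      also have "\<dots> \<le> S" using S_ge(1) by (simp add: mult.commute mult.left_commute)
      finally have "length (concat (map (?out i) [0..<Q])) \<le> S" .
      moreover have "set (?out i I) \<subseteq> {..<M} \<times> {..<W}" if I: "I < Q" for I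
      proof -
        have "sim_code P I (\<sigma> r) < M \<and> set (enc rec) \<subseteq> {..<W}" if "(r, rec) \<in> set (nrec I i)" for r rec
          using that record_words[OF I, of "(r, rec)"] nrec_in_AL[OF I True] set_enc[of rec] sim_less[OF I \<sigma>_less[of r]]
          by auto
        then show ?thesis by fastforce
      qed
      then have "set (concat (map (?out i) [0..<Q])) \<subseteq> {..<M} \<times> {..<W}" by fastforce
      ultimately show ?thesis using True by simp
    qed simp
  qed
  show "loaded_state (apply_step M dispatch cf)"
    unfolding loaded_state_def apply_step_def sends
  proof (intro allI impI conjI)
    fix i assume i: "i < M"
    have "deliver M (\<lambda>j. snd ([] :: nat list, if j < P then concat (map (?out j) [0..<Q]) else [])) i =
        concat (map (\<lambda>x. concat (map (\<lambda>I. msgs i (?out x I)) [0..<Q])) [0..<P])"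
      using P_less by (subst deliver_embed[of P "\<lambda>x. x"])
        (auto simp: msgs_concat o_def intro!: arg_cong[of _ _ concat])
    also have "\<dots> = roles P (\<lambda>_. [])
       (\<lambda>I k. if I < Q \<and> k < MA then enc (concat (placed \<sigma> (concat (map (nrec I) [0..<P])) k)) else []) (\<lambda>_ _ _. []) i"
    proof (cases i rule: role_cases[of _ P])
      case (2 I k)
      show ?thesis
      proof (cases "I < Q")
        case True
        have "concat (map (\<lambda>I'. msgs i (?out x I')) [0..<Q]) = enc (concat (placed \<sigma> (nrec I x) k))" for x
          using True by (subst concat_map_upt_single[of I]) (auto simp: 2 msgs_records_same msgs_records_other)
        moreover have "concat (map (\<lambda>x. enc (concat (placed \<sigma> (nrec I x) k))) [0..<P]) =
            enc (concat (placed \<sigma> (concat (map (nrec I) [0..<P])) k))"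
          by (rule enc_placed_concat)
        \<comment> \<open>Slots are below \<open>2 * n\<close> and hence owned by machines of
          \<open>A\<close>; surplus simulated machines receive nothing.\<close>
        moreover have "placed \<sigma> (concat (map (nrec I) [0..<P])) k = []" if "\<not> k < MA"
        proof -
          have "\<sigma> (fst q) < MA" if "q \<in> set (concat (map (nrec I) [0..<P]))" for q
            using record_words(3)[OF True, of q] that \<sigma>_less by (auto simp: AL_eq[OF True])
          then show ?thesis using that by (fastforce simp: placed_def filter_empty_conv)
        qed
        ultimately show ?thesis using True 2 by simp
      next
        case False
        then show ?thesis using 2 by (auto simp: msgs_records_other)
      qed
    qed (auto simp: msgs_records_other)
    finally show "snd (\<lambda>i. fst ([] :: nat list, if i < P then concat (map (?out i) [0..<Q]) else []),
        deliver M (\<lambda>j. snd ([] :: nat list, if j < P then concat (map (?out j) [0..<Q]) else []))) i = \<dots>" by simp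
  qed simp
qed (fact node_state_fits loaded_state_fits)+

lemma triple_load: "triple M S W loaded_state [load] (sim_state 0)"
proof (rule triple_step)
  fix cf assume st: "loaded_state cf"
  have none: "snd (load i (fst cf i) (snd cf i)) = []" for i
    by (cases i rule: role_cases[of _ P]) (simp_all add: load_def)
  then show "sends_ok M S W load cf" by (simp add: sends_ok_def)
  show "sim_state 0 (apply_step M load cf)"
    unfolding sim_state_def apply_step_def none
  proof (intro allI impI)
    fix i assume i: "i < M"
    have "fst (load i (fst cf i) (snd cf i)) =
        roles P (\<lambda>_. []) (\<lambda>I i. if I < Q \<and> i < MA then enc (fst (cfgA I 0) i) else []) (\<lambda>_ _ _. []) i"
    proof (cases i rule: role_cases[of _ P])
      case (2 I k)
      show ?thesis
      proof (cases "I < Q \<and> k < MA")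
        case True
        let ?l = "concat (map (nrec I) [0..<P])"
        have "snd cf i = enc (concat (placed \<sigma> ?l k))" using st i True 2 by (simp add: loaded_state_def)
        moreover have "set (concat (placed \<sigma> ?l k)) \<subseteq> {..<X}"
          by (rule placed_words[of I]) (use True in \<open>auto simp: AL_eq\<close>)
        ultimately have "dec (snd cf i) = concat (placed \<sigma> ?l k)" by simp
        then show ?thesis using True 2 by (simp add: load_def cfgA_0 start_def AL_eq placed_append)
      qed (use 2 in \<open>auto simp: load_def\<close>)
    qed (simp_all add: load_def)
    moreover have "roles P (\<lambda>_. []) (\<lambda>I i. if I < Q \<and> i < MA then enc (snd (cfgA I 0) i) else []) (\<lambda>_ _ _. []) i = []"
      by (cases i rule: role_cases[of _ P]) (auto simp: cfgA_0)
    moreover have "deliver M (\<lambda>j. []) i = []" by (simp add: deliver_none)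
    ultimately show "fst (\<lambda>i. fst (load i (fst cf i) (snd cf i)), deliver M (\<lambda>j. [])) i =
        roles P (\<lambda>_. []) (\<lambda>I i. if I < Q \<and> i < MA then enc (fst (cfgA I 0) i) else []) (\<lambda>_ _ _. []) i \<and>
      snd (\<lambda>i. fst (load i (fst cf i) (snd cf i)), deliver M (\<lambda>j. [])) i =
        roles P (\<lambda>_. []) (\<lambda>I i. if I < Q \<and> i < MA then enc (snd (cfgA I 0) i) else []) (\<lambda>_ _ _. []) i"
      by simp
  qed
qed (use loaded_state_fits sim_state_fits in auto)

lemma msgs_sim_same:
  "set q \<subseteq> Z \<times> {..<X} \<Longrightarrow>
    msgs (sim_code P I k) (concat (map (\<lambda>(d, w). tagged (sim_code P I d) (enc1 w)) q)) = enc (msgs k q)"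
  by (induction q) (auto simp: msgs_append msgs_Cons enc_Cons)

lemma msgs_sim_other:
  "\<forall>k. i \<noteq> sim_code P I k \<Longrightarrow> msgs i (concat (map (\<lambda>(d, w). tagged (sim_code P I d) (enc1 w)) q)) = []"
  by (induction q) (auto simp: msgs_append)

text \<open>A simulated machine hears only from machines of its own run, in the order that
  \<open>A\<close> has; encoding multiplies all lengths by exactly \<open>c\<close>.\<close>

lemma triple_simulate:
  assumes t: "t < T"
  shows "triple M S W (sim_state t) [simulate t] (sim_state (Suc t))"
proof (rule triple_step)
  fix cf assume st: "sim_state t cf"
  let ?out = "\<lambda>I k. concat (map (\<lambda>(d, w). tagged (sim_code P I d) (enc1 w)) (snd (resA I t k)))"
  have res: "simulate t i (fst cf i) (snd cf i) = roles P (\<lambda>_. ([], []))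
      (\<lambda>I k. if I < Q \<and> k < MA then (enc (fst (resA I t k)), ?out I k) else ([], [])) (\<lambda>_ _ _. ([], [])) i"
    if i: "i < M" for i
  proof (cases i rule: role_cases[of _ P])
    case (2 I k)
    show ?thesis
    proof (cases "I < Q \<and> k < MA")
      case True
      then have "dec (fst cf i) = fst (cfgA I t) k" "dec (snd cf i) = snd (cfgA I t) k"
        using st i 2 words_X[of I t k] t by (simp_all add: sim_state_def)
      then show ?thesis using True 2 by (simp add: simulate_def Let_def)
    qed (use 2 in \<open>auto simp: simulate_def\<close>)
  qed (simp_all add: simulate_def)
  have qX: "set (snd (resA I t k)) \<subseteq> {..<MA} \<times> {..<X}" if "I < Q" "k < MA" for I k
    using send_limits(2)[OF that(1) t that(2)] X_ge(1) by fastforce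
  show "sends_ok M S W (simulate t) cf"
    unfolding sends_ok_def
  proof (intro allI impI)
    fix i assume i: "i < M"
    show "length (snd (simulate t i (fst cf i) (snd cf i))) \<le> S \<and>
        set (snd (simulate t i (fst cf i) (snd cf i))) \<subseteq> {..<M} \<times> {..<W}"
    proof (cases i rule: role_cases[of _ P])
      case (2 I k)
      show ?thesis
      proof (cases "I < Q \<and> k < MA")
        case True
        have "length (?out I k) = c * length (map (\<lambda>(d, w). tagged (sim_code P I d) (enc1 w)) (snd (resA I t k)))"
          by (rule length_concat_const) (use qX[of I k] True enc1_length in auto)
        also have "\<dots> \<le> c * local_space A n" using send_limits(1)[OF _ t, of I k] True by simp
        also have "\<dots> \<le> S" by (rule S_ge(2))
        finally have "length (?out I k) \<le> S" .
        moreover have "set (?out I k) \<subseteq> {..<M} \<times> {..<W}"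
        proof -
          have "sim_code P I d < M \<and> set (enc1 w) \<subseteq> {..<W}" if "(d, w) \<in> set (snd (resA I t k))" for d w
            using that qX[of I k] True enc1_set[of w] sim_less[of I d] by auto
          then show ?thesis by fastforce
        qed
        moreover have "snd (simulate t i (fst cf i) (snd cf i)) = ?out I k"
          unfolding res[OF i] using True 2 by simp
        ultimately show ?thesis by simp
      next
        case False
        then have "snd (simulate t i (fst cf i) (snd cf i)) = []" unfolding res[OF i] using 2 by auto
        then show ?thesis by simp
      qed
    next
      case 3
      then have "snd (simulate t i (fst cf i) (snd cf i)) = []" unfolding res[OF i] by simp
      then show ?thesis by simp
    qed (simp add: res[OF i])
  qed
  have out: "snd (simulate t j (fst cf j) (snd cf j)) =
      roles P (\<lambda>_. []) (\<lambda>I k. if I < Q \<and> k < MA then ?out I k else []) (\<lambda>_ _ _. []) j" if "j < M" for j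
    unfolding res[OF that] by (cases j rule: role_cases[of _ P]) simp_all
  have dl: "deliver M (\<lambda>j. snd (simulate t j (fst cf j) (snd cf j))) i =
     roles P (\<lambda>_. []) (\<lambda>I k. if I < Q \<and> k < MA then enc (snd (cfgA I (Suc t)) k) else []) (\<lambda>_ _ _. []) i" for i
  proof (cases i rule: role_cases[of _ P])
    case (2 I k)
    have other: "msgs i (snd (simulate t j (fst cf j) (snd cf j))) = []"
      if "j < M" "j \<notin> sim_code P I ` {..<(if I < Q then MA else 0)}" for j
    proof (cases j rule: role_cases[of _ P])
      case c: (2 I' k')
      show ?thesis
      proof (cases "I' < Q \<and> k' < MA")
        case True
        then have "I' \<noteq> I" using that(2) c by auto
        moreover have "snd (simulate t j (fst cf j) (snd cf j)) = ?out I' k'"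
          unfolding res[OF that(1)] using c True by simp
        ultimately show ?thesis using 2 by (simp add: msgs_sim_other)
      next
        case False
        then have "snd (simulate t j (fst cf j) (snd cf j)) = []" unfolding res[OF that(1)] using c by auto
        then show ?thesis by simp
      qed
    next
      case 3
      then have "snd (simulate t j (fst cf j) (snd cf j)) = []" unfolding res[OF that(1)] by simp
      then show ?thesis by simp
    qed (simp add: res[OF that(1)])
    show ?thesis
    proof (cases "I < Q")
      case True
      have "deliver M (\<lambda>j. snd (simulate t j (fst cf j) (snd cf j))) i =
         concat (map (\<lambda>k'. msgs i (snd (simulate t (sim_code P I k') (fst cf (sim_code P I k')) (snd cf (sim_code P I k'))))) [0..<MA])"
        by (rule deliver_embed) (use True sim_code_mono sim_less other in auto)
      also have "\<dots> = concat (map (\<lambda>k'. enc (msgs k (snd (resA I t k')))) [0..<MA])"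
      proof (intro arg_cong[of _ _ concat] map_cong refl)
        fix k' assume "k' \<in> set [0..<MA]"
        then have "k' < MA" by simp
        then show "msgs i (snd (simulate t (sim_code P I k') (fst cf (sim_code P I k')) (snd cf (sim_code P I k')))) =
            enc (msgs k (snd (resA I t k')))"
          using True sim_less[OF True] msgs_sim_same[OF qX[OF True]] 2 by (simp add: res)
      qed
      also have "\<dots> = enc (deliver MA (\<lambda>k'. snd (resA I t k')) k)"
        by (simp add: deliver_def enc_concat o_def)
      finally have eq: "deliver M (\<lambda>j. snd (simulate t j (fst cf j) (snd cf j))) i = enc (snd (cfgA I (Suc t)) k)"
        by (simp add: cfgA_Suc)
      \<comment> \<open>\<open>A\<close> sends nothing to numbers beyond its machines, in agreement
        with the empty inboxes of surplus simulated machines.\<close>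
      have "snd (cfgA I (Suc t)) k = []" if "\<not> k < MA"
      proof -
        have "msgs k (snd (resA I t k')) = []" if "k' < MA" for k'
          using qX[OF True that] \<open>\<not> k < MA\<close> by (auto simp: msgs_def filter_empty_conv)
        then show ?thesis by (simp add: cfgA_Suc deliver_none)
      qed
      then show ?thesis using eq True 2 by auto
    next
      case False
      then show ?thesis using other 2 by (simp add: deliver_none)
    qed
  next
    case 1
    show ?thesis
    proof (subst deliver_none)
      fix j assume j: "j < M"
      show "msgs i (snd (simulate t j (fst cf j) (snd cf j))) = []"
        unfolding out[OF j] by (cases j rule: role_cases[of _ P]) (use 1 in \<open>auto simp: msgs_sim_other\<close>)
    qed (use 1 in simp)
  next
    case (3 I x jj)
    show ?thesis
    proof (subst deliver_none)
      fix j assume j: "j < M"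
      show "msgs i (snd (simulate t j (fst cf j) (snd cf j))) = []"
        unfolding out[OF j] by (cases j rule: role_cases[of _ P]) (use 3 in \<open>auto simp: msgs_sim_other\<close>)
    qed (use 3 in simp)
  qed
  have ft: "fst (simulate t i (fst cf i) (snd cf i)) =
     roles P (\<lambda>_. []) (\<lambda>I i. if I < Q \<and> i < MA then enc (fst (cfgA I (Suc t)) i) else []) (\<lambda>_ _ _. []) i" if "i < M" for i
    by (cases i rule: role_cases[of _ P]) (use that in \<open>auto simp: res cfgA_Suc\<close>)
  show "sim_state (Suc t) (apply_step M (simulate t) cf)"
    using ft dl by (simp add: sim_state_def apply_step_def)
qed (use sim_state_fits t in auto)

text \<open>Distinct nodes have distinct rungs, and a memory lists at most as many edges as it has
  words. So a machine that reports to many nodes still respects its space.\<close>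

lemma card_reports: "card {x. x < P \<and> reports m x} \<le> length m"
proof -
  have "(\<lambda>x. {x, x + P}) ` {x. x < P \<and> reports m x} \<subseteq> (\<lambda>(u, v). {u, v}) ` word_pairs m"
    by (force simp: reports_def image_iff insert_commute)
  then have "card ((\<lambda>x. {x, x + P}) ` {x. x < P \<and> reports m x}) \<le> card ((\<lambda>(u, v). {u, v}) ` word_pairs m)"
    using length_word_pairs by (intro card_mono) auto
  also have "\<dots> \<le> card (word_pairs m)" using length_word_pairs by (intro card_image_le) auto
  also have "\<dots> \<le> length m" using length_word_pairs by blast
  finally show ?thesis
    by (subst (asm) card_image) (auto simp: inj_on_def doubleton_eq_iff)
qed

text \<open>Each simulated machine has a collector of its own for every node, so at level 0 an inbox
  holds at most one word.\<close>

lemma triple_report: "triple M S W (sim_state T) [report] (tree_state 0)"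
proof (rule triple_step)
  fix cf assume st: "sim_state T cf"
  let ?out = "\<lambda>I k. map (\<lambda>x. (tree_code P I x k, 0)) (filter (\<lambda>x. H I x = 0 \<and> reports (fst (cfgA I T) k) x) [0..<P])"
  have res: "report i (fst cf i) (snd cf i) = roles P (\<lambda>_. ([], []))
      (\<lambda>I k. ([], if I < Q \<and> k < MA then ?out I k else [])) (\<lambda>_ _ _. ([], [])) i"
    if i: "i < M" for i
  proof (cases i rule: role_cases[of _ P])
    case (2 I k)
    show ?thesis
    proof (cases "I < Q \<and> k < MA")
      case True
      then have "dec (fst cf i) = fst (cfgA I T) k"
        using st i 2 words_X[of I T k] by (simp add: sim_state_def)
      then show ?thesis using True 2 by (simp add: report_def)
    qed (use 2 in \<open>auto simp: report_def\<close>)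
  qed (simp_all add: report_def)
  show "sends_ok M S W report cf"
    unfolding sends_ok_def
  proof (intro allI impI)
    fix i assume i: "i < M"
    show "length (snd (report i (fst cf i) (snd cf i))) \<le> S \<and>
        set (snd (report i (fst cf i) (snd cf i))) \<subseteq> {..<M} \<times> {..<W}"
    proof (cases i rule: role_cases[of _ P])
      case (2 I k)
      show ?thesis
      proof (cases "I < Q \<and> k < MA")
        case True
        have "length (?out I k) = card (set (filter (\<lambda>x. H I x = 0 \<and> reports (fst (cfgA I T) k) x) [0..<P]))"
          using distinct_card[of "filter (\<lambda>x. H I x = 0 \<and> reports (fst (cfgA I T) k) x) [0..<P]"] by simp
        also have "\<dots> \<le> card {x. x < P \<and> reports (fst (cfgA I T) k) x}" by (rule card_mono) auto
        also have "\<dots> \<le> length (fst (cfgA I T) k)" by (rule card_reports)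
        also have "\<dots> \<le> local_space A n" using mem_limits(1)[of I T k] True by simp
        also have "\<dots> \<le> c * local_space A n" using c_pos by simp
        finally have "length (?out I k) \<le> S" using S_ge(2) by simp
        moreover have "set (?out I k) \<subseteq> {..<M} \<times> {..<W}" using tree_less True W_ge by auto
        moreover have "snd (report i (fst cf i) (snd cf i)) = ?out I k"
          unfolding res[OF i] using True 2 by simp
        ultimately show ?thesis by simp
      next
        case False
        then have "snd (report i (fst cf i) (snd cf i)) = []" unfolding res[OF i] using 2 by auto
        then show ?thesis by simp
      qed
    next
      case 3
      then have "snd (report i (fst cf i) (snd cf i)) = []" unfolding res[OF i] by simp
      then show ?thesis by simp
    qed (simp add: res[OF i])
  qed
  have msg: "msgs (tree_code P I x k) (?out I' k') = (if I' = I \<and> k' = k \<and> x < P \<and> H I x = 0 \<and> reports (fst (cfgA I T) k) x then [0] else [])"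
    for I x k I' k'
  proof (cases "I' = I \<and> k' = k")
    case True
    then show ?thesis
      unfolding msgs_map_Pair tree_code_eq by (simp only: simp_thms filter_eq_upt) simp
  qed (auto simp: msgs_map_Pair)
  have msg0: "msgs i (?out I' k') = []" if "\<And>I x k. i \<noteq> tree_code P I x k" for i I' k'
    using that by (auto simp: msgs_map_Pair filter_empty_conv)
  have dl: "length (deliver M (\<lambda>j. snd (report j (fst cf j) (snd cf j))) i) \<le> Bf \<and>
      (deliver M (\<lambda>j. snd (report j (fst cf j) (snd cf j))) i \<noteq> []) =
      roles P (\<lambda>_. False) (\<lambda>_ _. False) (\<lambda>I x j. \<exists>k. reported I x k \<and> k div Bf ^ 0 = j) i" for i
  proof (cases "\<exists>I x k. i = tree_code P I x k")
    case True
    then obtain I x k where i: "i = tree_code P I x k" by blast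
    show ?thesis
    proof (cases "I < Q \<and> k < MA")
      case True
      then have sl: "sim_code P I k < M" using sim_less by blast
      have "deliver M (\<lambda>j. snd (report j (fst cf j) (snd cf j))) i =
          msgs i (snd (report (sim_code P I k) (fst cf (sim_code P I k)) (snd cf (sim_code P I k))))"
      proof (rule deliver_single[OF sl])
        fix j assume j: "j < M" "j \<noteq> sim_code P I k"
        show "msgs i (snd (report j (fst cf j) (snd cf j))) = []"
          by (cases j rule: role_cases[of _ P]) (use j in \<open>auto simp: res i msg\<close>)
      qed
      also have "\<dots> = (if reported I x k then [0] else [])"
        using True by (simp add: res[OF sl] i msg reported_def)
      finally show ?thesis using Bf_pos i by simp
    next
      case False
      have "deliver M (\<lambda>j. snd (report j (fst cf j) (snd cf j))) i = []"
      proof (rule deliver_none)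
        fix j assume j: "j < M"
        show "msgs i (snd (report j (fst cf j) (snd cf j))) = []"
          by (cases j rule: role_cases[of _ P]) (use j False in \<open>auto simp: res i msg\<close>)
      qed
      then show ?thesis using False i by (auto simp: reported_def)
    qed
  next
    case False
    have "deliver M (\<lambda>j. snd (report j (fst cf j) (snd cf j))) i = []"
    proof (rule deliver_none)
      fix j assume j: "j < M"
      show "msgs i (snd (report j (fst cf j) (snd cf j))) = []"
        by (cases j rule: role_cases[of _ P]) (use j False msg0 in \<open>auto simp: res\<close>)
    qed
    then show ?thesis using False by (cases i rule: role_cases[of _ P]) auto
  qed
  have "fst (report i (fst cf i) (snd cf i)) = []" if "i < M" for i
    by (cases i rule: role_cases[of _ P]) (use that in \<open>auto simp: res\<close>)
  then show "tree_state 0 (apply_step M report cf)"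
    using dl by (simp add: tree_state_def apply_step_def)
qed (use sim_state_fits tree_state_fits in auto)

text \<open>Collector \<open>j\<close> hears only from the \<open>Bf\<close> collectors whose
  quotient by \<open>Bf\<close> is \<open>j\<close>; iterated quotients by \<open>Bf\<close> are
  quotients by its powers.\<close>

lemma triple_combine: "triple M S W (tree_state l) [combine] (tree_state (Suc l))"
proof (rule triple_step)
  fix cf assume st: "tree_state l cf"
  have box: "snd cf (tree_code P I x j) \<noteq> [] \<longleftrightarrow> (\<exists>k. reported I x k \<and> k div Bf ^ l = j)"
    if "tree_code P I x j < M" for I x j
    using st that by (simp add: tree_state_def)
  show "sends_ok M S W combine cf"
    unfolding sends_ok_def
  proof (intro allI impI)
    fix i assume i: "i < M"
    show "length (snd (combine i (fst cf i) (snd cf i))) \<le> S \<and>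
        set (snd (combine i (fst cf i) (snd cf i))) \<subseteq> {..<M} \<times> {..<W}"
    proof (cases i rule: role_cases[of _ P])
      case (3 I x j)
      show ?thesis
      proof (cases "snd cf i = []")
        case False
        then obtain k where k: "reported I x k" "k div Bf ^ l = j" using box i 3 by blast
        then have "j div Bf < MA" by (auto simp: reported_def intro: le_less_trans[OF div_le_dividend] )
        then have "tree_code P I x (j div Bf) < M" using k tree_less by (auto simp: reported_def)
        then show ?thesis using 3 False S_ge(5) W_ge by (simp add: combine_def)
      qed (use 3 in \<open>simp add: combine_def\<close>)
    qed (simp_all add: combine_def)
  qed
  let ?sent = "\<lambda>j. snd (combine j (fst cf j) (snd cf j))"
  have dl: "length (deliver M ?sent i) \<le> Bf \<and> (deliver M ?sent i \<noteq> []) =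
      roles P (\<lambda>_. False) (\<lambda>_ _. False) (\<lambda>I x j. \<exists>k. reported I x k \<and> k div Bf ^ Suc l = j) i" for i
  proof (cases "\<exists>I x k. i = tree_code P I x k")
    case True
    then obtain I x j where i: "i = tree_code P I x j" by blast
    let ?Z = "tree_code P I x ` {j * Bf..<j * Bf + Bf}"
    have m: "msgs i (?sent jj) = (if \<exists>j'. jj = tree_code P I x j' \<and> j' div Bf = j \<and> snd cf jj \<noteq> [] then [0] else [])"
      if "jj < M" for jj
      by (cases jj rule: role_cases[of _ P]) (auto simp: combine_def i msgs_Cons)
    have "length (deliver M ?sent i) = (\<Sum>jj<M. length (msgs i (?sent jj)))" by (rule length_deliver)
    also have "\<dots> \<le> (\<Sum>jj<M. if jj \<in> ?Z then 1 else 0)"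
    proof (rule sum_mono)
      fix jj assume jj: "jj \<in> {..<M}"
      have "jj \<in> ?Z" if "jj = tree_code P I x j'" "j' div Bf = j" for j'
      proof -
        have "j * Bf \<le> j'" "j' < j * Bf + Bf"
          using that(2) Bf_pos dividend_less_div_times[of Bf j'] by auto
        then show ?thesis using that(1) by auto
      qed
      then show "length (msgs i (?sent jj)) \<le> (if jj \<in> ?Z then 1 else 0)"
        using m[of jj] jj by auto
    qed
    also have "\<dots> = card ({..<M} \<inter> ?Z)" by (simp add: sum.If_cases Int_def)
    also have "\<dots> \<le> card ?Z" by (rule card_mono) auto
    also have "\<dots> \<le> Bf" using card_image_le[of "{j * Bf..<j * Bf + Bf}" "tree_code P I x"] by simp
    finally have "length (deliver M ?sent i) \<le> Bf" .
    moreover have "(deliver M ?sent i \<noteq> []) = (\<exists>k. reported I x k \<and> k div Bf ^ Suc l = j)"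
    proof
      assume "deliver M ?sent i \<noteq> []"
      then obtain jj where "jj < M" "msgs i (?sent jj) \<noteq> []" by (auto simp: deliver_eq_Nil_iff)
      then obtain j' where j': "jj = tree_code P I x j'" "j' div Bf = j" "snd cf jj \<noteq> []"
        using m by (metis (full_types))
      then obtain k where k: "reported I x k" "k div Bf ^ l = j'" using box \<open>jj < M\<close> by blast
      have "k div Bf ^ Suc l = j" using k(2) j'(2) by (simp add: div_mult2_eq mult.commute[of Bf])
      then show "\<exists>k. reported I x k \<and> k div Bf ^ Suc l = j" using k(1) by blast
    next
      assume "\<exists>k. reported I x k \<and> k div Bf ^ Suc l = j"
      then obtain k where k: "reported I x k" "k div Bf ^ Suc l = j" by blast
      let ?jj = "tree_code P I x (k div Bf ^ l)"
      have "k div Bf ^ l < MA" using k(1) by (auto simp: reported_def intro: le_less_trans[OF div_le_dividend])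
      then have jj: "?jj < M" using k(1) tree_less by (auto simp: reported_def)
      then have "snd cf ?jj \<noteq> []" using box k(1) by blast
      moreover have "(k div Bf ^ l) div Bf = j" using k(2) by (simp add: div_mult2_eq mult.commute[of Bf])
      ultimately have "msgs i (?sent ?jj) \<noteq> []" using m[OF jj] by auto
      then show "deliver M ?sent i \<noteq> []" using jj by (auto simp: deliver_eq_Nil_iff)
    qed
    ultimately show ?thesis using i by simp
  next
    case False
    have "deliver M ?sent i = []"
    proof (rule deliver_none)
      fix j assume j: "j < M"
      show "msgs i (?sent j) = []"
        by (cases j rule: role_cases[of _ P]) (use j False in \<open>auto simp: combine_def msgs_Cons\<close>)
    qed
    then show ?thesis using False by (cases i rule: role_cases[of _ P]) auto
  qed
  have "fst (combine i (fst cf i) (snd cf i)) = []" for i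
    by (cases i rule: role_cases[of _ P]) (auto simp: combine_def)
  then show "tree_state (Suc l) (apply_step M combine cf)"
    using dl by (simp add: tree_state_def apply_step_def)
qed (fact tree_state_fits)+

text \<open>This is \<open>middle_removed_iff\<close> as the machines see it. The restriction to
  layer 0 matters: rungs at layer \<open>D\<close> may be removed as well, and nothing is known
  about them.\<close>

lemma reported_iff_full:
  assumes x: "x < P"
  shows "(\<exists>k. reported I x k) \<longleftrightarrow> full I x"
proof (cases "I < Q \<and> H I x = 0")
  case True
  then have I: "I < Q" "H I x = 0" by auto
  interpret F: fold_instance P D n s "H I" zs by (rule fold_instance[OF I(1)])
  have "(\<exists>k. reported I x k) \<longleftrightarrow> (\<exists>m\<in>set (mpc_output A n \<omega> (start I)). reports m x)"
    using I x by (auto simp: reported_def mpc_output_def memory_after_def cfgA_def)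
  also have "\<dots> \<longleftrightarrow> {x, x + P} \<in> removed_edges (mpc_output A n \<omega> (start I))"
  proof
    assume "\<exists>m\<in>set (mpc_output A n \<omega> (start I)). reports m x"
    then show "{x, x + P} \<in> removed_edges (mpc_output A n \<omega> (start I))"
      unfolding reports_def removed_edges_def by blast
  next
    assume "{x, x + P} \<in> removed_edges (mpc_output A n \<omega> (start I))"
    then obtain u v m where "{x, x + P} = {u, v}" "m \<in> set (mpc_output A n \<omega> (start I))" "(u, v) \<in> word_pairs m"
      unfolding removed_edges_def by blast
    then show "\<exists>m\<in>set (mpc_output A n \<omega> (start I)). reports m x"
      unfolding reports_def by (metis doubleton_eq_iff)
  qed
  also have "\<dots> \<longleftrightarrow> (\<forall>i\<le>D. H I ((s ^^ i) x) = i)"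
    by (rule F.middle_removed_iff[OF stable n_le sens start_initial[OF I(1)] tape x I(2)])
  finally show ?thesis using I by (simp add: full_def)
next
  case False
  moreover have "full I x \<Longrightarrow> I < Q \<and> H I x = 0" by (auto simp: full_def dest: spec[of _ 0])
  ultimately show ?thesis by (auto simp: reported_def)
qed

text \<open>As \<open>MA \<le> Bf ^ lv\<close>, all reports have reached collector 0, which returns
  the number of its run. A node has one such collector per run and so hears at most \<open>Q\<close>
  numbers.\<close>

lemma triple_hand_back: "triple M S W (tree_state lv) [hand_back] answer_state"
proof (rule triple_step)
  fix cf assume st: "tree_state lv cf"
  have box: "snd cf (tree_code P I x 0) \<noteq> [] \<longleftrightarrow> (\<exists>k. reported I x k)"
    if "tree_code P I x 0 < M" for I x
  proof -
    have "k div Bf ^ lv = 0" if "reported I x k" for k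
      using that Bf_lv by (intro div_less) (auto simp: reported_def)
    then show ?thesis using st that by (auto simp: tree_state_def)
  qed
  have IQ: "I < Q" "x < P" if "reported I x k" for I x k using that by (auto simp: reported_def)
  show "sends_ok M S W hand_back cf"
    unfolding sends_ok_def
  proof (intro allI impI)
    fix i assume i: "i < M"
    show "length (snd (hand_back i (fst cf i) (snd cf i))) \<le> S \<and>
        set (snd (hand_back i (fst cf i) (snd cf i))) \<subseteq> {..<M} \<times> {..<W}"
    proof (cases i rule: role_cases[of _ P])
      case (3 I x j)
      show ?thesis
      proof (cases "snd cf i = [] \<or> j \<noteq> 0")
        case False
        then have "I < X" "x < M" using box i 3 IQ X_ge(2) P_less by (metis less_le_trans less_trans)+
        then show ?thesis using 3 False enc1_fits[of I] by (auto simp: hand_back_def)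
      qed (use 3 in \<open>auto simp: hand_back_def\<close>)
    qed (simp_all add: hand_back_def)
  qed
  let ?sent = "\<lambda>j. snd (hand_back j (fst cf j) (snd cf j))"
  have "(if i < P then \<exists>Is. deliver M ?sent i = enc Is \<and> set Is = {I. full I i} \<and> length Is \<le> Q
     else deliver M ?sent i = [])" for i
  proof (cases "i < P")
    case True
    define g where "g j = roles P (\<lambda>_. []) (\<lambda>_ _. []) (\<lambda>I x k. if x = i \<and> k = 0 \<and> snd cf j \<noteq> [] then [I] else []) j" for j
    have g: "msgs i (?sent j) = enc (g j)" for j
      by (cases j rule: role_cases[of _ P]) (auto simp: hand_back_def g_def enc_Cons)
    define Is where "Is = concat (map g [0..<M])"
    have eq: "deliver M ?sent i = enc Is" by (simp add: deliver_def g Is_def enc_concat o_def)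
    have "I \<in> set Is \<longleftrightarrow> full I i" for I
    proof
      assume "I \<in> set Is"
      then obtain j where j: "j < M" "I \<in> set (g j)" by (auto simp: Is_def)
      then have "j = tree_code P I i 0 \<and> snd cf j \<noteq> []"
        by (cases j rule: role_cases[of _ P]) (auto simp: g_def split: if_splits)
      then show "full I i" using box j(1) reported_iff_full[OF True] by blast
    next
      assume f: "full I i"
      then have "tree_code P I i 0 < M" using tree_less True MA_pos by (auto simp: full_def)
      moreover from this have "snd cf (tree_code P I i 0) \<noteq> []" using box f reported_iff_full[OF True] by blast
      then have "I \<in> set (g (tree_code P I i 0))" by (simp add: g_def)
      ultimately show "I \<in> set Is" by (auto simp: Is_def)
    qed
    then have set_Is: "set Is = {I. full I i}" by auto
    have "length Is = (\<Sum>j<M. length (g j))"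
      by (simp add: Is_def length_concat o_def sum_list_sum_nth lessThan_atLeast0)
    also have "\<dots> \<le> (\<Sum>j<M. if j \<in> (\<lambda>I. tree_code P I i 0) ` {..<Q} then 1 else 0)"
    proof (rule sum_mono)
      fix j assume j: "j \<in> {..<M}"
      show "length (g j) \<le> (if j \<in> (\<lambda>I. tree_code P I i 0) ` {..<Q} then 1 else 0)"
      proof (cases j rule: role_cases[of _ P])
        case (3 I x k)
        then show ?thesis using box[of I x] IQ(1) j by (auto simp: g_def)
      qed (simp_all add: g_def)
    qed
    also have "\<dots> = card ({..<M} \<inter> (\<lambda>I. tree_code P I i 0) ` {..<Q})" by (simp add: sum.If_cases Int_def)
    also have "\<dots> \<le> card ((\<lambda>I. tree_code P I i 0) ` {..<Q})" by (rule card_mono) auto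
    also have "\<dots> \<le> Q" using card_image_le[of "{..<Q}" "\<lambda>I. tree_code P I i 0"] by simp
    finally show ?thesis using eq set_Is True by auto
  next
    case False
    have "deliver M ?sent i = []"
    proof (rule deliver_none)
      fix j assume j: "j < M"
      show "msgs i (?sent j) = []"
      proof (cases j rule: role_cases[of _ P])
        case (3 I x k)
        then show ?thesis using box[of I x] IQ(2) j False by (auto simp: hand_back_def)
      qed (simp_all add: hand_back_def)
    qed
    then show ?thesis using False by simp
  qed
  moreover have "fst (hand_back i (fst cf i) (snd cf i)) = []" for i
    by (cases i rule: role_cases[of _ P]) (auto simp: hand_back_def)
  ultimately show "answer_state (apply_step M hand_back cf)"
    by (simp add: answer_state_def apply_step_def)
qed (fact tree_state_fits answer_state_fits)+

lemma triple_gather: "triple M S W (node_state s) gather answer_state"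
proof -
  have sim: "triple M S W (sim_state 0) (map simulate [0..<T]) (sim_state T)"
  proof -
    have "concat (map (\<lambda>t. [simulate t]) [0..<T]) = map simulate [0..<T]" by (induction T) auto
    moreover have "triple M S W (sim_state 0) (concat (map (\<lambda>t. [simulate t]) [0..<T])) (sim_state T)"
      by (rule triple_iterate) (use sim_state_fits triple_simulate in auto)
    ultimately show ?thesis by simp
  qed
  have tree: "triple M S W (tree_state 0) (replicate lv combine) (tree_state lv)"
  proof -
    have "concat (map (\<lambda>t. [combine]) [0..<lv]) = replicate lv combine"
      by (induction lv) (auto simp: replicate_append_same)
    moreover have "triple M S W (tree_state 0) (concat (map (\<lambda>t. [combine]) [0..<lv])) (tree_state lv)"
      by (rule triple_iterate) (use tree_state_fits triple_combine in auto)
    ultimately show ?thesis by simp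
  qed
  have "triple M S W (node_state s) ([dispatch] @ ([load] @ (map simulate [0..<T] @ ([report] @ (replicate lv combine @ [hand_back]))))) answer_state"
    by (intro triple_append[OF triple_dispatch] triple_append[OF triple_load] triple_append[OF sim]
        triple_append[OF triple_report] triple_append[OF tree] triple_hand_back)
  then show ?thesis by (simp add: gather_def)
qed

definition spread :: "nat \<Rightarrow> bool" where
  "spread x \<longleftrightarrow> distinct (map (\<lambda>i. (s ^^ i) x) [0..<D + 1])"

text \<open>The separating property of the layerings, applied to the walk from \<open>x\<close>; it
  needs distinct nodes, that is, a walk that does not close up.\<close>

lemma full_exists:
  assumes x: "x < P" "spread x" and t: "t < P" "t \<noteq> (s ^^ D) x"
  shows "\<exists>I. full I x \<and> H I t \<noteq> D"
proof -
  let ?xs = "map (\<lambda>i. (s ^^ i) x) [0..<D + 1]"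
  have "last ?xs = (s ^^ D) x" by simp
  then obtain I where I: "I < Q" "\<forall>i\<le>D. H I (?xs ! i) = i" "H I t \<noteq> D"
    using H_family[of ?xs t] x t funpow_less[OF x(1)] by (auto simp: spread_def simp del: upt_Suc)
  have "?xs ! i = (s ^^ i) x" if "i \<le> D" for i
    using that by (simp del: upt_Suc)
  then show ?thesis using I by (auto simp: full_def)
qed

lemma triple_update:
  assumes spread: "\<And>x. x < P \<Longrightarrow> spread x" and P2: "2 \<le> P"
  shows "triple M S W answer_state [update] (node_state (s ^^ D))"
proof (rule triple_step)
  fix cf assume st: "answer_state cf"
  have res: "update i (fst cf i) (snd cf i) = ([], if i < P then tagged i (enc1 ((s ^^ D) i)) else [])" if i: "i < M" for i
  proof (cases i rule: role_cases[of _ P])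
    case 1
    then have "\<exists>Is. snd cf i = enc Is \<and> set Is = {I. full I i} \<and> length Is \<le> Q"
      using st i by (simp add: answer_state_def)
    then obtain Is where Is: "snd cf i = enc Is" "set Is = {I. full I i}" by blast
    have sub: "set Is \<subseteq> {..<X}" using Is(2) X_ge(2) by (auto simp: full_def)
    then have dec: "set (dec (snd cf i)) = {I. full I i}" using Is by simp
    \<comment> \<open>Any second node will do: \<open>full_exists\<close> then yields a complete
      run, so the inbox of \<open>i\<close> is not empty.\<close>
    obtain t where "t < P" "t \<noteq> (s ^^ D) i"
    proof -
      have "\<exists>t. t < P \<and> t \<noteq> (s ^^ D) i" using P2 by (metis less_le_trans one_less_numeral_iff semiring_norm(76) zero_neq_one zero_less_numeral)
      then show ?thesis using that by blast
    qed
    then have "\<exists>I. full I i" using full_exists[OF 1 spread[OF 1]] by blast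
    then have "Is \<noteq> []" using Is(2) by auto
    then have ne: "snd cf i \<noteq> []" using Is(1) enc_eq_Nil_iff[OF sub] by simp
    \<comment> \<open>Complete runs put the true end into layer \<open>D\<close>, and every other
      node is refuted by one of them.\<close>
    have "(THE t. t < P \<and> (\<forall>I\<in>set (dec (snd cf i)). H I t = D)) = (s ^^ D) i"
    proof (rule the_equality)
      show "(s ^^ D) i < P \<and> (\<forall>I\<in>set (dec (snd cf i)). H I ((s ^^ D) i) = D)"
        using funpow_less[OF 1] dec by (auto simp: full_def)
    next
      fix t assume "t < P \<and> (\<forall>I\<in>set (dec (snd cf i)). H I t = D)"
      then show "t = (s ^^ D) i" using full_exists[OF 1 spread[OF 1], of t] dec by auto
    qed
    then show ?thesis using 1 ne by (simp add: update_def)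
  qed (simp_all add: update_def)
  have fX: "(s ^^ D) i < X" if "i < P" for i using funpow_less[OF that, of D] P_le_X by simp
  show "sends_ok M S W update cf"
    using res enc1_fits fX by (fastforce simp: sends_ok_def)
  have "deliver M (\<lambda>j. snd (update j (fst cf j) (snd cf j))) i =
      roles P (\<lambda>x. enc1 ((s ^^ D) x)) (\<lambda>_ _. []) (\<lambda>_ _ _. []) i" if i: "i < M" for i
  proof -
    have "deliver M (\<lambda>j. snd (update j (fst cf j) (snd cf j))) i = msgs i (snd (update i (fst cf i) (snd cf i)))"
      by (rule deliver_single[OF i]) (simp add: res)
    also have "\<dots> = roles P (\<lambda>x. enc1 ((s ^^ D) x)) (\<lambda>_ _. []) (\<lambda>_ _ _. []) i"
      by (cases i rule: role_cases[of _ P]) (use i in \<open>auto simp: res\<close>)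
    finally show ?thesis .
  qed
  then show "node_state (s ^^ D) (apply_step M update cf)"
    using res by (simp add: node_state_def apply_step_def)
next
  fix cf assume "node_state (s ^^ D) cf"
  moreover have "length (roles P (\<lambda>x. enc1 ((s ^^ D) x)) (\<lambda>_ _. []) (\<lambda>_ _ _. []) i :: nat list) \<le> S" for i
  proof (cases i rule: role_cases[of _ P])
    case 1
    then have "(s ^^ D) i < X" using funpow_less[OF 1, of D] P_le_X by simp
    then show ?thesis using enc1_fits 1 by simp
  qed simp_all
  ultimately show "fits M S W cf" by (simp add: node_state_def fits_def)
qed (fact answer_state_fits)

lemma triple_decide:
  assumes "b \<longleftrightarrow> (\<exists>I. full I 0)"
  shows "triple M S W answer_state [decide] (\<lambda>cf. fits M S W cf \<and> fst cf 0 = [if b then 1 else 0])"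
proof (rule triple_step)
  fix cf assume st: "answer_state cf"
  have none: "snd (decide i (fst cf i) (snd cf i)) = []" for i
    by (cases i rule: role_cases[of _ P]) (simp_all add: decide_def)
  then show "sends_ok M S W decide cf" by (simp add: sends_ok_def)
  have "\<exists>Is. snd cf 0 = enc Is \<and> set Is = {I. full I 0} \<and> length Is \<le> Q"
    using st P_pos P_less by (simp add: answer_state_def)
  then obtain Is where Is: "snd cf 0 = enc Is" "set Is = {I. full I 0}" by blast
  have sub: "set Is \<subseteq> {..<X}" using Is(2) X_ge(2) by (auto simp: full_def)
  have b: "b \<longleftrightarrow> snd cf 0 \<noteq> []"
    using assms Is enc_eq_Nil_iff[OF sub] by (metis (mono_tags) empty_iff mem_Collect_eq set_empty equals0I list.set(1))
  have "fst (apply_step M decide cf) 0 = [if b then 1 else 0]"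
    using b P_pos by (simp add: apply_step_def decide_def)
  moreover have "fits M S W (apply_step M decide cf)"
  proof -
    have "length (fst (decide i m b)) \<le> 1 \<and> set (fst (decide i m b)) \<subseteq> {..<W}" for i m b
      using W_ge by (cases i rule: role_cases[of _ P]) (auto simp: decide_def)
    then show ?thesis using S_ge(5)
      by (fastforce simp: fits_def apply_step_def none deliver_none intro: order_trans)
  qed
  ultimately show "fits M S W (apply_step M decide cf) \<and> fst (apply_step M decide cf) 0 = [if b then 1 else 0]" by blast
qed (use answer_state_fits in auto)

end

section \<open>From the input to a permutation\<close>

text \<open>The admissible initial memories, detached from \<open>mpc_algorithm\<close>: programs
  are analysed before the algorithm that runs them is defined.\<close>

definition starts :: "nat \<Rightarrow> nat \<Rightarrow> nat list set \<Rightarrow> (nat \<Rightarrow> nat list) set" where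
  "starts M S recs = {m0. \<exists>\<rho> :: nat \<Rightarrow> nat list list. distinct (concat (map \<rho> [0..<M])) \<and>
     set (concat (map \<rho> [0..<M])) = recs \<and> (\<forall>i. m0 i = concat (\<rho> i)) \<and> (\<forall>i<M. length (m0 i) \<le> S)}"

text \<open>There are enough machines to give every record its own.\<close>

lemma starts_nonempty:
  assumes "finite recs" "card recs \<le> M" "\<And>r. r \<in> recs \<Longrightarrow> length r \<le> S"
  shows "starts M S recs \<noteq> {}"
proof -
  obtain l where l: "set l = recs" "distinct l" using finite_distinct_list[OF assms(1)] by blast
  define \<rho> where "\<rho> i = (if i < length l then [l ! i] else [])" for i
  have len: "length l \<le> M" using l assms(2) distinct_card by metis
  have "map \<rho> [0..<M] = map \<rho> [0..<length l] @ map \<rho> [length l..<M]"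
    using len upt_add_eq_append[of 0 "length l" "M - length l"] by simp
  moreover have "concat (map \<rho> [0..<length l]) = l"
  proof -
    have "map \<rho> [0..<length l] = map (\<lambda>i. [l ! i]) [0..<length l]" by (simp add: \<rho>_def)
    then show ?thesis by (simp only: concat_map_singleton map_nth)
  qed
  moreover have "concat (map \<rho> [length l..<M]) = []" by (auto simp: \<rho>_def)
  ultimately have c: "concat (map \<rho> [0..<M]) = l" by simp
  have "length (concat (\<rho> i)) \<le> S" for i using assms(3) l(1) nth_mem by (fastforce simp: \<rho>_def)
  then have "(\<lambda>i. concat (\<rho> i)) \<in> starts M S recs"
    unfolding starts_def using c l by (intro CollectI exI[of _ \<rho>]) auto
  then show ?thesis by blast
qed

lemma distinct_concat_map:
  assumes "distinct R" "\<And>r. r \<in> set R \<Longrightarrow> distinct (g r)"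
    "\<And>r r'. r \<in> set R \<Longrightarrow> r' \<in> set R \<Longrightarrow> r \<noteq> r' \<Longrightarrow> set (g r) \<inter> set (g r') = {}"
  shows "distinct (concat (map g R))"
  using assms
proof (induction R)
  case (Cons r R)
  have "set (g r) \<inter> set (concat (map g R)) = {}"
  proof -
    have "set (g r) \<inter> set (g r') = {}" if "r' \<in> set R" for r'
      using Cons.prems(1) Cons.prems(3)[of r r'] that by auto
    then show ?thesis by auto
  qed
  then show ?case using Cons by simp
qed simp

fun pair_sends :: "nat list \<Rightarrow> (nat \<times> nat) list" where
  "pair_sends (u # v # ws) = (u, v) # (v, u) # pair_sends ws"
| "pair_sends _ = []"

lemma length_pair_sends: "length (pair_sends ws) \<le> length ws"
  by (induction ws rule: pair_sends.induct) auto

lemma set_pair_sends: "set ws \<subseteq> Z \<Longrightarrow> set (pair_sends ws) \<subseteq> Z \<times> Z"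
  by (induction ws rule: pair_sends.induct) auto

definition nb :: "nat set set \<Rightarrow> nat \<Rightarrow> nat set" where
  "nb E u = {v. {u, v} \<in> E}"

lemma card_two_Min_Max:
  assumes "card (Z :: nat set) = 2"
  shows "Z = {Min Z, Max Z}" "Min Z \<noteq> Max Z" "finite Z"
proof -
  obtain a b where "Z = {a, b}" "a \<noteq> b" using assms by (meson card_2_iff)
  then show "Z = {Min Z, Max Z}" "Min Z \<noteq> Max Z" "finite Z" by (auto simp: min_def max_def)
qed

lemma nb_cycle:
  assumes xs: "distinct xs" "length xs = l" "3 \<le> l" and E: "\<And>u v. u \<in> set xs \<Longrightarrow> {u, v} \<in> E \<longleftrightarrow> {u, v} \<in> cycle_edges xs"
  shows "nb E (xs ! (i mod l)) = {xs ! ((i + 1) mod l), xs ! ((i + (l - 1)) mod l)}"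
proof -
  have ne: "xs \<noteq> []" and l: "0 < l" using xs by auto
  let ?p = "i mod l"
  have p: "?p < l" using l by simp
  have nth_eq: "xs ! a = xs ! b \<longleftrightarrow> a = b" if "a < l" "b < l" for a b
    using that xs by (simp add: nth_eq_iff_index_eq)
  have "v \<in> nb E (xs ! ?p) \<longleftrightarrow> v = xs ! ((i + 1) mod l) \<or> v = xs ! ((i + (l - 1)) mod l)" for v
  proof -
    have "v \<in> nb E (xs ! ?p) \<longleftrightarrow> (\<exists>j<l. {xs ! ?p, v} = {xs ! j, xs ! (Suc j mod l)})"
      using E[of "xs ! ?p" v] p xs(2) by (auto simp: nb_def cycle_edges_nth[OF ne])
    also have "\<dots> \<longleftrightarrow> (\<exists>j<l. (?p = j \<and> v = xs ! (Suc j mod l)) \<or> (?p = Suc j mod l \<and> v = xs ! j))"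
      using nth_eq p l by (auto simp: doubleton_eq_iff)
    also have "\<dots> \<longleftrightarrow> v = xs ! (Suc ?p mod l) \<or> (\<exists>j<l. ?p = Suc j mod l \<and> v = xs ! j)" using p by blast
    also have "(\<exists>j<l. ?p = Suc j mod l \<and> v = xs ! j) \<longleftrightarrow> v = xs ! ((i + (l - 1)) mod l)"
    proof
      assume "\<exists>j<l. ?p = Suc j mod l \<and> v = xs ! j"
      then obtain j where j: "j < l" "?p = Suc j mod l" "v = xs ! j" by blast
      have "(i + (l - 1)) mod l = (?p + (l - 1)) mod l" by (simp add: mod_add_left_eq)
      also have "\<dots> = (Suc j + (l - 1)) mod l" unfolding j(2) by (simp add: mod_add_left_eq)
      also have "Suc j + (l - 1) = j + l" using l by simp
      finally show "v = xs ! ((i + (l - 1)) mod l)" using j by simp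
    next
      assume v: "v = xs ! ((i + (l - 1)) mod l)"
      have "Suc ((i + (l - 1)) mod l) mod l = (Suc (i + (l - 1))) mod l" by (rule mod_Suc_eq)
      also have "Suc (i + (l - 1)) = i + l" using l by simp
      finally have "?p = Suc ((i + (l - 1)) mod l) mod l" by simp
      then show "\<exists>j<l. ?p = Suc j mod l \<and> v = xs ! j" using v l by (intro exI[of _ "(i + (l - 1)) mod l"]) simp
    qed
    also have "Suc ?p mod l = (i + 1) mod l" by (simp add: mod_Suc_eq)
    finally show ?thesis .
  qed
  then show ?thesis by blast
qed

lemma mod_add_eq_self_iff: "(a + k) mod l = a mod l \<longleftrightarrow> l dvd (k :: nat)"
proof
  assume "(a + k) mod l = a mod l"
  then have "l dvd (a + k) - a" using mod_eq_dvd_iff_nat[of a "a + k" l] by simp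
  then show "l dvd k" by simp
qed (auto simp: dvd_def)

text \<open>The vertices are exactly the numbers below \<open>2 * N\<close>, so machine
  \<open>u\<close> can act for vertex \<open>u\<close>. Walking in both directions at once avoids
  the choice of an orientation and makes \<open>4 * N\<close> nodes. \<open>M_ge\<close> leaves a
  machine for each of at most \<open>(2 * N)\<^sup>2\<close> records.\<close>

locale regular_input = word_code "2 * N" X c enc1
  for N X c and enc1 :: "nat \<Rightarrow> nat list" +
  fixes M S :: nat and E :: "nat set set"
  assumes N_pos: "0 < N" and X_ge: "4 * N \<le> X" and M_ge: "4 * N\<^sup>2 + 4 * N \<le> M" and S_ge: "2 * c \<le> S" "2 \<le> S"
    and edge: "e \<in> E \<Longrightarrow> \<exists>u<2 * N. \<exists>v<2 * N. u \<noteq> v \<and> e = {u, v}"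
    and regular: "u < 2 * N \<Longrightarrow> card (nb E u) = 2"
begin

lemma nb_sym: "v \<in> nb E u \<longleftrightarrow> u \<in> nb E v"
  by (simp add: nb_def insert_commute)

lemma nb_less: "v \<in> nb E u \<Longrightarrow> u < 2 * N \<and> v < 2 * N \<and> u \<noteq> v"
  using edge[of "{u, v}"] by (auto simp: nb_def doubleton_eq_iff)

lemma nb_Min_Max:
  assumes "u < 2 * N"
  shows "nb E u = {Min (nb E u), Max (nb E u)}" "Min (nb E u) \<noteq> Max (nb E u)" "finite (nb E u)"
  using card_two_Min_Max[OF regular[OF assms]] by auto

definition collect :: step where
  "collect i m b = ([], pair_sends m)"

text \<open>A walk that arrives at \<open>w\<close> from its smaller neighbour goes on to the larger
  one, and conversely.\<close>

definition step_to :: "nat \<Rightarrow> nat \<Rightarrow> nat" where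
  "step_to u w = w + (if u = Min (nb E w) then 2 * N else 0)"

text \<open>
  The node \<open>u\<close> is the vertex \<open>u\<close> about to be left towards its smaller neighbour, and \<open>u + 2 N\<close>
  the vertex \<open>u\<close> about to be left towards its larger neighbour.
\<close>

definition succ_node :: "nat \<Rightarrow> nat" where
  "succ_node x = (if x < 2 * N then step_to x (Min (nb E x)) else step_to (x - 2 * N) (Max (nb E (x - 2 * N))))"

text \<open>The word for neighbour \<open>x\<close> is \<open>step_to x i\<close>, the node reached
  by moving from \<open>x\<close> to \<open>i\<close>; it depends on the other neighbour of
  \<open>i\<close>, which \<open>x\<close> does not know.\<close>

definition announce :: step where
  "announce i m b = ([], if i < 2 * N then
     concat (map (\<lambda>x. tagged x (enc1 (i + (if x = Min (set b) then 2 * N else 0)))) b) else [])"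

text \<open>Inboxes are ordered by sender, so the first decoded word comes from the smaller
  neighbour and the second one from the larger.\<close>

definition split_node :: step where
  "split_node i m b = ([], if i < 2 * N then
     tagged i (enc1 (dec b ! 0)) @ tagged (i + 2 * N) (enc1 (dec b ! 1)) else [])"

definition neighbour_state :: "cfg \<Rightarrow> bool" where
  "neighbour_state cf \<longleftrightarrow> (\<forall>i<M. fst cf i = [] \<and>
     (if i < 2 * N then distinct (snd cf i) \<and> set (snd cf i) = nb E i else snd cf i = []))"

definition heard_state :: "cfg \<Rightarrow> bool" where
  "heard_state cf \<longleftrightarrow> (\<forall>i<M. fst cf i = [] \<and>
     snd cf i = (if i < 2 * N then enc [step_to i (Min (nb E i)), step_to i (Max (nb E i))] else []))"

definition succ_state :: "cfg \<Rightarrow> bool" where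
  "succ_state cf \<longleftrightarrow> (\<forall>i<M. fst cf i = [] \<and> snd cf i = (if i < 4 * N then enc1 (succ_node i) else []))"

definition input_state :: "cfg \<Rightarrow> bool" where
  "input_state cf \<longleftrightarrow> fst cf \<in> starts M S (edge_records E) \<and> snd cf = (\<lambda>_. [])"

lemma M_gt: "4 * N \<le> M"
  using M_ge by simp

lemma step_to_less: "w < 2 * N \<Longrightarrow> step_to u w < 4 * N"
  by (simp add: step_to_def)

lemma Min_Max_less:
  assumes "u < 2 * N"
  shows "Min (nb E u) < 2 * N" "Max (nb E u) < 2 * N" "Min (nb E u) \<in> nb E u" "Max (nb E u) \<in> nb E u"
proof -
  have "{Min (nb E u), Max (nb E u)} \<subseteq> nb E u" using nb_Min_Max(1)[OF assms] by blast
  then show "Min (nb E u) \<in> nb E u" "Max (nb E u) \<in> nb E u" by auto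
  then show "Min (nb E u) < 2 * N" "Max (nb E u) < 2 * N" using nb_less by blast+
qed

lemma succ_node_less: "x < 4 * N \<Longrightarrow> succ_node x < 4 * N"
  using Min_Max_less[of x] Min_Max_less[of "x - 2 * N"] step_to_less by (auto simp: succ_node_def)

lemma edge_record_words:
  assumes "r \<in> edge_records E"
  shows "set r \<subseteq> {..<2 * N}" "length r = 2" "r = [r ! 0, r ! 1]" "r ! 0 < r ! 1" "r ! 1 \<in> nb E (r ! 0)"
  using assms nb_less by (auto simp: edge_records_def nb_def)

lemma starts_edge_records: "starts M S (edge_records E) \<noteq> {}"
proof (rule starts_nonempty)
  let ?Z = "{xs :: nat list. set xs \<subseteq> {..<2 * N} \<and> length xs = 2}"
  have sub: "edge_records E \<subseteq> ?Z" using edge_record_words by blast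
  have fin: "finite ?Z" by (rule finite_lists_length_eq) simp
  show "finite (edge_records E)" using finite_subset[OF sub fin] .
  have "card (edge_records E) \<le> card ?Z" by (rule card_mono[OF fin sub])
  also have "\<dots> = (2 * N)\<^sup>2" by (simp add: card_lists_length_eq)
  also have "\<dots> \<le> M" using M_ge by (simp add: power_mult_distrib)
  finally show "card (edge_records E) \<le> M" .
qed (use edge_record_words(2) S_ge(2) in auto)

lemma triple_collect: "triple M S (2 * N) input_state [collect] neighbour_state"
proof (rule triple_step)
  fix cf assume "input_state cf"
  then obtain \<rho> where \<rho>: "distinct (concat (map \<rho> [0..<M]))" "set (concat (map \<rho> [0..<M])) = edge_records E"
    "\<And>i. fst cf i = concat (\<rho> i)" "\<And>i. i < M \<Longrightarrow> length (fst cf i) \<le> S" "snd cf = (\<lambda>_. [])"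
    by (auto simp: input_state_def starts_def)
  let ?R = "concat (map \<rho> [0..<M])"
  have rec: "r \<in> edge_records E" if "i < M" "r \<in> set (\<rho> i)" for i r
  proof -
    have "r \<in> set ?R" using that by auto
    then show ?thesis unfolding \<rho>(2) .
  qed
  have sub: "set (fst cf i) \<subseteq> {..<2 * N}" if "i < M" for i
    using rec[OF that] edge_record_words(1) by (fastforce simp: \<rho>(3))
  show "fits M S (2 * N) cf" using \<rho>(4,5) sub by (simp add: fits_def)
  show "sends_ok M S (2 * N) collect cf"
    unfolding sends_ok_def
  proof (intro allI impI conjI)
    fix i assume i: "i < M"
    show "length (snd (collect i (fst cf i) (snd cf i))) \<le> S"
      using length_pair_sends \<rho>(4)[OF i] by (simp add: collect_def) (meson order_trans)
    have "{..<2 * N} \<times> {..<2 * N} \<subseteq> {..<M} \<times> {..<2 * N}" using M_gt by auto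
    from order_trans[OF set_pair_sends[OF sub[OF i]] this]
    show "set (snd (collect i (fst cf i) (snd cf i))) \<subseteq> {..<M} \<times> {..<2 * N}"
      by (simp add: collect_def)
  qed
  define g where "g u r = msgs u [(r ! 0, r ! 1), (r ! 1, r ! 0)]" for u and r :: "nat list"
  have ps: "msgs u (pair_sends (concat rs)) = concat (map (g u) rs)" if "set rs \<subseteq> edge_records E" for u rs
    using that
  proof (induction rs)
    case (Cons r rs)
    then have "r = [r ! 0, r ! 1]" using edge_record_words(3) by simp
    then have "pair_sends (r @ ws) = [(r ! 0, r ! 1), (r ! 1, r ! 0)] @ pair_sends ws" for ws
      by (metis append_Cons append_Nil pair_sends.simps(1))
    then show ?case using Cons by (simp add: msgs_append g_def del: append_Cons)
  qed simp
  have dl: "deliver M (\<lambda>j. snd (collect j (fst cf j) (snd cf j))) u = concat (map (g u) ?R)" for u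
  proof -
    have "deliver M (\<lambda>j. snd (collect j (fst cf j) (snd cf j))) u = concat (map (\<lambda>j. concat (map (g u) (\<rho> j))) [0..<M])"
      unfolding deliver_def collect_def
      by (intro arg_cong[of _ _ concat] map_cong refl) (use rec in \<open>simp add: \<rho>(3) ps subset_iff\<close>)
    also have "\<dots> = concat (map (g u) ?R)" by (simp add: map_concat o_def)
      (induction M, auto)
    finally show ?thesis .
  qed
  have g_set: "v \<in> set (g u r) \<longleftrightarrow> (r = [u, v] \<or> r = [v, u])" if r: "r \<in> edge_records E" for u v r
  proof -
    obtain a b where "r = [a, b]" "a < b" using edge_record_words(3,4)[OF r] by metis
    then show ?thesis by (auto simp: g_def msgs_Cons)
  qed
  \<comment> \<open>Records list the smaller end first, so each edge has a single record and no
    neighbour arrives twice.\<close>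
  have dst: "distinct (concat (map (g u) ?R))" for u
  proof (rule distinct_concat_map[OF \<rho>(1)])
    show "distinct (g u r)" if "r \<in> set ?R" for r
      using that edge_record_words(4)[of r] unfolding \<rho>(2) by (auto simp: g_def msgs_Cons)
    show "set (g u r) \<inter> set (g u r') = {}" if "r \<in> set ?R" "r' \<in> set ?R" "r \<noteq> r'" for r r'
    proof (rule equals0I)
      fix v assume "v \<in> set (g u r) \<inter> set (g u r')"
      then have "r = [u, v] \<or> r = [v, u]" "r' = [u, v] \<or> r' = [v, u]"
        using g_set that unfolding \<rho>(2) by auto
      moreover have "r ! 0 < r ! 1" "r' ! 0 < r' ! 1" using that edge_record_words(4) unfolding \<rho>(2) by auto
      ultimately show False using that(3) by auto
    qed
  qed
  have set_nb: "set (concat (map (g u) ?R)) = nb E u" for u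
  proof -
    have "set (concat (map (g u) ?R)) = {v. \<exists>r\<in>edge_records E. v \<in> set (g u r)}"
      unfolding \<rho>(2)[symmetric] by auto
    also have "\<dots> = {v. [u, v] \<in> edge_records E \<or> [v, u] \<in> edge_records E}"
      by (rule Collect_cong) (auto simp: g_set)
    also have "\<dots> = nb E u"
      using nb_less[of _ u] by (auto simp: edge_records_def nb_def insert_commute) (metis linorder_neqE_nat)
    finally show ?thesis .
  qed
  have "concat (map (g u) ?R) = []" if "\<not> u < 2 * N" for u
  proof -
    have "nb E u = {}" using nb_less that by blast
    then show ?thesis using set_nb[of u] by (simp only: set_empty)
  qed
  then show "neighbour_state (apply_step M collect cf)"
    unfolding neighbour_state_def apply_step_def fst_conv snd_conv dl
    using dst set_nb by (simp add: collect_def del: set_concat distinct_concat_iff)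
next
  fix cf assume "neighbour_state cf"
  then have "fst cf i = []" "length (snd cf i) \<le> 2" if "i < M" for i
    using that distinct_card[of "snd cf i"] regular[of i] by (auto simp: neighbour_state_def split: if_splits)
  then show "fits M S (2 * N) cf" using S_ge(2) by (fastforce simp: fits_def)
qed

lemma fits_enc:
  assumes "\<And>i. i < M \<Longrightarrow> fst cf i = []" "\<And>i. i < M \<Longrightarrow> length (snd cf i) \<le> 2 * c"
  shows "fits M S (2 * N) cf"
  using assms S_ge(1) by (fastforce simp: fits_def)

lemma triple_announce: "triple M S (2 * N) neighbour_state [announce] heard_state"
proof (rule triple_step)
  fix cf assume st: "neighbour_state cf"
  have nbs: "distinct (snd cf i)" "set (snd cf i) = nb E i" "length (snd cf i) = 2" if "i < 2 * N" for i
  proof -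
    have "i < M" using that M_gt by simp
    then show d: "distinct (snd cf i)" "set (snd cf i) = nb E i" using st that by (auto simp: neighbour_state_def)
    then show "length (snd cf i) = 2" using distinct_card[of "snd cf i"] regular[OF that] by simp
  qed
  show "fits M S (2 * N) cf"
  proof -
    have "length (snd cf i) \<le> 2" if "i < M" for i
      using st nbs(3)[of i] that by (cases "i < 2 * N") (auto simp: neighbour_state_def)
    then show ?thesis using st S_ge(2) by (fastforce simp: fits_def neighbour_state_def)
  qed
  let ?w = "\<lambda>i x. i + (if x = Min (nb E i) then 2 * N else 0)"
  have sent: "snd (announce i (fst cf i) (snd cf i)) =
     (if i < 2 * N then concat (map (\<lambda>x. tagged x (enc1 (?w i x))) (snd cf i)) else [])" for i
    using nbs(2)[of i] by (simp add: announce_def)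
  have wX: "?w i x < X" if "i < 2 * N" for i x using that X_ge by simp
  show "sends_ok M S (2 * N) announce cf"
    unfolding sends_ok_def sent
  proof (intro allI impI)
    fix i assume "i < M"
    let ?l = "if i < 2 * N then concat (map (\<lambda>x. tagged x (enc1 (?w i x))) (snd cf i)) else []"
    show "length ?l \<le> S \<and> set ?l \<subseteq> {..<M} \<times> {..<2 * N}"
    proof (cases "i < 2 * N")
      case True
      have "length (concat (map (\<lambda>x. tagged x (enc1 (?w i x))) (snd cf i))) =
          c * length (map (\<lambda>x. tagged x (enc1 (?w i x))) (snd cf i))"
        by (rule length_concat_const) (use enc1_length[OF wX[OF True]] in auto)
      then have "length ?l \<le> S" using True nbs(3)[OF True] S_ge(1) by (simp add: mult.commute)
      moreover have "set ?l \<subseteq> {..<M} \<times> {..<2 * N}"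
      proof -
        have "x < M \<and> set (enc1 (?w i x)) \<subseteq> {..<2 * N}" if "x \<in> set (snd cf i)" for x
          using that nbs(2)[OF True] nb_less[of x i] M_gt enc1_set[OF wX[OF True], of x] by auto
        then show ?thesis using True by fastforce
      qed
      ultimately show ?thesis by blast
    qed simp
  qed
  have dl: "deliver M (\<lambda>j. snd (announce j (fst cf j) (snd cf j))) i =
     (if i < 2 * N then enc [step_to i (Min (nb E i)), step_to i (Max (nb E i))] else [])" for i
  proof -
    have one: "concat (map (\<lambda>x. msgs i (tagged x (g x))) l) = (if i \<in> set l then g i else [])" if "distinct l" for l and g :: "nat \<Rightarrow> nat list"
      using that by (induction l) auto
    have m: "msgs i (snd (announce j (fst cf j) (snd cf j))) = (if j \<in> nb E i then enc1 (step_to i j) else [])" for j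
    proof (cases "j < 2 * N")
      case True
      then show ?thesis using one[OF nbs(1)[OF True], of "\<lambda>x. enc1 (?w j x)"] nbs(2)[OF True] nb_sym[of j i]
        unfolding sent by (simp add: msgs_concat o_def step_to_def)
    next
      case False
      then show ?thesis using nb_less[of j i] by (auto simp: sent)
    qed
    show ?thesis
    proof (cases "i < 2 * N")
      case True
      have "deliver M (\<lambda>j. snd (announce j (fst cf j) (snd cf j))) i =
          concat (map (\<lambda>j. enc1 (step_to i j)) (filter (\<lambda>j. j \<in> nb E i) [0..<M]))"
        unfolding deliver_def m by (subst concat_map_filter_nonempty[of _ "\<lambda>j. j \<in> nb E i"])
          (auto intro!: arg_cong[of _ _ concat])
      also have "filter (\<lambda>j. j \<in> nb E i) [0..<M] = [Min (nb E i), Max (nb E i)]"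
      proof (rule sorted_distinct_set_unique)
        have "Min (nb E i) \<le> Max (nb E i)" using Min_Max_less[OF True] nb_Min_Max(3)[OF True] by simp
        then show "sorted [Min (nb E i), Max (nb E i)]" by simp
        show "distinct [Min (nb E i), Max (nb E i)]" using nb_Min_Max(2)[OF True] by simp
        have "nb E i \<subseteq> {..<M}" using nb_less M_gt by fastforce
        then show "set (filter (\<lambda>j. j \<in> nb E i) [0..<M]) = set [Min (nb E i), Max (nb E i)]"
          using nb_Min_Max(1)[OF True] by auto
      qed (auto simp: sorted_wrt_filter)
      finally show ?thesis using True by (simp add: enc_def)
    next
      case False
      then have "j \<notin> nb E i" for j using nb_less[of j i] by blast
      then show ?thesis using False m by (simp add: deliver_none)
    qed
  qed
  show "heard_state (apply_step M announce cf)"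
    unfolding heard_state_def apply_step_def fst_conv snd_conv dl by (simp add: announce_def)
next
  fix cf assume st: "heard_state cf"
  show "fits M S (2 * N) cf"
  proof (rule fits_enc)
    show "length (snd cf i) \<le> 2 * c" if "i < M" for i
    proof (cases "i < 2 * N")
      case True
      have "set [step_to i (Min (nb E i)), step_to i (Max (nb E i))] \<subseteq> {..<X}"
        using step_to_less[OF Min_Max_less(1)[OF True], of i] step_to_less[OF Min_Max_less(2)[OF True], of i] X_ge by auto
      then show ?thesis using st that True length_enc by (simp add: heard_state_def)
    qed (use st that in \<open>simp add: heard_state_def\<close>)
  qed (use st in \<open>simp add: heard_state_def\<close>)
qed

lemma triple_split: "triple M S (2 * N) heard_state [split_node] succ_state"
proof (rule triple_step)
  fix cf assume st: "heard_state cf"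
  have ws: "set [step_to i (Min (nb E i)), step_to i (Max (nb E i))] \<subseteq> {..<X}" if "i < 2 * N" for i
    using step_to_less[OF Min_Max_less(1)[OF that], of i] step_to_less[OF Min_Max_less(2)[OF that], of i] X_ge by auto
  show "fits M S (2 * N) cf"
  proof (rule fits_enc)
    show "length (snd cf i) \<le> 2 * c" if "i < M" for i
      using st that length_enc[OF ws[of i]] by (cases "i < 2 * N") (simp_all add: heard_state_def)
  qed (use st in \<open>simp add: heard_state_def\<close>)
  have sent: "snd (split_node i (fst cf i) (snd cf i)) =
     (if i < 2 * N then tagged i (enc1 (succ_node i)) @ tagged (i + 2 * N) (enc1 (succ_node (i + 2 * N))) else [])" if "i < M" for i
    using st that dec_enc[OF ws[of i]] by (simp add: split_node_def heard_state_def succ_node_def)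
  show "sends_ok M S (2 * N) split_node cf"
    unfolding sends_ok_def
  proof (intro allI impI)
    fix i assume i: "i < M"
    show "length (snd (split_node i (fst cf i) (snd cf i))) \<le> S \<and>
        set (snd (split_node i (fst cf i) (snd cf i))) \<subseteq> {..<M} \<times> {..<2 * N}"
    proof (cases "i < 2 * N")
      case True
      have "succ_node i < X" "succ_node (i + 2 * N) < X"
        using succ_node_less[of i] succ_node_less[of "i + 2 * N"] True X_ge by simp_all
      then show ?thesis
        using enc1_length enc1_set[of "succ_node i"] enc1_set[of "succ_node (i + 2 * N)"] True S_ge(1) M_gt
        unfolding sent[OF i] by auto
    qed (simp add: sent[OF i])
  qed
  have "deliver M (\<lambda>j. snd (split_node j (fst cf j) (snd cf j))) i = (if i < 4 * N then enc1 (succ_node i) else [])" for i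
  proof -
    have m: "msgs i (snd (split_node j (fst cf j) (snd cf j))) =
        (if j < 2 * N \<and> (j = i \<or> j + 2 * N = i) then enc1 (succ_node i) else [])" if "j < M" for j
      using N_pos by (auto simp: sent[OF that] msgs_append)
    show ?thesis
    proof (cases "i < 4 * N")
      case True
      define j0 where "j0 = (if i < 2 * N then i else i - 2 * N)"
      have j0: "j0 < M" "j0 < 2 * N" "j0 = i \<or> j0 + 2 * N = i" using True M_gt by (auto simp: j0_def)
      have "deliver M (\<lambda>j. snd (split_node j (fst cf j) (snd cf j))) i = msgs i (snd (split_node j0 (fst cf j0) (snd cf j0)))"
        by (rule deliver_single[OF j0(1)]) (use m in \<open>auto simp: j0_def\<close>)
      then show ?thesis using True j0 m[OF j0(1)] by auto
    next
      case False
      then show ?thesis using m by (subst deliver_none) auto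
    qed
  qed
  then show "succ_state (apply_step M split_node cf)"
    by (simp add: succ_state_def apply_step_def split_node_def)
next
  fix cf assume st: "succ_state cf"
  show "fits M S (2 * N) cf"
  proof (rule fits_enc)
    show "length (snd cf i) \<le> 2 * c" if "i < M" for i
      using st that enc1_length[of "succ_node i"] succ_node_less[of i] X_ge
      by (cases "i < 4 * N") (simp_all add: succ_state_def)
  qed (use st in \<open>simp add: succ_state_def\<close>)
qed

lemma triple_prepare: "triple M S (2 * N) input_state [collect, announce, split_node] succ_state"
  using triple_append[OF triple_append[OF triple_collect triple_announce] triple_split] by simp

section \<open>Orbits\<close>

text \<open>The number of the directed edge from \<open>u\<close> to its neighbour
  \<open>w\<close>.\<close>

definition node :: "nat \<Rightarrow> nat \<Rightarrow> nat" where
  "node u w = u + (if w = Min (nb E u) then 0 else 2 * N)"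

lemma succ_node_node:
  assumes "nb E w = {u, u'}" "u \<noteq> u'"
  shows "succ_node (node u w) = node w u'"
proof -
  have w: "w \<in> nb E u" using assms nb_sym by blast
  then have u: "u < 2 * N" "w < 2 * N" using nb_less by blast+
  have "succ_node (node u w) = step_to u w"
    using w u nb_Min_Max(1)[OF u(1)] by (auto simp: succ_node_def node_def)
  moreover have "u = Min (nb E w) \<longleftrightarrow> u' \<noteq> Min (nb E w)"
    using nb_Min_Max(1,2)[OF u(2)] assms by (metis doubleton_eq_iff)
  ultimately show ?thesis by (auto simp: step_to_def node_def)
qed

lemma walk_funpow:
  assumes "\<And>i. nb E (v (Suc i)) = {v i, v (Suc (Suc i))}" "\<And>i. v i \<noteq> v (Suc (Suc i))"
  shows "(succ_node ^^ k) (node (v 0) (v 1)) = node (v k) (v (Suc k))"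
proof (induction k)
  case (Suc k)
  then show ?case using succ_node_node[OF assms] by simp
qed simp

lemma node_inject: "u < 2 * N \<Longrightarrow> u' < 2 * N \<Longrightarrow> node u w = node u' w' \<Longrightarrow> u = u'"
  by (auto simp: node_def split: if_splits)

lemma node_exists: "x < 4 * N \<Longrightarrow> \<exists>u w. u < 2 * N \<and> w \<in> nb E u \<and> x = node u w"
proof (cases "x < 2 * N")
  case True
  then show ?thesis using Min_Max_less[OF True] by (intro exI[of _ x] exI[of _ "Min (nb E x)"]) (simp add: node_def)
next
  case False
  assume "x < 4 * N"
  then have u: "x - 2 * N < 2 * N" using False by simp
  show ?thesis using Min_Max_less[OF u] nb_Min_Max(2)[OF u] False u
    by (intro exI[of _ "x - 2 * N"] exI[of _ "Max (nb E (x - 2 * N))"]) (auto simp: node_def)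
qed

text \<open>The walk is \<open>xs ! ((p + i * d) mod l)\<close> with \<open>d = 1\<close> in one
  direction and \<open>d = l - 1\<close> in the other. As \<open>d\<close> is a unit modulo
  \<open>l\<close>, the starting vertex recurs only after multiples of \<open>l\<close>
  steps.\<close>

lemma orbit_on_cycle:
  assumes xs: "distinct xs" "length xs = l" "3 \<le> l" and E: "\<And>u v. u \<in> set xs \<Longrightarrow> {u, v} \<in> E \<longleftrightarrow> {u, v} \<in> cycle_edges xs"
    and sub: "set xs \<subseteq> {..<2 * N}" and x: "u \<in> set xs" "w \<in> nb E u"
  shows "(succ_node ^^ l) (node u w) = node u w" "0 < k \<Longrightarrow> k < l \<Longrightarrow> (succ_node ^^ k) (node u w) \<noteq> node u w"
proof -
  note nbc = nb_cycle[OF xs E]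
  obtain p where p: "p < l" "u = xs ! p" using x(1) xs(2) by (metis in_set_conv_nth)
  have nth_eq: "xs ! (a mod l) = xs ! (b mod l) \<longleftrightarrow> a mod l = b mod l" for a b
    using xs by (simp add: nth_eq_iff_index_eq)
  have "w = xs ! ((p + 1) mod l) \<or> w = xs ! ((p + (l - 1)) mod l)" using nbc[of p] x(2) p by simp
  then obtain d where d: "d = 1 \<or> d = l - 1" "w = xs ! ((p + d) mod l)" by blast
  define v where "v i = xs ! ((p + i * d) mod l)" for i
  have v0: "v 0 = u" "v 1 = w" using p d by (simp_all add: v_def)
  \<comment> \<open>For \<open>d = l - 1\<close> this follows from
    \<open>m * d + m = m * l\<close>.\<close>
  have d_dvd: "l dvd m * d \<longleftrightarrow> l dvd m" for m
  proof (cases "d = 1")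
    case False
    then have "m * d + m = m * l" using d(1) xs(3) by (metis Suc_diff_1 Suc_eq_plus1 add.commute less_le_trans mult_Suc_right zero_less_numeral)
    then have "l dvd m * d + m" by simp
    then show ?thesis by (metis dvd_add_right_iff dvd_add_left_iff)
  qed simp
  have step: "nb E (v (Suc i)) = {v i, v (Suc (Suc i))}" for i
  proof -
    let ?a = "p + Suc i * d"
    have *: "nb E (v (Suc i)) = {xs ! ((?a + 1) mod l), xs ! ((?a + (l - 1)) mod l)}"
      unfolding v_def by (rule nbc)
    show ?thesis
    proof (cases "d = 1")
      case True
      have "?a + (l - 1) = p + i * d + l" "?a + 1 = p + Suc (Suc i) * d" using True xs(3) by simp_all
      then have "nb E (v (Suc i)) = {xs ! ((p + Suc (Suc i) * d) mod l), xs ! ((p + i * d + l) mod l)}"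
        using * by (simp only:)
      then show ?thesis unfolding v_def mod_add_self2 by blast
    next
      case False
      then have "?a + 1 = p + i * d + l" "?a + (l - 1) = p + Suc (Suc i) * d" using d(1) xs(3) by simp_all
      then have "nb E (v (Suc i)) = {xs ! ((p + i * d + l) mod l), xs ! ((p + Suc (Suc i) * d) mod l)}"
        using * by (simp only:)
      then show ?thesis unfolding v_def mod_add_self2 by blast
    qed
  qed
  \<comment> \<open>\<open>3 \<le> l\<close> excludes that \<open>l\<close> divides 2, so the walk
    does not turn back.\<close>
  have neq: "v i \<noteq> v (Suc (Suc i))" for i
  proof
    assume "v i = v (Suc (Suc i))"
    moreover have "p + Suc (Suc i) * d = p + i * d + 2 * d" by simp
    ultimately have "(p + i * d) mod l = (p + i * d + 2 * d) mod l" using nth_eq by (simp only: v_def)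
    then have "l dvd 2 * d" using mod_add_eq_self_iff[of "p + i * d" "2 * d" l] by simp
    then have "l dvd 2" using d_dvd by blast
    then show False using xs(3) by (auto dest: dvd_imp_le)
  qed
  have walk: "(succ_node ^^ k) (node u w) = node (v k) (v (Suc k))" for k
    using walk_funpow[of v k, OF step neq] v0 by simp
  have vl: "v (i + l) = v i" for i
  proof -
    have "p + (i + l) * d = p + i * d + l * d" by (simp add: algebra_simps)
    then show ?thesis by (simp only: v_def mod_mult_self2)
  qed
  show "(succ_node ^^ l) (node u w) = node u w" using walk[of l] vl[of 0] vl[of 1] v0 by simp
  show "(succ_node ^^ k) (node u w) \<noteq> node u w" if k: "0 < k" "k < l"
  proof
    assume "(succ_node ^^ k) (node u w) = node u w"
    then have "node (v k) (v (Suc k)) = node u w" using walk by simp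
    moreover have "v k < 2 * N" "u < 2 * N" using sub x(1) xs by (auto simp: v_def subset_iff)
    ultimately have "v k = v 0" using node_inject v0 by blast
    then have "(p + k * d) mod l = p mod l" using nth_eq[of "p + k * d" p] by (simp add: v_def)
    then have "l dvd k" using mod_add_eq_self_iff d_dvd by blast
    then show False using k by (auto dest: dvd_imp_le)
  qed
qed

end

section \<open>Periods of the successor permutation\<close>

definition has_period :: "nat \<Rightarrow> nat \<Rightarrow> (nat \<Rightarrow> nat) \<Rightarrow> bool" where
  "has_period P l s \<longleftrightarrow> (\<forall>x<P. s x < P \<and> (s ^^ l) x = x \<and> (\<forall>k. 0 < k \<longrightarrow> k < l \<longrightarrow> (s ^^ k) x \<noteq> x))"

lemma has_period_funpow_less: "has_period P l s \<Longrightarrow> x < P \<Longrightarrow> (s ^^ k) x < P"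
  by (induction k) (auto simp: has_period_def)

lemma has_period_bij:
  assumes "has_period P l s" "0 < l"
  shows "bij_betw (s ^^ k) {..<P} {..<P}"
proof -
  have "bij_betw s {..<P} {..<P}"
  proof (rule bij_betw_byWitness[where f' = "s ^^ (l - 1)"])
    have e: "l = Suc (l - 1)" using assms(2) by simp
    show "\<forall>a\<in>{..<P}. (s ^^ (l - 1)) (s a) = a"
      using assms(1) e by (metis funpow_Suc_right comp_apply has_period_def lessThan_iff)
    show "\<forall>a\<in>{..<P}. s ((s ^^ (l - 1)) a) = a"
      using assms(1) e by (metis funpow.simps(2) comp_apply has_period_def lessThan_iff)
  qed (use assms(1) has_period_funpow_less in \<open>auto simp: has_period_def\<close>)
  then show ?thesis
  proof (induction k)
    case (Suc k)
    then show ?case using bij_betw_trans[of "s ^^ k" "{..<P}" "{..<P}" s "{..<P}"] by (simp add: comp_def)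
  qed (simp add: bij_betw_def)
qed

text \<open>\<open>m * D < l\<close> keeps all \<open>D + 1\<close> points of the walk within one
  period of \<open>s\<close>.\<close>

lemma has_period_distinct:
  assumes "has_period P l s" "x < P" "m * D < l" "0 < m"
  shows "distinct (map (\<lambda>i. ((s ^^ m) ^^ i) x) [0..<D + 1])"
proof -
  have pw: "((s ^^ m) ^^ i) x = (s ^^ (m * i)) x" for i by (simp add: funpow_mult)
  have neq: "(s ^^ (m * i)) x \<noteq> (s ^^ (m * j)) x" if "i < j" "j \<le> D" for i j
  proof -
    have "m * j = m * (j - i) + m * i" using that by (simp add: diff_mult_distrib2)
    then have "(s ^^ (m * j)) x = (s ^^ (m * (j - i))) ((s ^^ (m * i)) x)" by (simp add: funpow_add)
    moreover have "m * (j - i) \<le> m * D" using that by (intro mult_le_mono2) simp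
    then have "m * (j - i) < l" using assms(3) by linarith
    then have "(s ^^ (m * (j - i))) y \<noteq> y" if "y < P" for y
      using assms(1,4) \<open>i < j\<close> that unfolding has_period_def by simp
    then have "(s ^^ (m * (j - i))) ((s ^^ (m * i)) x) \<noteq> (s ^^ (m * i)) x"
      using has_period_funpow_less[OF assms(1,2)] by blast
    ultimately show ?thesis by metis
  qed
  have "inj_on (\<lambda>i. ((s ^^ m) ^^ i) x) {0..<D + 1}"
  proof (rule inj_onI)
    fix i j assume ij: "i \<in> {0..<D + 1}" "j \<in> {0..<D + 1}" "((s ^^ m) ^^ i) x = ((s ^^ m) ^^ j) x"
    then show "i = j" using neq[of i j] neq[of j i] pw by (cases i j rule: linorder_cases) auto
  qed
  then show ?thesis by (simp add: distinct_map del: upt_Suc)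
qed

text \<open>The input cycles when words are restricted to the numbers below \<open>2 * N\<close>; by
  \<open>set_eq_lessThan\<close> their names then exhaust these numbers.\<close>

definition one_cycle :: "nat \<Rightarrow> nat set set \<Rightarrow> bool" where
  "one_cycle N E \<longleftrightarrow> (\<exists>xs. distinct xs \<and> length xs = 2 * N \<and> set xs \<subseteq> {..<2 * N} \<and> E = cycle_edges xs)"

definition two_cycles :: "nat \<Rightarrow> nat set set \<Rightarrow> bool" where
  "two_cycles N E \<longleftrightarrow> (\<exists>xs ys. distinct (xs @ ys) \<and> length xs = N \<and> length ys = N \<and>
     set (xs @ ys) \<subseteq> {..<2 * N} \<and> E = cycle_edges xs \<union> cycle_edges ys)"

lemma cycle_edges_meet:
  assumes "u \<in> set xs" "set xs \<inter> set ys = {}" "ys \<noteq> []"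
  shows "{u, v} \<notin> cycle_edges ys"
  using comp_edges_subset[of "{u, v}" True ys] assms by (auto simp: comp_edges_def)

lemma set_eq_lessThan: "distinct xs \<Longrightarrow> length xs = m \<Longrightarrow> set xs \<subseteq> {..<m} \<Longrightarrow> set xs = {..<m}"
  by (rule card_subset_eq) (auto simp: distinct_card)

text \<open>Common form of both kinds of inputs: they differ only in \<open>l\<close>, which is
  \<open>2 * N\<close> or \<open>N\<close> and becomes the period.\<close>

definition cycle_cover :: "nat \<Rightarrow> nat \<Rightarrow> nat set set \<Rightarrow> bool" where
  "cycle_cover N l E \<longleftrightarrow> 3 \<le> l \<and> (\<forall>e\<in>E. \<exists>u<2 * N. \<exists>v<2 * N. u \<noteq> v \<and> e = {u, v}) \<and>
     (\<forall>u<2 * N. \<exists>xs. u \<in> set xs \<and> distinct xs \<and> length xs = l \<and> set xs \<subseteq> {..<2 * N} \<and>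
        (\<forall>u v. u \<in> set xs \<longrightarrow> ({u, v} \<in> E \<longleftrightarrow> {u, v} \<in> cycle_edges xs)))"

lemma one_cycle_cover:
  assumes "one_cycle N E" "3 \<le> N"
  shows "cycle_cover N (2 * N) E"
proof -
  obtain xs where xs: "distinct xs" "length xs = 2 * N" "set xs \<subseteq> {..<2 * N}" "E = cycle_edges xs"
    using assms(1) by (auto simp: one_cycle_def)
  have "set xs = {..<2 * N}" by (rule set_eq_lessThan) (use xs in auto)
  moreover have "\<exists>u<2 * N. \<exists>v<2 * N. u \<noteq> v \<and> e = {u, v}" if "e \<in> E" for e
    using comp_edges_proper[of e True xs] that xs assms(2) by (fastforce simp: comp_edges_def)
  ultimately show ?thesis using xs assms(2) unfolding cycle_cover_def by (intro conjI) auto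
qed

lemma two_cycles_cover:
  assumes "two_cycles N E" "3 \<le> N"
  shows "cycle_cover N N E"
proof -
  obtain xs ys where xs: "distinct (xs @ ys)" "length xs = N" "length ys = N" "set (xs @ ys) \<subseteq> {..<2 * N}"
    "E = cycle_edges xs \<union> cycle_edges ys"
    using assms(1) by (auto simp: two_cycles_def)
  have ne: "xs \<noteq> []" "ys \<noteq> []" using xs assms(2) by auto
  have all: "set (xs @ ys) = {..<2 * N}" by (rule set_eq_lessThan) (use xs in auto)
  have pr: "\<exists>u<2 * N. \<exists>v<2 * N. u \<noteq> v \<and> e = {u, v}" if "e \<in> cycle_edges zs" "zs = xs \<or> zs = ys" for e zs
  proof -
    have "\<exists>u\<in>set zs. \<exists>v\<in>set zs. u \<noteq> v \<and> e = {u, v}"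
      by (rule comp_edges_proper[of e True zs]) (use that xs assms(2) in \<open>auto simp: comp_edges_def\<close>)
    moreover have "set zs \<subseteq> {..<2 * N}" using that(2) xs(4) by auto
    ultimately show ?thesis by blast
  qed
  have "{u, v} \<in> E \<longleftrightarrow> {u, v} \<in> cycle_edges xs" if "u \<in> set xs" for u v
    using cycle_edges_meet[OF that _ ne(2)] xs by auto
  moreover have "{u, v} \<in> E \<longleftrightarrow> {u, v} \<in> cycle_edges ys" if "u \<in> set ys" for u v
    using cycle_edges_meet[OF that _ ne(1)] xs by auto
  moreover have "u \<in> set xs \<or> u \<in> set ys" if "u < 2 * N" for u using all that by auto
  ultimately show ?thesis using xs pr assms(2) unfolding cycle_cover_def
    by (intro conjI ballI allI impI) (auto, metis+)
qed

text \<open>For \<open>3 \<le> l\<close> the positions before and after a vertex differ modulo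
  \<open>l\<close>, hence degree 2; the period is the same for both directions of walking.\<close>

lemma regular_input_cover:
  assumes "word_code (2 * N) X c enc1" "4 * N \<le> X" "4 * N\<^sup>2 + 4 * N \<le> M" "2 * c \<le> S" "2 \<le> S" "0 < N"
    and cover: "cycle_cover N l E"
  shows "regular_input N X c enc1 M S E" "has_period (4 * N) l (regular_input.succ_node N E)"
proof -
  interpret word_code "2 * N" X c enc1 by (rule assms(1))
  interpret regular_input N X c enc1 M S E
  proof
    show "\<exists>u<2 * N. \<exists>v<2 * N. u \<noteq> v \<and> e = {u, v}" if "e \<in> E" for e
      using cover that by (auto simp: cycle_cover_def)
    fix u assume "u < 2 * N"
    then obtain xs where xs: "u \<in> set xs" "distinct xs" "length xs = l" "3 \<le> l"
      "\<And>u v. u \<in> set xs \<Longrightarrow> {u, v} \<in> E \<longleftrightarrow> {u, v} \<in> cycle_edges xs"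
      using cover unfolding cycle_cover_def by blast
    obtain i where i: "i < l" "u = xs ! i" using xs(1,3) by (metis in_set_conv_nth)
    have "card {xs ! ((i + 1) mod l), xs ! ((i + (l - 1)) mod l)} = 2"
    proof -
      have "(i + 1 + (l - 2)) mod l \<noteq> (i + 1) mod l"
        using mod_add_eq_self_iff[of "i + 1" "l - 2" l] xs(4) by (auto dest: dvd_imp_le)
      moreover have "i + 1 + (l - 2) = i + (l - 1)" using xs(4) by simp
      ultimately have "(i + 1) mod l \<noteq> (i + (l - 1)) mod l" by metis
      then have "xs ! ((i + 1) mod l) \<noteq> xs ! ((i + (l - 1)) mod l)"
        using xs(2-4) by (simp add: nth_eq_iff_index_eq)
      then show ?thesis by simp
    qed
    then show "card (nb E u) = 2" using nb_cycle[OF xs(2-5), of i] i by simp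
  qed (use assms in auto)
  show "regular_input N X c enc1 M S E" by unfold_locales
  show "has_period (4 * N) l succ_node"
    unfolding has_period_def
  proof (intro allI impI conjI)
    fix x assume x: "x < 4 * N"
    then show "succ_node x < 4 * N" by (rule succ_node_less)
    obtain u w where uw: "u < 2 * N" "w \<in> nb E u" "x = node u w" using node_exists[OF x] by blast
    obtain xs where xs: "u \<in> set xs" "distinct xs" "length xs = l" "3 \<le> l" "set xs \<subseteq> {..<2 * N}"
      "\<And>u v. u \<in> set xs \<Longrightarrow> {u, v} \<in> E \<longleftrightarrow> {u, v} \<in> cycle_edges xs"
      using cover uw(1) unfolding cycle_cover_def by blast
    show "(succ_node ^^ l) x = x"
      unfolding uw(3) by (rule orbit_on_cycle(1)[OF xs(2-4) _ xs(5,1) uw(2)]) (rule xs(6))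
    show "(succ_node ^^ k) x \<noteq> x" if "0 < k" "k < l" for k
      unfolding uw(3) by (rule orbit_on_cycle(2)[OF xs(2-4) _ xs(5,1) uw(2) that]) (rule xs(6))
  qed
qed

section \<open>Solving the cycle problem\<close>

definition answers :: "nat \<Rightarrow> nat \<Rightarrow> nat \<Rightarrow> step list \<Rightarrow> nat set set \<Rightarrow> nat list \<Rightarrow> bool" where
  "answers N M S p E out \<longleftrightarrow> starts M S (edge_records E) \<noteq> {} \<and>
     (\<forall>m0\<in>starts M S (edge_records E). safe M S (2 * N) p (m0, \<lambda>_. []) \<and> fst (exec M p (m0, \<lambda>_. [])) 0 = out)"

text \<open>No tape occurs: the randomness of \<open>A\<close> is removed by fixing
  \<omega>.\<close>

definition solver :: "nat \<Rightarrow> nat \<Rightarrow> nat \<Rightarrow> step list \<Rightarrow> bool" where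
  "solver N M S p \<longleftrightarrow> (\<forall>E. (one_cycle N E \<longrightarrow> answers N M S p E [1]) \<and> (two_cycles N E \<longrightarrow> answers N M S p E [0]))"

context regular_input
begin

lemma answersI:
  assumes "triple M S (2 * N) input_state p (\<lambda>cf. fits M S (2 * N) cf \<and> fst cf 0 = out)"
  shows "answers N M S p E out"
  using assms starts_edge_records by (auto simp: answers_def triple_def input_state_def)

section \<open>A correct but slow program: the token\<close>

definition remember :: step where
  "remember i m b = (if i < 4 * N then (b, if i = 0 then [(hd (dec b), 0)] else []) else ([], []))"

definition walk :: step where
  "walk i m b = (m, if b = [] then [] else [(hd (dec m), 0)])"

definition judge :: step where
  "judge i m b = (if i = 0 then [if b = [] then 1 else 0] else [], [])"

definition walk_state :: "nat \<Rightarrow> cfg \<Rightarrow> bool" where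
  "walk_state t cf \<longleftrightarrow> (\<forall>i<M. fst cf i = (if i < 4 * N then enc1 (succ_node i) else []) \<and>
     snd cf i = (if i = (succ_node ^^ t) 0 then [0] else []))"

lemma funpow_less: "x < 4 * N \<Longrightarrow> (succ_node ^^ t) x < 4 * N"
  by (induction t) (auto simp: succ_node_less)

lemma succ_node_X: "i < 4 * N \<Longrightarrow> succ_node i < X"
  using succ_node_less X_ge by fastforce

lemma walk_state_fits: "walk_state t cf \<Longrightarrow> fits M S (2 * N) cf"
proof -
  assume st: "walk_state t cf"
  have "length (enc1 (succ_node i)) \<le> S" "set (enc1 (succ_node i)) \<subseteq> {..<2 * N}" if "i < 4 * N" for i
    using enc1_length[OF succ_node_X[OF that]] enc1_set[OF succ_node_X[OF that]] S_ge(1) by auto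
  then show ?thesis using st S_ge(2) by (auto simp: fits_def walk_state_def)
qed

lemma deliver_token:
  assumes i0: "i0 < M" and sent: "\<And>j. j < M \<Longrightarrow> snd (st j (fst cf j) (snd cf j)) = (if j = i0 then [(d, 0)] else [])"
  shows "deliver M (\<lambda>j. snd (st j (fst cf j) (snd cf j))) i = (if i = d then [0] else [])"
proof -
  have "deliver M (\<lambda>j. snd (st j (fst cf j) (snd cf j))) i = msgs i (snd (st i0 (fst cf i0) (snd cf i0)))"
    by (rule deliver_single[OF i0]) (use sent in auto)
  then show ?thesis using sent[OF i0] by (simp add: msgs_Cons)
qed

lemma triple_remember: "triple M S (2 * N) succ_state [remember] (walk_state 1)"
proof (rule triple_step)
  fix cf assume st: "succ_state cf"
  have M: "4 * N \<le> M" by (rule M_gt)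
  have sent: "remember j (fst cf j) (snd cf j) =
      (if j < 4 * N then enc1 (succ_node j) else [], if j = 0 then [(succ_node 0, 0)] else [])" if "j < M" for j
    using st that N_pos succ_node_X[of 0] by (simp add: remember_def succ_state_def)
  show "fits M S (2 * N) cf"
    by (rule fits_enc) (use st enc1_length[OF succ_node_X] in \<open>auto simp: succ_state_def\<close>)
  have "succ_node 0 < M" using succ_node_less[of 0] N_pos M by simp
  then show "sends_ok M S (2 * N) remember cf" using S_ge(2) N_pos by (auto simp: sends_ok_def sent)
  have "deliver M (\<lambda>j. snd (remember j (fst cf j) (snd cf j))) i = (if i = succ_node 0 then [0] else [])" for i
    by (rule deliver_token[of 0]) (use M N_pos sent in auto)
  then show "walk_state 1 (apply_step M remember cf)" by (simp add: walk_state_def apply_step_def sent)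
qed (fact walk_state_fits)

lemma triple_walk: "triple M S (2 * N) (walk_state t) [walk] (walk_state (Suc t))"
proof (rule triple_step)
  fix cf assume st: "walk_state t cf"
  let ?i = "(succ_node ^^ t) 0"
  have i: "?i < 4 * N" "?i < M" using funpow_less[of 0 t] N_pos M_gt by auto
  have sent: "walk j (fst cf j) (snd cf j) = (fst cf j, if j = ?i then [(succ_node ?i, 0)] else [])" if "j < M" for j
    using st that succ_node_X[OF i(1)] i by (simp add: walk_def walk_state_def)
  have "succ_node ?i < M" using succ_node_less[OF i(1)] M_gt by simp
  then show "sends_ok M S (2 * N) walk cf" using S_ge(2) N_pos by (auto simp: sends_ok_def sent)
  have "deliver M (\<lambda>j. snd (walk j (fst cf j) (snd cf j))) k = (if k = succ_node ?i then [0] else [])" for k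
    by (rule deliver_token[OF i(2)]) (simp add: sent)
  note dl = this
  show "walk_state (Suc t) (apply_step M walk cf)"
    unfolding walk_state_def apply_step_def fst_conv snd_conv dl
    using st by (simp add: walk_state_def walk_def)
qed (fact walk_state_fits)+

lemma triple_judge:
  "triple M S (2 * N) (walk_state t) [judge]
     (\<lambda>cf. fits M S (2 * N) cf \<and> fst cf 0 = [if (succ_node ^^ t) 0 = 0 then 0 else 1])"
proof (rule triple_step)
  fix cf assume st: "walk_state t cf"
  have none: "snd (judge i m b) = []" for i m b by (simp add: judge_def)
  show "sends_ok M S (2 * N) judge cf" by (simp add: sends_ok_def none)
  have "snd cf 0 = [] \<longleftrightarrow> (succ_node ^^ t) 0 \<noteq> 0" using st M_gt N_pos by (auto simp: walk_state_def)
  moreover have "fits M S (2 * N) (apply_step M judge cf)"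
    using S_ge(2) N_pos by (auto simp: fits_def apply_step_def none deliver_none) (auto simp: judge_def)
  ultimately show "fits M S (2 * N) (apply_step M judge cf) \<and>
      fst (apply_step M judge cf) 0 = [if (succ_node ^^ t) 0 = 0 then 0 else 1]"
    by (simp add: apply_step_def judge_def)
qed (use walk_state_fits in auto)

lemma baseline_answers:
  "answers N M S ([collect, announce, split_node] @ [remember] @ replicate (N - 1) walk @ [judge]) E
     [if (succ_node ^^ N) 0 = 0 then 0 else 1]"
proof (rule answersI)
  \<comment> \<open>\<open>remember\<close> has already moved the token to
    \<open>succ_node 0\<close>, so \<open>N - 1\<close> further moves make \<open>N\<close>.\<close>
  have "triple M S (2 * N) (walk_state 1) (replicate (N - 1) walk) (walk_state (Suc (N - 1)))"
  proof -
    have "concat (map (\<lambda>t. [walk]) [0..<N - 1]) = replicate (N - 1) walk"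
      by (induction "N - 1") (auto simp: map_replicate_const)
    moreover have "triple M S (2 * N) (walk_state (Suc 0)) (concat (map (\<lambda>t. [walk]) [0..<N - 1])) (walk_state (Suc (N - 1)))"
      by (rule triple_iterate[where I = "\<lambda>t. walk_state (Suc t)"]) (use walk_state_fits triple_walk in auto)
    ultimately show ?thesis by simp
  qed
  then have "triple M S (2 * N) (walk_state 1) (replicate (N - 1) walk) (walk_state N)" using N_pos by simp
  then show "triple M S (2 * N) input_state ([collect, announce, split_node] @ [remember] @ replicate (N - 1) walk @ [judge])
      (\<lambda>cf. fits M S (2 * N) cf \<and> fst cf 0 = [if (succ_node ^^ N) 0 = 0 then 0 else 1])"
    by (intro triple_append[OF triple_prepare] triple_append[OF triple_remember] triple_append[OF _ triple_judge])
qed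

end

text \<open>With period \<open>N\<close> the token is back at node 0 after \<open>N\<close> moves,
  with period \<open>2 * N\<close> it is not. Blocks of two words suffice, as
  \<open>4 * N \<le> (2 * N)\<^sup>2\<close>.\<close>

lemma baseline_solver:
  assumes N: "3 \<le> N" and M: "4 * N\<^sup>2 + 4 * N \<le> M" and S: "4 \<le> S"
  shows "\<exists>p. solver N M S p"
proof -
  have "4 * N \<le> (2 * N)\<^sup>2" using N by (simp add: power2_eq_square)
  then obtain enc1 where code: "word_code (2 * N) (4 * N) 2 enc1" using exists_word_code[of "4 * N" "2 * N" 2] by auto
  let ?p = "[regular_input.collect, regular_input.announce N enc1, regular_input.split_node N (4 * N) enc1]
     @ [regular_input.remember N (4 * N) enc1] @ replicate (N - 1) (regular_input.walk (4 * N) enc1) @ [regular_input.judge]"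
  have ans: "answers N M S ?p E [if (regular_input.succ_node N E ^^ N) 0 = 0 then 0 else 1]"
    and per: "has_period (4 * N) l (regular_input.succ_node N E)" if "cycle_cover N l E" for l E
    using regular_input_cover[OF code _ M, of S l E] that S N regular_input.baseline_answers[of N "4 * N" 2 enc1 M S E] by auto
  have "answers N M S ?p E [1]" if "one_cycle N E" for E
  proof -
    note c = one_cycle_cover[OF that N]
    have "(regular_input.succ_node N E ^^ N) 0 \<noteq> 0"
      using per[OF c] N unfolding has_period_def by auto
    then show ?thesis using ans[OF c] by simp
  qed
  moreover have "answers N M S ?p E [0]" if "two_cycles N E" for E
  proof -
    note c = two_cycles_cover[OF that N]
    have "(regular_input.succ_node N E ^^ N) 0 = 0"
      using per[OF c] N unfolding has_period_def by auto
    then show ?thesis using ans[OF c] by simp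
  qed
  ultimately have "solver N M S ?p" unfolding solver_def by blast
  then show ?thesis by blast
qed

section \<open>Iterating the phases\<close>

lemma roles_only_nodes: "roles P g (\<lambda>_ _. []) (\<lambda>_ _ _. []) i = (if i < P then g i else [])"
  by (cases i rule: role_cases[of _ P]) simp_all

context phase_setup
begin

text \<open>The last phase ends with \<open>decide\<close> instead of \<open>update\<close>: for two
  cycles its walks close up after \<open>D\<close> steps, so they are complete in no run and their
  ends could not be identified.\<close>

definition power_prog :: "nat \<Rightarrow> step list" where
  "power_prog k = concat (map (\<lambda>_. gather @ [update]) [0..<k - 1]) @ gather @ [decide]"

lemma phase_power:
  assumes "has_period P l s" "0 < l"
  shows "phase W X c enc1 A n \<epsilon> p \<omega> f D zs P Q H \<sigma> Bf lv M S (s ^^ m)"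
  using phase_setup_axioms has_period_bij[OF assms] by (simp add: phase_def phase_axioms_def)

text \<open>Each phase multiplies the exponent by \<open>D\<close>. Before the last phase
  \<open>D ^ Suc j\<close> is below \<open>D ^ k\<close> and so below the period, hence walks do not
  repeat nodes.\<close>

lemma triple_power:
  assumes per: "has_period P l s" and k: "1 \<le> k" and P2: "2 \<le> P" and D2: "2 \<le> D"
    and l: "l = D ^ k \<or> D ^ k < l"
  shows "triple M S W (node_state s) (power_prog k)
     (\<lambda>cf. fits M S W cf \<and> fst cf 0 = [if D ^ k < l then 1 else 0])"
proof -
  let ?s = "\<lambda>j. s ^^ (D ^ j)"
  have l_pos: "0 < l" using l D2 by (metis gr0I not_less_zero power_eq_0_iff zero_neq_numeral not_numeral_le_zero)
  have "triple M S W (node_state (?s 0)) (concat (map (\<lambda>_. gather @ [update]) [0..<k - 1])) (node_state (?s (k - 1)))"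
  proof (rule triple_iterate[where I = "\<lambda>j. node_state (?s j)"])
    fix cf assume "node_state (?s 0) cf"
    then show "fits M S W cf" by (rule phase.node_state_fits[OF phase_power[OF per l_pos]])
  next
    fix j assume j: "j < k - 1"
    interpret phase W X c enc1 A n \<epsilon> p \<omega> f D zs P Q H \<sigma> Bf lv M S "?s j" by (rule phase_power[OF per l_pos])
    have "D ^ j * D = D ^ Suc j" by simp
    also have "\<dots> < D ^ k" by (rule power_strict_increasing) (use j D2 in auto)
    finally have "D ^ j * D < D ^ k" .
    then have "D ^ j * D < l" using l by auto
    then have sp: "spread x" if "x < P" for x
      unfolding spread_def by (rule has_period_distinct[OF per that]) (use D2 in auto)
    have "?s j ^^ D = ?s (Suc j)" by (simp add: funpow_mult mult.commute)
    then show "triple M S W (node_state (?s j)) (gather @ [update]) (node_state (?s (Suc j)))"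
      using triple_append[OF triple_gather triple_update[OF sp P2]] by simp
  qed
  moreover have "triple M S W (node_state (?s (k - 1))) (gather @ [decide])
     (\<lambda>cf. fits M S W cf \<and> fst cf 0 = [if D ^ k < l then 1 else 0])"
  proof -
    interpret phase W X c enc1 A n \<epsilon> p \<omega> f D zs P Q H \<sigma> Bf lv M S "?s (k - 1)" by (rule phase_power[OF per l_pos])
    have Dk: "D ^ (k - 1) * D = D ^ k" using k by (metis le_add_diff_inverse2 power_Suc2 Suc_eq_plus1)
    have "D ^ k < l \<longleftrightarrow> (\<exists>I. full I 0)"
    proof
      assume "D ^ k < l"
      then have sp: "spread 0"
        unfolding spread_def using Dk P_pos D2 by (intro has_period_distinct[OF per]) auto
      have "\<exists>t. t < P \<and> t \<noteq> (?s (k - 1) ^^ D) 0"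
        using P2 by (metis less_le_trans one_less_numeral_iff semiring_norm(76) zero_neq_one zero_less_numeral)
      then show "\<exists>I. full I 0" using full_exists[OF P_pos sp] by blast
    next
      assume "\<exists>I. full I 0"
      \<comment> \<open>A complete run puts start and end into the different layers 0 and
        \<open>D\<close>, so the walk has not returned.\<close>
      then obtain I where "full I 0" ..
      then have a: "\<forall>i\<le>D. H I ((?s (k - 1) ^^ i) 0) = i" unfolding full_def by blast
      then have "H I 0 = 0" "H I ((?s (k - 1) ^^ D) 0) = D" using a[rule_format, of 0] by simp_all
      moreover have "(?s (k - 1) ^^ D) 0 = (s ^^ (D ^ k)) 0" using Dk by (simp add: funpow_mult)
      ultimately have "(s ^^ (D ^ k)) 0 \<noteq> 0" using D2 by (metis not_numeral_le_zero)
      then show "D ^ k < l" using l per P_pos by (auto simp: has_period_def)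
    qed
    then show ?thesis by (rule triple_append[OF triple_gather triple_decide])
  qed
  ultimately show ?thesis using triple_append by (fastforce simp: power_prog_def)
qed

lemma length_power_prog: "1 \<le> k \<Longrightarrow> length (power_prog k) = k * (T + lv + 5)"
proof -
  assume k: "1 \<le> k"
  have "length (power_prog k) = (k - 1) * (T + lv + 5) + (T + lv + 5)"
    by (simp add: power_prog_def gather_def length_concat o_def sum_list_triv algebra_simps)
  also have "\<dots> = (k - 1 + 1) * (T + lv + 5)" by (simp only: add_mult_distrib mult_1)
  finally show ?thesis using k by simp
qed

end

text \<open>\<open>N = D ^ k\<close> makes the last walk cover exactly \<open>N\<close> steps: it
  closes up on cycles of length \<open>N\<close> and stops halfway on the cycle of length
  \<open>2 * N\<close>.\<close>

lemma fast_solver: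
  assumes ps: "phase_setup (2 * N) X c enc1 A n \<epsilon> p \<omega> f D zs (4 * N) Q H \<sigma> Bf lv M S"
    and N: "3 \<le> N" "N = D ^ k" and D: "2 \<le> D" and X: "4 * N \<le> X" and M: "4 * N\<^sup>2 + 4 * N \<le> M" and S: "2 * c \<le> S" "2 \<le> S"
  shows "\<exists>p. length p = 3 + k * (rounds A n + lv + 5) \<and> solver N M S p"
proof -
  interpret phase_setup "2 * N" X c enc1 A n \<epsilon> p \<omega> f D zs "4 * N" Q H \<sigma> Bf lv M S by (rule ps)
  have k: "1 \<le> k" using N by (cases k) auto
  let ?pre = "[regular_input.collect, regular_input.announce N enc1, regular_input.split_node N X enc1]"
  have ans: "answers N M S (?pre @ power_prog k) E [if D ^ k < l then 1 else 0]"
    if cover: "cycle_cover N l E" and l: "l = D ^ k \<or> D ^ k < l" for l E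
  proof -
    have reg: "regular_input N X c enc1 M S E" and per: "has_period (4 * N) l (regular_input.succ_node N E)"
      using regular_input_cover[OF word_code_axioms X M S _ cover] N(1) by auto
    interpret regular_input N X c enc1 M S E by (rule reg)
    have "triple M S (2 * N) input_state ?pre (node_state succ_node)"
      by (rule triple_conseq[OF triple_prepare]) (auto simp: succ_state_def node_state_def roles_only_nodes)
    from triple_append[OF this triple_power[OF per k _ D l]] N(1) show ?thesis by (intro answersI) simp
  qed
  have "answers N M S (?pre @ power_prog k) E [1]" if "one_cycle N E" for E
  proof -
    have lt: "D ^ k < 2 * N" using N by linarith
    show ?thesis using ans[OF one_cycle_cover[OF that N(1)] disjI2[OF lt]] unfolding if_P[OF lt] .
  qed
  moreover have "answers N M S (?pre @ power_prog k) E [0]" if "two_cycles N E" for E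
  proof -
    have "\<not> D ^ k < N" using N(2) by simp
    from ans[OF two_cycles_cover[OF that N(1)] disjI1[OF N(2)], unfolded if_not_P[OF this]] show ?thesis .
  qed
  ultimately have "solver N M S (?pre @ power_prog k)" unfolding solver_def by blast
  moreover have "length (?pre @ power_prog k) = 3 + k * (rounds A n + lv + 5)"
    using length_power_prog[OF k] by simp
  ultimately show ?thesis by blast
qed

text \<open>All non-uniform choices are made here, for a single \<open>n\<close>. The permutation
  has \<open>4 * N\<close> nodes and a folded instance needs three slots of edges for each of them,
  hence \<open>12 * N \<le> n\<close>.\<close>

lemma exists_fast_solver:
  assumes stable: "stable_witness A f"
    and solves: "solves_almost_spanning_forest A n \<epsilon> (1 - 1 / real n)"
    and N: "3 \<le> N" "N = D ^ k" "12 * N \<le> n" and D: "2 \<le> D" "D + 2 \<le> 4 * N"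
    and n: "8 * (D + 1)\<^sup>2 + 1 < n" and eps: "0 < \<epsilon>" "4 * real (D + 1) * \<epsilon> < 1"
    and X: "word_range A n \<le> (2 * N) ^ c" "Q \<le> (2 * N) ^ c" "0 < c"
    and Q: "real ((D + 1) ^ (D + 2)) * (real (D + 2) * ln (real (4 * N))) < real Q"
    and Bf: "1 \<le> Bf" "machines A n \<le> Bf ^ lv"
    and M: "machine_bound (4 * N) Q (machines A n) \<le> M" "4 * N\<^sup>2 + 4 * N \<le> M"
    and S: "15 * c * Q \<le> S" "c * local_space A n \<le> S" "Bf \<le> S" "2 * c \<le> S" "2 \<le> S"
  shows "\<exists>p. length p = 3 + k * (rounds A n + lv + 5) \<and> solver N M S p"
proof -
  have "2 * (2 * (2 * D + 2)) * (D + 1) + 1 < n" using n by (simp add: power2_eq_square algebra_simps)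
  moreover have "2 * real (2 * D + 2) * \<epsilon> < 1" using eps(2) by (simp add: algebra_simps)
  ultimately obtain \<omega> zs where \<omega>: "\<omega> \<in> tapes A n" "sensitive_cycle f n D \<omega> zs"
    using exists_sensitive_cycle[OF stable solves _ refl, of D] D(1) eps(1) by auto
  obtain H where H: "\<forall>I<Q. \<forall>x<4 * N. H I x \<le> D"
    "\<forall>xs t. distinct xs \<and> length xs = D + 1 \<and> set xs \<subseteq> {..<4 * N} \<and> t < 4 * N \<and> t \<noteq> last xs \<longrightarrow>
       (\<exists>I<Q. (\<forall>i\<le>D. H I (xs ! i) = i) \<and> H I t \<noteq> D)"
    using exists_layerings[OF _ D(2) Q] D(1) by auto
  obtain \<sigma> where \<sigma>: "\<forall>r<2 * n. \<sigma> r < machines A n"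
    "\<forall>i<machines A n. 3 * card {r. r < 2 * n \<and> \<sigma> r = i} \<le> local_space A n"
    using exists_slots[OF solves] N by auto
  obtain enc1 where code: "word_code (2 * N) ((2 * N) ^ c) c enc1" using exists_word_code[OF order_refl X(3)] by blast
  have Xn: "n \<le> (2 * N) ^ c" using X(1) solves by (simp add: solves_almost_spanning_forest_def)
  interpret word_code "2 * N" "(2 * N) ^ c" c enc1 by (rule code)
  have "phase_setup (2 * N) ((2 * N) ^ c) c enc1 A n \<epsilon> (1 - 1 / real n) \<omega> f D zs (4 * N) Q H \<sigma> Bf lv M S"
    by unfold_locales (use assms \<omega> H \<sigma> in auto)
  then show ?thesis by (rule fast_solver[OF _ N(1,2) D(1) _ M(2) S(4,5)]) (use Xn N in simp)
qed

section \<open>Applying the conjecture to the shortest program\<close>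

lemma safe_take:
  assumes "safe M S W p c" "t \<le> length p"
  shows "fits M S W (exec M (take t p) c)" "t < length p \<Longrightarrow> sends_ok M S W (p ! t) (exec M (take t p) c)"
proof -
  have "safe M S W (take t p @ drop t p) c" using assms(1) by simp
  then have d: "safe M S W (drop t p) (exec M (take t p) c)" unfolding safe_append by blast
  then show "fits M S W (exec M (take t p) c)" by (rule safe_fits)
  show "sends_ok M S W (p ! t) (exec M (take t p) c)" if "t < length p"
    using d that by (simp flip: Cons_nth_drop_Suc)
qed

text \<open>The algorithm runs a shortest correct program for each \<open>N\<close>, and
  \<open>base\<close> provides one for almost all \<open>N\<close>, so the conjecture applies. By
  minimality its bound passes to every correct program of large size, even if fast programs existed
  for isolated sizes only.\<close>

lemma solver_lower_bound:
  assumes conj: one_vs_two_cycle_conjecture and \<gamma>: "0 < \<gamma>"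
    and S: "(\<lambda>n. real (S n)) \<in> O(\<lambda>n. real n powr (1 - \<gamma>))" and M: "poly_bounded M" "\<And>n. 0 < M n"
    and base: "\<forall>\<^sub>F N in sequentially. \<exists>p. solver N (M N) (S N) p"
  shows "\<exists>c>0. \<forall>\<^sub>F N in sequentially. \<forall>p. solver N (M N) (S N) p \<longrightarrow> c * ln (real N) \<le> real (length p)"
proof -
  define pr where "pr N = (ARG_MIN length p. solver N (M N) (S N) p)" for N
  \<comment> \<open>The word range \<open>2 * N\<close> is the least one allowed and forces the
    vertex names to be the numbers below \<open>2 * N\<close>. With tape length 0 the only tape is
    empty, and success has probability 1.\<close>
  define B where "B = \<lparr>machines = M, local_space = S, word_range = (\<lambda>N. 2 * N), tape_length = (\<lambda>_. 0),
    rounds = (\<lambda>N. length (pr N)), local_comp = (\<lambda>N t i \<omega> m b. (pr N ! t) i m b)\<rparr>"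
  have sel [simp]: "machines B = M" "local_space B = S" "word_range B = (\<lambda>N. 2 * N)" "tape_length B = (\<lambda>_. 0)"
    "rounds B = (\<lambda>N. length (pr N))" "local_comp B = (\<lambda>N t i \<omega> m b. (pr N ! t) i m b)"
    by (simp_all add: B_def)
  have tapes: "tapes B N = {[]}" for N by (auto simp: tapes_def)
  have init: "initial_memories B N recs = starts (M N) (S N) recs" for N recs
    by (simp add: initial_memories_def starts_def)
  have conf: "config B N \<omega> m0 t = exec (M N) (take t (pr N)) (m0, \<lambda>_. [])" if "t \<le> length (pr N)" for N \<omega> m0 t
    using that
  proof (induction t)
    case (Suc t)
    then have "take (Suc t) (pr N) = take t (pr N) @ [pr N ! t]" by (simp add: take_Suc_conv_app_nth)
    then show ?case using Suc
      by (simp add: exec_append apply_step_def deliver_def msgs_def Let_def case_prod_beta fun_eq_iff)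
  qed simp
  have ach: "mpc_achieves B N (edge_records E) p (\<lambda>mems. mems ! 0 = out)"
    if ans: "answers N (M N) (S N) (pr N) E out" and p: "p \<le> 1" for N E out p
    unfolding mpc_achieves_def init tapes
  proof (intro conjI ballI)
    show "starts (M N) (S N) (edge_records E) \<noteq> {}" using ans by (simp add: answers_def)
    fix m0 assume "m0 \<in> starts (M N) (S N) (edge_records E)"
    then have safe: "safe (M N) (S N) (2 * N) (pr N) (m0, \<lambda>_. [])" and out: "fst (exec (M N) (pr N) (m0, \<lambda>_. [])) 0 = out"
      using ans by (auto simp: answers_def)
    show "within_limits B N \<omega> m0" for \<omega>
      using safe_take[OF safe] unfolding within_limits_def
      by (auto simp: memory_after_def inbox_after_def sent_in_round_def conf fits_def sends_ok_def)
    have "mpc_output B N \<omega> m0 ! 0 = out" for \<omega>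
      using out M(2)[of N] by (simp add: mpc_output_def memory_after_def conf)
    then show "p \<le> measure_pmf.prob (pmf_of_set {[]}) {\<omega>. mpc_output B N \<omega> m0 ! 0 = out}"
      using p by (simp add: pmf_of_set_singleton)
  qed
  have "distinguishes_one_vs_two_cycles B N (1 - 1 / real N)" if "\<exists>p. solver N (M N) (S N) p" for N
  proof -
    have "solver N (M N) (S N) (pr N)" unfolding pr_def using that by (metis arg_min_natI)
    then have "one_cycle N E \<Longrightarrow> answers N (M N) (S N) (pr N) E [1]" "two_cycles N E \<Longrightarrow> answers N (M N) (S N) (pr N) E [0]" for E
      unfolding solver_def by blast+
    then have "mpc_achieves B N (edge_records E) (1 - 1 / real N) (\<lambda>mems. mems ! 0 = [1])" if "one_cycle N E" for E
      using ach that by simp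
    moreover have "mpc_achieves B N (edge_records E) (1 - 1 / real N) (\<lambda>mems. mems ! 0 = [0])" if "two_cycles N E" for E
      using ach that \<open>\<And>E. two_cycles N E \<Longrightarrow> answers N (M N) (S N) (pr N) E [0]\<close> by simp
    moreover have "one_cycle N (cycle_edges xs)" if "distinct xs" "length xs = 2 * N" "set xs \<subseteq> {..<2 * N}" for xs
      using that unfolding one_cycle_def by blast
    moreover have "two_cycles N (cycle_edges xs \<union> cycle_edges ys)"
      if "distinct (xs @ ys)" "length xs = N" "length ys = N" "set (xs @ ys) \<subseteq> {..<2 * N}" for xs ys
      using that unfolding two_cycles_def by blast
    ultimately show ?thesis unfolding distinguishes_one_vs_two_cycles_def sel by blast
  qed
  with base have "\<forall>\<^sub>F N in sequentially. distinguishes_one_vs_two_cycles B N (1 - 1 / real N)"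
    by (rule eventually_mono)
  moreover have "poly_bounded (word_range B)" by (auto simp: poly_bounded_def intro!: exI[of _ 1])
  ultimately have "(\<lambda>n. real (rounds B n)) \<in> \<Omega>(\<lambda>n. ln (real n))"
    using \<gamma> S M(1)
    by (intro conj[unfolded one_vs_two_cycle_conjecture_def, THEN spec[of _ B], THEN spec[of _ \<gamma>], THEN mp]) simp
  then obtain c where c: "c > 0" "\<forall>\<^sub>F N in sequentially. c * norm (ln (real N)) \<le> norm (real (length (pr N)))"
    by (elim landau_omega.bigE) auto
  have "\<forall>\<^sub>F N in sequentially. \<forall>p. solver N (M N) (S N) p \<longrightarrow> c * ln (real N) \<le> real (length p)"
    using c(2)
  proof eventually_elim
    case (elim N)
    have "length (pr N) \<le> length p" if "solver N (M N) (S N) p" for p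
      unfolding pr_def by (rule arg_min_nat_le) (rule that)
    moreover have "c * ln (real N) \<le> c * norm (ln (real N))" using c(1) by (intro mult_left_mono) auto
    ultimately show ?case using elim by fastforce
  qed
  then show ?thesis using c(1) by blast
qed

text \<open>With no round at all, the output is the input, whose vertex records are not edges.\<close>

lemma rounds_pos:
  assumes solves: "solves_almost_spanning_forest A n \<epsilon> (1 - 1 / real n)" and n: "2 \<le> n"
  shows "0 < rounds A n"
proof (rule ccontr)
  assume "\<not> 0 < rounds A n"
  then have r0: "rounds A n = 0" by simp
  interpret path_cycle_family "(\<lambda>v. [v]) ` {..<n}" "\<lambda>_. False" "{..<n}" "{}"
    by standard (auto simp: comp_edges_def)
  have W: "n \<le> word_range A n" using solves by (simp add: solves_almost_spanning_forest_def)
  have "forest_input A n {..<n} {} id"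
    by (rule forest_inputI) (use W in auto)
  then have ach: "mpc_achieves A n (graph_records {..<n} {} id) (1 - 1 / real n)
      (\<lambda>mems. almost_spanning_forest_solution \<epsilon> {..<n} {} (removed_edges mems))"
    using solves unfolding solves_almost_spanning_forest_def by blast
  then obtain m0 where m0: "m0 \<in> initial_memories A n (graph_records {..<n} {} id)" by (auto simp: mpc_achieves_def)
  then obtain \<rho> where \<rho>: "set (concat (map \<rho> [0..<machines A n])) = graph_records {..<n} {} id" "\<And>i. m0 i = concat (\<rho> i)"
    by (auto simp: initial_memories_def)
  have rec: "r \<in> graph_records {..<n} {} id" if "i < machines A n" "r \<in> set (\<rho> i)" for i r
  proof -
    have "r \<in> set (concat (map \<rho> [0..<machines A n]))" using that by auto
    then show ?thesis unfolding \<rho>(1) .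
  qed
  have "[0, 0, 0] \<in> graph_records {..<n} {} id" using n by (auto simp: graph_records_def)
  then have "[0, 0, 0] \<in> set (concat (map \<rho> [0..<machines A n]))" unfolding \<rho>(1) .
  then obtain i where i: "i < machines A n" "[0, 0, 0] \<in> set (\<rho> i)" by auto
  \<comment> \<open>Whatever record stands first in this memory has the form
    \<open>[0, v, v]\<close>; read in pairs, it lists the edge \<open>{0, v}\<close>, which the
    edgeless graph does not have.\<close>
  then obtain r rs where rs: "\<rho> i = r # rs" by (cases "\<rho> i") auto
  then obtain v where v: "r = [0, v, v]" using rec[OF i(1), of r] by (auto simp: graph_records_def)
  have "(0, v) \<in> word_pairs (m0 i)" by (simp add: \<rho>(2) rs v)
  moreover have "m0 i \<in> set (mpc_output A n \<omega> m0)" for \<omega>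
    using i(1) by (auto simp: mpc_output_def memory_after_def r0)
  ultimately have "{0, v} \<in> removed_edges (mpc_output A n \<omega> m0)" for \<omega>
    unfolding removed_edges_def by blast
  then have "{\<omega>. almost_spanning_forest_solution \<epsilon> {..<n} {} (removed_edges (mpc_output A n \<omega> m0))} = {}"
    by (auto simp: almost_spanning_forest_solution_def)
  then have "1 - 1 / real n \<le> 0" using ach m0 by (auto simp: mpc_achieves_def)
  then show False using n by (simp add: field_simps)
qed

text \<open>Turns the polynomial bound on total space into one on the number of machines.\<close>

lemma local_space_pos:
  assumes "solves_almost_spanning_forest A n \<epsilon> p" "3 \<le> n"
  shows "0 < local_space A n"
proof -
  obtain \<sigma> where \<sigma>: "\<forall>r<2 * n. \<sigma> r < machines A n" "\<forall>i<machines A n. 3 * card {r. r < 2 * n \<and> \<sigma> r = i} \<le> local_space A n"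
    using exists_slots[OF assms] by blast
  have "0 \<in> {r. r < 2 * n \<and> \<sigma> r = \<sigma> 0}" "finite {r. r < 2 * n \<and> \<sigma> r = \<sigma> 0}" using assms(2) by auto
  then have "0 < card {r. r < 2 * n \<and> \<sigma> r = \<sigma> 0}" by (metis card_gt_0_iff empty_iff)
  moreover have "\<sigma> 0 < machines A n" using \<sigma>(1) assms(2) by simp
  then have "3 * card {r. r < 2 * n \<and> \<sigma> r = \<sigma> 0} \<le> local_space A n" using \<sigma>(2) by blast
  ultimately show ?thesis by linarith
qed

section \<open>The choice of the parameters\<close>

lemma poly_bounded_power:
  assumes "poly_bounded g"
  shows "\<exists>a. \<forall>\<^sub>F n in sequentially. g n \<le> n ^ a"
proof -
  obtain k c where c: "\<forall>\<^sub>F n in sequentially. norm (real (g n)) \<le> c * norm (real n ^ k)"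
    using assms by (auto simp: poly_bounded_def elim!: landau_o.bigE)
  have "\<forall>\<^sub>F n in sequentially. g n \<le> n ^ (k + 1)"
    using c eventually_ge_at_top[of "nat \<lceil>c\<rceil>"]
  proof eventually_elim
    case (elim n)
    have "c \<le> real n" using elim(2) by linarith
    then have "c * real n ^ k \<le> real n * real n ^ k" by (intro mult_right_mono) auto
    then have "real (g n) \<le> real (n ^ (k + 1))" using elim(1) by simp
    then show ?case by (simp only: of_nat_le_iff)
  qed
  then show ?thesis by blast
qed

lemma machine_bound_mono:
  "Q \<le> Q' \<Longrightarrow> m \<le> m' \<Longrightarrow> machine_bound P Q m \<le> machine_bound P Q' m'"
  unfolding machine_bound_def by (intro add_mono mult_left_mono power_mono order_refl) auto

lemma machine_bound_poly: "poly_bounded (\<lambda>N. machine_bound (4 * N) N (N ^ a))"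
proof -
  have le: "machine_bound (4 * N) N (N ^ a) \<le> 3200 * N ^ (2 * a + 4)" if N: "1 \<le> N" for N
  proof -
    let ?B = "N ^ (a + 2)"
    have "(N + 4 * N + 1)\<^sup>2 \<le> (6 * N)\<^sup>2" using N by (intro power_mono) auto
    also have "\<dots> = 36 * N ^ 2" by (simp add: power_mult_distrib)
    also have "\<dots> \<le> 36 * ?B" using N by (intro mult_left_mono power_increasing) auto
    finally have 1: "(N + 4 * N + 1)\<^sup>2 \<le> 36 * ?B" .
    have 2: "N ^ a \<le> ?B" "N \<le> ?B" "1 \<le> ?B" using N by (auto intro: power_increasing self_le_power)
    have "((N + 4 * N + 1)\<^sup>2 + N ^ a + N + 1)\<^sup>2 \<le> (39 * ?B)\<^sup>2"
      by (intro power_mono) (use 1 2 in linarith, simp)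
    also have "\<dots> = 1521 * N ^ ((a + 2) * 2)" unfolding power_mult_distrib power_mult by simp
    also have "(a + 2) * 2 = 2 * a + 4" by simp
    finally have 3: "((N + 4 * N + 1)\<^sup>2 + N ^ a + N + 1)\<^sup>2 \<le> 1521 * N ^ (2 * a + 4)" .
    have 4: "N \<le> N ^ (2 * a + 4)" "1 \<le> N ^ (2 * a + 4)" using N by (auto intro: self_le_power)
    show ?thesis unfolding machine_bound_def using 3 4 by linarith
  qed
  have "\<forall>\<^sub>F N in sequentially. norm (real (machine_bound (4 * N) N (N ^ a))) \<le> 3200 * norm (real N ^ (2 * a + 4))"
    using eventually_ge_at_top[of 1]
  proof eventually_elim
    case (elim N)
    have "real (machine_bound (4 * N) N (N ^ a)) \<le> real (3200 * N ^ (2 * a + 4))"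
      using le[OF elim] by (simp only: of_nat_le_iff)
    then show ?case by simp
  qed
  then have "(\<lambda>N. real (machine_bound (4 * N) N (N ^ a))) \<in> O(\<lambda>N. real N ^ (2 * a + 4))" by (rule landau_o.bigI[rotated]) simp
  then show ?thesis unfolding poly_bounded_def by blast
qed

lemma exists_power_below:
  assumes "2 \<le> D" "c \<le> n" "0 < (c::nat)"
  shows "\<exists>k. c * D ^ k \<le> n \<and> n < c * D ^ Suc k"
proof -
  have "n < 2 ^ n" by (rule less_exp)
  also have "\<dots> \<le> D ^ n" using assms(1) by (rule power_mono) simp
  also have "\<dots> \<le> c * D ^ n" using assms(3) by simp
  finally have ex: "\<exists>k. n < c * D ^ k" by blast
  define k where "k = (LEAST k. n < c * D ^ k)"
  have k: "n < c * D ^ k" unfolding k_def by (rule LeastI_ex[OF ex])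
  then have "k \<noteq> 0" using assms(2) by (cases k) auto
  then obtain j where j: "k = Suc j" by (cases k) auto
  then have "\<not> n < c * D ^ j" using not_less_Least[of j "\<lambda>k. n < c * D ^ k"] by (simp add: k_def)
  then show ?thesis using k j by (intro exI[of _ j]) auto
qed

lemma le_nat_ceilingI: "real m \<le> x \<Longrightarrow> m \<le> nat \<lceil>x\<rceil>"
  by linarith

text \<open>\<open>C\<close> and \<delta> describe the local space of \<open>A\<close>, and
  \<open>n ^ a\<close> and \<open>n ^ b\<close> bound its machines and words. The conjecture
  measures resources in the cycle length \<open>N\<close>, so everything below is expressed in
  \<open>N\<close>; in \<open>fast\<close>, \<open>n \<le> N\<^sup>2\<close>.\<close>

locale parameters =
  fixes \<delta> C :: real and a b :: nat
  assumes \<delta>: "0 < \<delta>" "\<delta> < 1" and C: "0 < C"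
begin

text \<open>Words of \<open>A\<close> are below \<open>n ^ b \<le> N ^ (2 * b)\<close>; the summand
  2 leaves room for the run numbers and makes \<open>c\<close> positive.\<close>

definition c where "c = 2 * b + 2"
text \<open>Halfway between \<delta> and 1: this leaves room for \<open>n\<close> exceeding
  \<open>N\<close> by a factor \<open>12 * D\<close> and keeps the exponent below 1.\<close>

definition \<beta> where "\<beta> = (1 + \<delta>) / 2"
text \<open>Sum of the demands on \<open>S\<close>: \<open>15 * c * Q\<close> with \<open>Q\<close>
  at most \<open>sqrt N\<close>, the encoded memories of \<open>A\<close>, and 4 for the fan-in and
  small constants.\<close>

definition space where "space N = nat \<lceil>(15 * real c + real c * C + 4) * real N powr \<beta>\<rceil>"
definition machs where "machs N = machine_bound (4 * N) N (N ^ (2 * a))"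

text \<open>\<open>sqrt (2 * ln N)\<close> bounds \<open>D\<close> because
  \<open>n \<le> N\<^sup>2\<close>. The third condition keeps the number of layerings below
  \<open>sqrt N\<close>: the power on its left is the exponential of \<open>sqrt (ln N)\<close>
  times a factor of order \<open>ln (ln N)\<close>, hence \<open>N powr o(1)\<close>. This is where
  polylogarithmic \<open>1 / \<epsilon>\<close> enters.\<close>

definition good where
  "good N \<longleftrightarrow> 3 \<le> N \<and> sqrt (2 * ln (real N)) + 2 \<le> 4 * real N \<and>
     (sqrt (2 * ln (real N)) + 1) powr (sqrt (2 * ln (real N)) + 2) * ((sqrt (2 * ln (real N)) + 2) * ln (4 * real N)) + 1
        \<le> real N powr (1 / 2) \<and>
     12 * sqrt (2 * ln (real N)) \<le> real N powr ((1 - \<delta>) / 2)"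

lemma eventually_good: "eventually good sequentially"
proof -
  have "\<forall>\<^sub>F N in sequentially. sqrt (2 * ln (real N)) + 2 \<le> 4 * real N" by real_asymp
  moreover have "\<forall>\<^sub>F N in sequentially.
     (sqrt (2 * ln (real N)) + 1) powr (sqrt (2 * ln (real N)) + 2) * ((sqrt (2 * ln (real N)) + 2) * ln (4 * real N)) + 1
        \<le> real N powr (1 / 2)" by real_asymp
  moreover have "\<forall>\<^sub>F N in sequentially. 12 * sqrt (2 * ln (real N)) \<le> real N powr ((1 - \<delta>) / 2)"
    using \<delta> by real_asymp
  ultimately show ?thesis
    using eventually_ge_at_top[of 3] unfolding good_def by eventually_elim auto
qed

lemma space_ge: "1 \<le> N \<Longrightarrow> real m \<le> (15 * real c + real c * C + 4) * real N powr \<beta> \<Longrightarrow> m \<le> space N"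
  unfolding space_def by (rule le_nat_ceilingI)

lemma space_bigo: "(\<lambda>N. real (space N)) \<in> O(\<lambda>N. real N powr (1 - (1 - \<delta>) / 2))"
proof -
  let ?K = "15 * real c + real c * C + 4"
  have K: "0 \<le> ?K" using C by simp
  have e: "1 - (1 - \<delta>) / 2 = \<beta>" by (simp add: \<beta>_def field_simps)
  have "\<forall>\<^sub>F N in sequentially. norm (real (space N)) \<le> (?K + 1) * norm (real N powr \<beta>)"
    using eventually_ge_at_top[of 1]
  proof eventually_elim
    case (elim N)
    have "1 \<le> real N powr \<beta>" using elim \<delta> by (intro ge_one_powr_ge_zero) (auto simp: \<beta>_def)
    moreover have "0 \<le> ?K * real N powr \<beta>" using K by simp
    then have "real (space N) \<le> ?K * real N powr \<beta> + 1" unfolding space_def by linarith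
    ultimately show ?case by (simp add: algebra_simps)
  qed
  then show ?thesis unfolding e by (rule landau_o.bigI[rotated]) (use K in simp)
qed

lemma machs_ge: "4 * N\<^sup>2 + 4 * N \<le> machs N"
proof -
  have "4 * N\<^sup>2 = (2 * N)\<^sup>2" by (simp add: power_mult_distrib)
  also have "\<dots> \<le> ((N + 4 * N + 1)\<^sup>2 + N ^ (2 * a) + N + 1)\<^sup>2"
  proof (rule power_mono)
    have "N + 4 * N + 1 \<le> (N + 4 * N + 1)\<^sup>2" by (rule self_le_power) auto
    then show "2 * N \<le> (N + 4 * N + 1)\<^sup>2 + N ^ (2 * a) + N + 1" by linarith
  qed simp
  finally show ?thesis by (simp add: machs_def machine_bound_def)
qed

lemma baseline: "\<forall>\<^sub>F N in sequentially. \<exists>p. solver N (machs N) (space N) p"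
  using eventually_ge_at_top[of 3]
proof eventually_elim
  case (elim N)
  have "1 * 1 \<le> (15 * real c + real c * C + 4) / 4 * real N powr \<beta>"
    using elim \<delta> C by (intro mult_mono ge_one_powr_ge_zero) (auto simp: \<beta>_def)
  then have "4 \<le> space N" using elim by (intro space_ge) auto
  then show ?case using baseline_solver[OF elim machs_ge] by blast
qed

text \<open>\<open>N\<close> is the largest power of \<open>D\<close> with
  \<open>12 * N \<le> n\<close>, so \<open>n < 12 * D * N\<close>, and \<open>N\<close> is at least
  \<open>sqrt n\<close>. The program has \<open>k = ln N / ln D\<close> phases of
  \<open>rounds A n + 4 * a + 5\<close> rounds; 8 in place of 5 absorbs the 3 preparatory
  rounds.\<close>

lemma fast:
  assumes stable: "stable_witness A f"
    and solves: "solves_almost_spanning_forest A n \<epsilon> (1 - 1 / real n)"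
    and bounds: "real (local_space A n) \<le> C * real n powr \<delta>" "machines A n \<le> n ^ a" "word_range A n \<le> n ^ b"
    and D: "2 \<le> D" "real D \<le> sqrt (ln (real n))" and eps: "0 < \<epsilon>" "4 * real (D + 1) * \<epsilon> < 1"
    and n: "8 * (D + 1)\<^sup>2 + 1 < n" "12 * sqrt (ln (real n)) \<le> sqrt (real n)" "12 \<le> n"
    and large: "\<And>N. sqrt (real n) \<le> real N \<Longrightarrow> good N"
  shows "\<exists>N p. sqrt (real n) \<le> real N \<and> solver N (machs N) (space N) p \<and>
    real (length p) * ln (real D) \<le> ln (real N) * (real (rounds A n) + 4 * real a + 8)"
proof -
  obtain k where k: "12 * D ^ k \<le> n" "n < 12 * D ^ Suc k" using exists_power_below[OF D(1) n(3)] by auto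
  define N where "N = D ^ k"
  have nN: "real n \<le> 12 * real D * real N"
  proof -
    have "n \<le> 12 * D * N" using k(2) by (simp add: N_def mult.assoc)
    then show ?thesis by (metis of_nat_le_iff of_nat_mult of_nat_numeral)
  qed
  have n_pos: "0 < real n" using n(3) by simp
  have sqrtN: "sqrt (real n) \<le> real N"
  proof -
    have "sqrt (real n) * sqrt (real n) \<le> 12 * real D * real N" using nN by simp
    also have "\<dots> \<le> 12 * sqrt (ln (real n)) * real N" using D(2) by (intro mult_right_mono) auto
    also have "\<dots> \<le> sqrt (real n) * real N" using n(2) by (intro mult_right_mono) auto
    finally show ?thesis by (rule mult_left_le_imp_le) (use n_pos in simp)
  qed
  then have g: "good N" by (rule large)
  then have N3: "3 \<le> N" by (simp add: good_def)
  have nN2: "n \<le> N\<^sup>2"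
  proof -
    have "(sqrt (real n))\<^sup>2 \<le> (real N)\<^sup>2" using sqrtN by (intro power_mono) auto
    then have "real n \<le> real (N\<^sup>2)" by simp
    then show ?thesis by (simp only: of_nat_le_iff)
  qed
  let ?z = "sqrt (2 * ln (real N))"
  have "ln (real n) \<le> ln (real (N\<^sup>2))" using nN2 n_pos by (intro ln_mono) (auto simp del: of_nat_power)
  also have "\<dots> = 2 * ln (real N)" using N3 by (simp add: ln_realpow)
  finally have Dz: "real D \<le> ?z" using D(2) by (meson order_trans real_sqrt_le_mono)
  have z0: "0 \<le> ?z" using D(1) Dz by linarith
  define q where "q = real ((D + 1) ^ (D + 2)) * (real (D + 2) * ln (real (4 * N)))"
  have q0: "0 \<le> q" unfolding q_def using N3 by (intro mult_nonneg_nonneg ln_ge_zero) auto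
  have "real ((D + 1) ^ (D + 2)) = (real D + 1) ^ (D + 2)" by (simp only: of_nat_power of_nat_add of_nat_1)
  also have "\<dots> = (real D + 1) powr real (D + 2)" by (rule powr_realpow[symmetric]) simp
  also have "\<dots> = (real D + 1) powr (real D + 2)" by (simp add: add.commute)
  also have "\<dots> \<le> (?z + 1) powr (real D + 2)" using Dz by (intro powr_mono2) auto
  also have "\<dots> \<le> (?z + 1) powr (?z + 2)" using Dz z0 by (intro powr_mono) auto
  finally have "q \<le> (?z + 1) powr (?z + 2) * ((?z + 2) * ln (4 * real N))"
    unfolding q_def using Dz z0 N3 by (intro mult_mono) auto
  then have qN: "q + 1 \<le> real N powr (1 / 2)" using g by (simp add: good_def)
  define Q where "Q = nat \<lfloor>q\<rfloor> + 1"
  have Q: "q < real Q" "real Q \<le> real N powr (1 / 2)" using q0 qN unfolding Q_def by linarith+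
  have half: "real N powr (1 / 2) \<le> real N powr \<beta>" using N3 \<delta> by (intro powr_mono) (auto simp: \<beta>_def)
  have "real N powr (1 / 2) \<le> real N powr 1" using N3 by (intro powr_mono) auto
  then have QN: "Q \<le> N" using Q(2) by simp
  have one: "1 \<le> real N powr \<beta>" using N3 \<delta> by (intro ge_one_powr_ge_zero) (auto simp: \<beta>_def)
  \<comment> \<open>Fan-in about \<open>sqrt N\<close> fits into the local space, and depth
    \<open>4 * a\<close> then serves \<open>N ^ (2 * a)\<close> machines, so the trees cost a
    constant number of rounds.\<close>
  define Bf where "Bf = nat \<lceil>sqrt (real N)\<rceil>"
  have Bf: "sqrt (real N) \<le> real Bf" "real Bf \<le> sqrt (real N) + 1"
    using real_sqrt_ge_zero[of "real N"] unfolding Bf_def by linarith+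
  have c0: "0 < c" by (simp add: c_def)
  let ?K = "15 * real c + real c * C + 4"
  \<comment> \<open>\<open>n\<close> is at most \<open>12 * D * N\<close>, hence at most
    \<open>N powr ((1 - \<delta>) / 2 + 1)\<close>, and \<delta> times this exponent is at most
    \<beta>.\<close>
  have "real n powr \<delta> \<le> real N powr \<beta>"
  proof -
    have "12 * real D \<le> real N powr ((1 - \<delta>) / 2)" using Dz g by (simp add: good_def)
    then have "12 * real D * real N \<le> real N powr ((1 - \<delta>) / 2) * real N" by (intro mult_right_mono) auto
    then have "real n powr \<delta> \<le> (real N powr ((1 - \<delta>) / 2) * real N) powr \<delta>"
      using nN \<delta> by (intro powr_mono2) auto
    also have "\<dots> = (real N powr ((1 - \<delta>) / 2 + 1)) powr \<delta>" using N3 by (simp add: powr_add)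
    also have "\<dots> = real N powr (((1 - \<delta>) / 2 + 1) * \<delta>)" by (simp add: powr_powr)
    also have "\<dots> \<le> real N powr \<beta>"
    proof (rule powr_mono)
      have "(1 - \<delta>) / 2 * \<delta> \<le> (1 - \<delta>) / 2 * 1" using \<delta> by (intro mult_left_mono) auto
      then show "((1 - \<delta>) / 2 + 1) * \<delta> \<le> \<beta>" by (simp add: \<beta>_def field_simps)
    qed (use N3 in simp)
    finally show ?thesis .
  qed
  then have "C * real n powr \<delta> \<le> C * real N powr \<beta>" using C by (intro mult_left_mono) auto
  then have loc: "real (local_space A n) \<le> C * real N powr \<beta>" using bounds(1) by linarith
  have mach: "machines A n \<le> N ^ (2 * a)"
  proof -
    have "n ^ a \<le> (N\<^sup>2) ^ a" by (rule power_mono[OF nN2]) simp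
    then show ?thesis using bounds(2) by (simp add: power_mult)
  qed
  have "\<exists>p. length p = 3 + k * (rounds A n + 4 * a + 5) \<and> solver N (machs N) (space N) p"
  proof (rule exists_fast_solver[OF stable solves N3 N_def _ D(1) _ n(1) eps])
    show "12 * N \<le> n" using k(1) by (simp add: N_def)
    show "D + 2 \<le> 4 * N"
    proof -
      have "real D + 2 \<le> 4 * real N" using Dz g by (simp add: good_def)
      then show ?thesis by linarith
    qed
    show "word_range A n \<le> (2 * N) ^ c"
    proof -
      have "n ^ b \<le> (N\<^sup>2) ^ b" by (rule power_mono[OF nN2]) simp
      also have "\<dots> = N ^ (2 * b)" by (simp add: power_mult)
      also have "\<dots> \<le> (2 * N) ^ (2 * b)" by (rule power_mono) auto
      also have "\<dots> \<le> (2 * N) ^ c" using N3 by (intro power_increasing) (auto simp: c_def)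
      finally show ?thesis using bounds(3) by linarith
    qed
    have "N \<le> (2 * N) ^ 1" by simp
    also have "\<dots> \<le> (2 * N) ^ c" using N3 by (intro power_increasing) (auto simp: c_def)
    finally show "Q \<le> (2 * N) ^ c" using QN by linarith
    show "real ((D + 1) ^ (D + 2)) * (real (D + 2) * ln (real (4 * N))) < real Q" using Q(1) by (simp only: q_def)
    show "1 \<le> Bf"
    proof -
      have "1 \<le> sqrt (real N)" using N3 by simp
      then have "1 \<le> real Bf" using Bf(1) by linarith
      then show ?thesis by simp
    qed
    show "machines A n \<le> Bf ^ (4 * a)"
    proof -
      have "real (N ^ (2 * a)) = sqrt (real N) ^ (4 * a)"
      proof -
        have "sqrt (real N) ^ (4 * a) = (sqrt (real N) ^ 2) ^ (2 * a)" by (simp only: power_mult[symmetric]) simp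
        then show ?thesis by simp
      qed
      also have "\<dots> \<le> real Bf ^ (4 * a)" using Bf(1) by (intro power_mono) auto
      finally have "real (N ^ (2 * a)) \<le> real (Bf ^ (4 * a))" by simp
      then have "N ^ (2 * a) \<le> Bf ^ (4 * a)" by (simp only: of_nat_le_iff)
      then show ?thesis using mach by linarith
    qed
    show "machine_bound (4 * N) Q (machines A n) \<le> machs N"
      unfolding machs_def by (rule machine_bound_mono[OF QN mach])
    have N1: "1 \<le> N" using N3 by simp
    have cC: "0 \<le> real c * C * real N powr \<beta>" "0 \<le> real c * real N powr \<beta>" using C by auto
    have K: "?K * real N powr \<beta> = 15 * (real c * real N powr \<beta>) + real c * C * real N powr \<beta> + 4 * real N powr \<beta>"
      by (simp add: algebra_simps)
    have cN: "real c \<le> real c * real N powr \<beta>" using one by (simp add: mult_le_cancel_left1)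
    have "real c * real Q \<le> real c * real N powr \<beta>" using Q(2) half by (intro mult_left_mono) auto
    then show "15 * c * Q \<le> space N" by (intro space_ge[OF N1]) (use K cC one in simp)
    have "real c * real (local_space A n) \<le> real c * (C * real N powr \<beta>)" using loc by (intro mult_left_mono) auto
    then have "real c * real (local_space A n) \<le> real c * C * real N powr \<beta>" by (simp only: mult.assoc)
    then show "c * local_space A n \<le> space N"
      by (intro space_ge[OF N1]) (use cC one in \<open>unfold K of_nat_mult, linarith\<close>)
    have "real Bf \<le> 2 * real N powr \<beta>" using Bf(2) half one N3 by (simp add: powr_half_sqrt)
    then show "Bf \<le> space N" by (intro space_ge[OF N1]) (use K cC one in linarith)
    show "2 * c \<le> space N" by (intro space_ge[OF N1]) (use K cC cN one in simp)
    show "2 \<le> space N" by (intro space_ge[OF N1]) (use cC one in \<open>unfold K of_nat_numeral, linarith\<close>)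
  qed (use c0 machs_ge in auto)
  then obtain p where p: "length p = 3 + k * (rounds A n + 4 * a + 5)" "solver N (machs N) (space N) p" by blast
  have k1: "1 \<le> k" using N3 by (cases k) (auto simp: N_def)
  have "length p \<le> k * (rounds A n + 4 * a + 8)" using p(1) k1 by (simp add: algebra_simps)
  then have "real (length p) \<le> real k * (real (rounds A n) + 4 * real a + 8)"
    by (metis (mono_tags, lifting) of_nat_add of_nat_le_iff of_nat_mult of_nat_numeral)
  then have "real (length p) * ln (real D) \<le> real k * (real (rounds A n) + 4 * real a + 8) * ln (real D)"
    using D(1) by (intro mult_right_mono) auto
  also have "\<dots> = ln (real N) * (real (rounds A n) + 4 * real a + 8)"
    using D(1) by (simp add: N_def ln_realpow)
  finally show ?thesis using sqrtN p(2) by blast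
qed

end

theorem theorem5:
  fixes \<delta> :: real and \<epsilon> :: "nat \<Rightarrow> real" and A :: mpc_algorithm
  assumes "0 < \<delta>" and "\<delta> < 1"
    and "\<And>n. 0 < \<epsilon> n" and "\<And>n. \<epsilon> n < 1"
    and "\<exists>k::nat. \<epsilon> \<in> \<Omega>(\<lambda>n. 1 / ln (real n) ^ k)"
    and "one_vs_two_cycle_conjecture"
    and "(\<lambda>n. real (local_space A n)) \<in> O(\<lambda>n. real n powr \<delta>)"
    and "poly_bounded (\<lambda>n. machines A n * local_space A n)"
    and "poly_bounded (word_range A)"
    and "component_stable A"
    and "\<forall>\<^sub>F n in sequentially. solves_almost_spanning_forest A n (\<epsilon> n) (1 - 1 / real n)"
  shows "(\<lambda>n. real (rounds A n)) \<in> \<Omega>(\<lambda>n. ln (1 / \<epsilon> n))"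
proof -
  obtain f where f: "stable_witness A f" using assms(10) by (auto simp: component_stable_def stable_witness_def)
  obtain q c0 where c0: "c0 > 0" and eps: "\<forall>\<^sub>F n in sequentially. c0 * norm (1 / ln (real n) ^ q) \<le> norm (\<epsilon> n)"
    using assms(5) by (auto elim!: landau_omega.bigE)
  obtain C where C: "C > 0" and space: "\<forall>\<^sub>F n in sequentially. norm (real (local_space A n)) \<le> C * norm (real n powr \<delta>)"
    using assms(7) by (auto elim!: landau_o.bigE)
  obtain a where a: "\<forall>\<^sub>F n in sequentially. machines A n * local_space A n \<le> n ^ a"
    using poly_bounded_power[OF assms(8)] by blast
  obtain b where b: "\<forall>\<^sub>F n in sequentially. word_range A n \<le> n ^ b"
    using poly_bounded_power[OF assms(9)] by blast
  interpret parameters \<delta> C a b by unfold_locales (use assms(1,2) C in auto)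
  obtain c1 where c1: "c1 > 0"
    and low: "\<forall>\<^sub>F N in sequentially. \<forall>p. solver N (machs N) (space N) p \<longrightarrow> c1 * ln (real N) \<le> real (length p)"
  proof -
    have "poly_bounded machs" unfolding machs_def by (rule machine_bound_poly)
    moreover have "0 < machs n" for n by (simp add: machs_def machine_bound_def)
    ultimately show ?thesis
      using solver_lower_bound[OF assms(6) _ space_bigo _ _ baseline] assms(2) that by auto
  qed
  \<comment> \<open>\<open>D\<close> will be about \<open>(1 / \<epsilon> n) powr \<kappa>\<close>.
    As \<open>q * \<kappa> \<le> 1 / 4\<close>, it stays below \<open>sqrt (ln n)\<close>, with
    another factor \<open>ln n powr (1 / 4)\<close> left for the constant \<open>c0\<close>; as
    \<open>\<kappa> \<le> 1 / 4\<close>, the paths are short enough for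
    \<open>4 * (D + 1) * \<epsilon> n < 1\<close>.\<close>
  define \<kappa> where "\<kappa> = 1 / (4 * (real q + 1))"
  have \<kappa>: "0 < \<kappa>" "\<kappa> \<le> 1 / 4" "real q * \<kappa> \<le> 1 / 4" by (auto simp: \<kappa>_def field_simps)
  \<comment> \<open>The first bound makes \<open>D\<close> at least 2 as soon as
    \<open>e * ln (1 / \<epsilon> n)\<close> exceeds 1; the second one closes the final chain of
    inequalities.\<close>
  define e where "e = min (\<kappa> / 2) (c1 * \<kappa> / (2 * (4 * real a + 9)))"
  have e: "0 < e" "e \<le> \<kappa> / 2" "e * (4 * real a + 9) \<le> c1 * \<kappa> / 2"
  proof -
    show "0 < e" using c1 \<kappa> by (simp add: e_def)
    show "e \<le> \<kappa> / 2" unfolding e_def by (rule min.cobounded1)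
    have "e \<le> c1 * \<kappa> / (2 * (4 * real a + 9))" by (simp add: e_def)
    then show "e * (4 * real a + 9) \<le> c1 * \<kappa> / 2" by (simp add: field_simps)
  qed
  \<comment> \<open>A single threshold suffices, since the \<open>N\<close> found for
    \<open>n\<close> is at least \<open>sqrt n\<close>.\<close>
  obtain N0 where N0: "\<And>N. N0 \<le> N \<Longrightarrow> good N \<and> (\<forall>p. solver N (machs N) (space N) p \<longrightarrow> c1 * ln (real N) \<le> real (length p))"
    using eventually_conj[OF eventually_good low] by (auto simp: eventually_sequentially)
  have "\<forall>\<^sub>F n in sequentially. e * norm (ln (1 / \<epsilon> n)) \<le> norm (real (rounds A n))"
  proof -
    have "\<forall>\<^sub>F n in sequentially. real N0 \<le> sqrt (real n)" by real_asymp
    moreover have "\<forall>\<^sub>F n in sequentially. 12 * sqrt (ln (real n)) \<le> sqrt (real n)" by real_asymp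
    moreover have "\<forall>\<^sub>F n in sequentially. 8 * (sqrt (ln (real n)) + 1)\<^sup>2 + 1 < real n" by real_asymp
    moreover have "\<forall>\<^sub>F n in sequentially. c0 powr (- \<kappa>) \<le> ln (real n) powr (1 / 4)" by real_asymp
    moreover have "\<forall>\<^sub>F n in sequentially. 1 \<le> ln (real n)" by real_asymp
    ultimately show ?thesis
      using eps space a b assms(11) eventually_ge_at_top[of 12]
    proof eventually_elim
      case (elim n)
      note solves = elim(10)
      let ?T = "real (rounds A n)" and ?r = "1 / \<epsilon> n"
      have r1: "1 < ?r" using assms(3,4) by simp
      show ?case
      proof (rule ccontr)
        \<comment> \<open>Each large \<open>n\<close> is treated separately: too few rounds at this
          \<open>n\<close> give a program that is too short at one \<open>N\<close>.\<close>
        assume "\<not> ?case"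
        then have T: "?T < e * ln ?r" using r1 by simp
        \<comment> \<open>At least one round is made, so a violation forces
          \<open>1 / \<epsilon> n\<close> to be large; this settles the case of bounded
          \<open>1 / \<epsilon> n\<close>.\<close>
        have "1 \<le> ?T" using rounds_pos[OF solves] elim(11) by simp
        then have er: "1 < e * ln ?r" using T by linarith
        define y where "y = ?r powr \<kappa>"
        have lny: "ln y = \<kappa> * ln ?r" using r1 by (simp add: y_def ln_powr)
        have "2 < ln y"
        proof -
          have "e * ln ?r \<le> \<kappa> / 2 * ln ?r" using e(2) r1 by (intro mult_right_mono) auto
          then show ?thesis using er lny by simp
        qed
        then have y4: "4 \<le> y"
        proof -
          have "ln (4::real) \<le> 2" using ln_add_one_self_le_self[of 1] ln_realpow[of 2 2] by simp
          moreover have "0 < y" using assms(3)[of n] by (simp add: y_def)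
          ultimately show ?thesis using \<open>2 < ln y\<close> by (smt (verit) ln_less_cancel_iff)
        qed
        \<comment> \<open>The only use of the lower bound on \<epsilon>:
          \<open>1 / \<epsilon> n\<close> is at most \<open>ln n ^ q / c0\<close>.\<close>
        have yz: "y \<le> sqrt (ln (real n))"
        proof -
          let ?z = "ln (real n)"
          have zq: "0 < ?z ^ q" using elim(5) by simp
          have "c0 / ?z ^ q \<le> \<epsilon> n" using elim(6) zq assms(3)[of n] by simp
          then have "?r \<le> ?z ^ q / c0" using zq c0 assms(3)[of n] by (simp add: field_simps)
          then have "y \<le> (?z ^ q / c0) powr \<kappa>"
            unfolding y_def using assms(3)[of n] \<kappa> by (intro powr_mono2) auto
          also have "\<dots> = ?z powr (real q * \<kappa>) * c0 powr (- \<kappa>)"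
            using elim(5) c0 by (simp add: powr_divide powr_minus_divide powr_realpow[symmetric] powr_powr)
          also have "\<dots> \<le> ?z powr (1 / 4) * ?z powr (1 / 4)"
            using elim(4,5) \<kappa>(3) by (intro mult_mono powr_mono) auto
          also have "\<dots> = ?z powr (1 / 2)" by (simp add: powr_add[symmetric])
          also have "\<dots> = sqrt ?z" using elim(5) by (simp add: powr_half_sqrt)
          finally show ?thesis .
        qed
        define D where "D = nat \<lfloor>y\<rfloor>"
        have D: "real D \<le> y" "y < real D + 1" "2 \<le> D" using y4 unfolding D_def by linarith+
        have "8 * (D + 1)\<^sup>2 + 1 < n"
        proof -
          have "(real D + 1)\<^sup>2 \<le> (sqrt (ln (real n)) + 1)\<^sup>2" using D(1) yz by (intro power_mono) auto
          then have "8 * (real D + 1)\<^sup>2 + 1 < real n" using elim(3) by linarith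
          then have "real (8 * (D + 1)\<^sup>2 + 1) < real n" by (simp add: add.commute)
          then show ?thesis by (simp only: of_nat_less_iff)
        qed
        moreover have "4 * real (D + 1) * \<epsilon> n < 1"
        proof -
          have "y ^ 4 = y powr real 4" using y4 by (intro powr_realpow[symmetric]) simp
          also have "\<dots> = ?r powr (\<kappa> * 4)" by (simp add: y_def powr_powr)
          also have "\<dots> \<le> ?r powr 1" using r1 \<kappa> by (intro powr_mono) auto
          finally have "y ^ 4 \<le> ?r" using r1 by simp
          moreover have "4 * (y + 1) < y ^ 4"
          proof -
            have "8 * y \<le> y ^ 3 * y" using y4 power_mono[of 4 y 3] by (intro mult_right_mono) auto
            then show ?thesis using y4 by (simp add: power_Suc2[symmetric] del: power_Suc)
          qed
          ultimately have "4 * real (D + 1) < ?r" using D(1) by simp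
          then show ?thesis using assms(3)[of n] by (simp add: field_simps)
        qed
        moreover have "machines A n \<le> n ^ a"
        proof -
          have "machines A n * 1 \<le> machines A n * local_space A n"
            using local_space_pos[OF solves] elim(11) by (intro mult_le_mono2) auto
          then show ?thesis using elim(8) by linarith
        qed
        moreover have "good N" if "sqrt (real n) \<le> real N" for N
          using N0[of N] that elim(1) by linarith
        ultimately obtain N p where Np: "sqrt (real n) \<le> real N" "solver N (machs N) (space N) p"
          "real (length p) * ln (real D) \<le> ln (real N) * (?T + 4 * real a + 8)"
          using fast[OF f solves _ _ _ D(3) order_trans[OF D(1) yz] assms(3)] elim by auto
        have "N0 \<le> N" using Np(1) elim(1) by linarith
        then have lenp: "c1 * ln (real N) \<le> real (length p)" using N0 Np(2) by blast
        have N3: "3 \<le> N" using N0[OF \<open>N0 \<le> N\<close>] by (simp add: good_def)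
        have lnN: "0 < ln (real N)" using N3 by simp
        \<comment> \<open>Rounding down costs at most half of the logarithm:
          \<open>D > y - 1\<close>, and this is at least \<open>sqrt y\<close>.\<close>
        have "ln y / 2 \<le> ln (real D)"
        proof -
          have "2 \<le> sqrt y" using y4 real_sqrt_le_mono[of 4 y] by simp
          then have "2 * sqrt y \<le> sqrt y * sqrt y" using y4 by (intro mult_right_mono) auto
          then have "sqrt y \<le> real D" using D(2) y4 \<open>2 \<le> sqrt y\<close> by simp
          then have "ln (sqrt y) \<le> ln (real D)" using y4 by (intro ln_mono) auto
          then show ?thesis using y4 by (simp add: ln_sqrt)
        qed
        then have "c1 * (ln y / 2) \<le> c1 * ln (real D)" using c1 by (intro mult_left_mono) auto
        moreover have "ln (real N) * (c1 * ln (real D)) \<le> ln (real N) * (?T + 4 * real a + 8)"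
        proof -
          have "c1 * ln (real N) * ln (real D) \<le> real (length p) * ln (real D)"
            using lenp D(3) by (intro mult_right_mono) auto
          then show ?thesis using Np(3) by (simp add: mult.commute mult.left_commute)
        qed
        then have "c1 * ln (real D) \<le> ?T + 4 * real a + 8" using lnN by simp
        ultimately have "c1 * (ln y / 2) < e * ln ?r + 4 * real a + 8" using T by linarith
        \<comment> \<open>The additive constants are absorbed by
          \<open>1 < e * ln (1 / \<epsilon> n)\<close>.\<close>
        also have "\<dots> \<le> e * ln ?r + (4 * real a + 8) * (e * ln ?r)"
          using er mult_left_mono[of 1 "e * ln ?r" "4 * real a + 8"] by simp
        also have "\<dots> = e * (4 * real a + 9) * ln ?r" by (simp add: algebra_simps)
        also have "\<dots> \<le> c1 * \<kappa> / 2 * ln ?r" using e(3) r1 by (intro mult_right_mono) auto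
        also have "\<dots> = c1 * (ln y / 2)" by (simp add: lny)
        finally show False by simp
      qed
    qed
  qed
  then show ?thesis by (rule landau_omega.bigI[OF e(1)])
qed

end
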